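(* Let $H$ be a finite-dimensional Hopf algebra over a field $K$, with antipode $S$. Then the order of $[H^*]$ in the Picard group $\mathrm{Pic}(H)$ is the least common multiple of the order of the class of $S^2$ in $\mathrm{Out}(H)$ and the order of the modular element $\mathcal{G}$ of $H^*$ in the group $G(H^* )$ of grouplike elements of $H^*$.
   Context: Algebras are associative unital $K$-algebras, and bimodules are bimodules on which $K$ acts centrally. For an algebra $R$, an $R$-bimodule $P$ is invertible if there is an $R$-bimodule $Q$ with $P\otimes_R Q\simeq R\simeq Q\otimes_R P$ as bimodules; $\mathrm{Pic}(R)$ is the group of isomorphism classes $[P]$ of invertible $R$-bimodules, with $[U][V]=[U\otimes_R V]$. $\mathrm{Aut}(R)$ is the group of $K$-algebra automorphisms of $R$, $\mathrm{Inn}(R)$ the normal subgroup of inner automorphisms $r\mapsto u^{-1}ru$ ($u\in R$ invertible), and $\mathrm{Out}(R)=\mathrm{Aut}(R)/\mathrm{Inn}(R)$. $R^*=\mathrm{Hom}_K(R,K)$ is an $R$-bimodule by $(r\rightharpoonup r^* )(a)=r^*(ar)$ and $(r^*\leftharpoonup r)(a)=r^*(ra)$. A finite-dimensional Hopf algebra $H$ is a Frobenius algebra, so $H^*$ is an invertible $H$-bimodule and $[H^*]\in\mathrm{Pic}(H)$ is defined. Modular element: let $\varepsilon$ be the counit of $H$ and $t\in H$ a non-zero left integral, i.e. $ht=\varepsilon(h)t$ for all $h\in H$ (the space of left integrals is one-dimensional). The modular element $\mathcal{G}\in H^*$ is the linear map with $th=\mathcal{G}(h)t$ for all $h\in H$;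 it is an algebra morphism $H\to K$, i.e. a grouplike element of the dual Hopf algebra $H^*$ (whose product is convolution and whose identity is $\varepsilon$). *)

theory Defs
  imports
    "HOL-Algebra.Free_Abelian_Groups"
    "HOL-Algebra.Multiplicative_Group"
begin

section \<open>Bimodules and tensor products\<close>

text \<open>
  The ring is a type of class \<open>ring_1\<close>; a bimodule is an explicit structure on a carrier set.
  Its underlying abelian group is a \<open>comm_group\<close> of HOL-Algebra, so the addition of the
  bimodule \<open>M\<close> is written multiplicatively as \<open>\<otimes>\<^bsub>M\<^esub>\<close>, with neutral element \<open>\<one>\<^bsub>M\<^esub>\<close>.
\<close>

record ('r, 'm) bimodule = "'m monoid" +
  lact :: "'r \<Rightarrow> 'm \<Rightarrow> 'm"
  ract :: "'m \<Rightarrow> 'r \<Rightarrow> 'm"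

locale is_bimodule = comm_group M
  for M :: "('r::ring_1, 'm) bimodule" (structure) +
  assumes lact_closed: "m \<in> carrier M \<Longrightarrow> lact M r m \<in> carrier M"
    and ract_closed: "m \<in> carrier M \<Longrightarrow> ract M m r \<in> carrier M"
    and lact_add: "m \<in> carrier M \<Longrightarrow> n \<in> carrier M \<Longrightarrow>
          lact M r (m \<otimes> n) = lact M r m \<otimes> lact M r n"
    and ract_add: "m \<in> carrier M \<Longrightarrow> n \<in> carrier M \<Longrightarrow>
          ract M (m \<otimes> n) r = ract M m r \<otimes> ract M n r"
    and lact_plus: "m \<in> carrier M \<Longrightarrow> lact M (r + s) m = lact M r m \<otimes> lact M s m"
    and ract_plus: "m \<in> carrier M \<Longrightarrow> ract M m (r + s) = ract M m r \<otimes> ract M m s"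
    and lact_lact: "m \<in> carrier M \<Longrightarrow> lact M (r * s) m = lact M r (lact M s m)"
    and ract_ract: "m \<in> carrier M \<Longrightarrow> ract M m (r * s) = ract M (ract M m r) s"
    and lact_one: "m \<in> carrier M \<Longrightarrow> lact M 1 m = m"
    and ract_one: "m \<in> carrier M \<Longrightarrow> ract M m 1 = m"
    and lact_ract: "m \<in> carrier M \<Longrightarrow> ract M (lact M r m) s = lact M r (ract M m s)"

definition bimodule_iso ::
  "('r::ring_1, 'm) bimodule \<Rightarrow> ('r, 'n) bimodule \<Rightarrow> bool" (infix \<open>\<cong>\<^sub>b\<close> 50)
  where "M \<cong>\<^sub>b N \<longleftrightarrow> (\<exists>f \<in> iso M N. \<forall>r. \<forall>m \<in> carrier M.
      f (lact M r m) = lact N r (f m) \<and> f (ract M m r) = ract N (f m) r)"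

text \<open>
  \<open>U \<otimes>\<^sub>R V\<close> is the free abelian group on \<open>carrier U \<times> carrier V\<close> modulo biadditivity and
  \<open>ur \<otimes> v = u \<otimes> rv\<close>; its elements are cosets of finitely supported integer combinations
  of pairs.
\<close>

type_synonym ('u, 'v) tensor = "(('u \<times> 'v) \<Rightarrow>\<^sub>0 int) set"

definition tensor_free ::
  "('r::ring_1, 'u) bimodule \<Rightarrow> ('r, 'v) bimodule \<Rightarrow> ('u \<times> 'v \<Rightarrow>\<^sub>0 int) monoid"
  where "tensor_free U V = free_Abelian_group (carrier U \<times> carrier V)"

definition tensor_rel ::
  "('r::ring_1, 'u) bimodule \<Rightarrow> ('r, 'v) bimodule \<Rightarrow> ('u, 'v) tensor"
  where "tensor_rel U V = generate (tensor_free U V)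
     ({frag_of (u \<otimes>\<^bsub>U\<^esub> u', v) - frag_of (u, v) - frag_of (u', v) |u u' v.
          u \<in> carrier U \<and> u' \<in> carrier U \<and> v \<in> carrier V} \<union>
      {frag_of (u, v \<otimes>\<^bsub>V\<^esub> v') - frag_of (u, v) - frag_of (u, v') |u v v'.
          u \<in> carrier U \<and> v \<in> carrier V \<and> v' \<in> carrier V} \<union>
      {frag_of (ract U u r, v) - frag_of (u, lact V r v) |u r v.
          u \<in> carrier U \<and> v \<in> carrier V})"

definition tensor_class ::
  "('r::ring_1, 'u) bimodule \<Rightarrow> ('r, 'v) bimodule \<Rightarrow> ('u \<times> 'v \<Rightarrow>\<^sub>0 int) \<Rightarrow> ('u, 'v) tensor"
  where "tensor_class U V x = tensor_rel U V #>\<^bsub>tensor_free U V\<^esub> x"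

definition pure_tensor ::
  "('r::ring_1, 'u) bimodule \<Rightarrow> ('r, 'v) bimodule \<Rightarrow> 'u \<Rightarrow> 'v \<Rightarrow> ('u, 'v) tensor"
  where "pure_tensor U V u v = tensor_class U V (frag_of (u, v))"

text \<open>
  The map \<open>f \<otimes> g\<close> from \<open>U \<otimes> V\<close> to \<open>U' \<otimes> V'\<close>. A map on cosets is given, as for products of
  cosets in HOL-Algebra, by the union over all representatives; for maps compatible with the
  relations the union is a single coset.
\<close>

definition tensor_map ::
  "('s::ring_1, 'u2) bimodule \<Rightarrow> ('s, 'v2) bimodule \<Rightarrow> ('u \<Rightarrow> 'u2) \<Rightarrow> ('v \<Rightarrow> 'v2) \<Rightarrow>
     ('u, 'v) tensor \<Rightarrow> ('u2, 'v2) tensor"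
  where "tensor_map U' V' f g X =
    (\<Union>x\<in>X. tensor_class U' V' (frag_extend (\<lambda>(u, v). frag_of (f u, g v)) x))"

definition tensor_bimodule ::
  "('r::ring_1, 'u) bimodule \<Rightarrow> ('r, 'v) bimodule \<Rightarrow> ('r, ('u, 'v) tensor) bimodule"
  where "tensor_bimodule U V =
    \<lparr>carrier = carrier (tensor_free U V Mod tensor_rel U V),
     monoid.mult = monoid.mult (tensor_free U V Mod tensor_rel U V),
     one = one (tensor_free U V Mod tensor_rel U V),
     lact = (\<lambda>r. tensor_map U V (lact U r) id),
     ract = (\<lambda>X r. tensor_map U V id (\<lambda>v. ract V v r) X)\<rparr>"

text \<open>
  The additive map on a tensor product with \<open>u \<otimes> v \<mapsto> f u v\<close>; it is meaningful when \<open>f\<close> is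
  biadditive and balanced, for then all representatives give the same value.
\<close>

definition tensor_lift :: "('u \<Rightarrow> 'v \<Rightarrow> 'c::ring_1) \<Rightarrow> ('u, 'v) tensor \<Rightarrow> 'c"
  where "tensor_lift f X = the_elem
    ((\<lambda>x. \<Sum>p\<in>Poly_Mapping.keys x. of_int (Poly_Mapping.lookup x p) * f (fst p) (snd p)) ` X)"

definition tensor_assoc ::
  "('r::ring_1, 'u) bimodule \<Rightarrow> ('r, 'v) bimodule \<Rightarrow> ('r, 'w) bimodule \<Rightarrow>
     (('u, 'v) tensor, 'w) tensor \<Rightarrow> ('u, ('v, 'w) tensor) tensor"
  where "tensor_assoc U V W = (SOME a.
    a \<in> hom (tensor_bimodule (tensor_bimodule U V) W) (tensor_bimodule U (tensor_bimodule V W)) \<and>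
    (\<forall>u\<in>carrier U. \<forall>v\<in>carrier V. \<forall>w\<in>carrier W.
       a (pure_tensor (tensor_bimodule U V) W (pure_tensor U V u v) w) =
       pure_tensor U (tensor_bimodule V W) u (pure_tensor V W v w)))"


section \<open>Algebras, Picard groups and outer automorphisms\<close>

locale unital_algebra = vector_space scale
  for scale :: "'k::field \<Rightarrow> 'r::ring_1 \<Rightarrow> 'r" +
  assumes scale_mult_left: "scale k (a * b) = scale k a * b"
    and scale_mult_right: "scale k (a * b) = a * scale k b"

text \<open>
  A bimodule over a \<open>K\<close>-algebra needs no separate \<open>K\<close>-structure: \<open>K\<close> acts through the unit of
  the algebra, and centrality says that its left and right actions agree.
\<close>

definition central_bimodule ::
  "('k::field \<Rightarrow> 'r::ring_1 \<Rightarrow> 'r) \<Rightarrow> ('r, 'm) bimodule \<Rightarrow> bool"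
  where "central_bimodule scale M \<longleftrightarrow> is_bimodule M \<and>
    (\<forall>k. \<forall>m\<in>carrier M. lact M (scale k 1) m = ract M m (scale k 1))"

definition regular_bimodule :: "('r::ring_1, 'r) bimodule"
  where "regular_bimodule = \<lparr>carrier = UNIV, monoid.mult = (+), one = 0, lact = (*), ract = (*)\<rparr>"

text \<open>
  Isomorphism classes have to be formed inside a fixed type. An invertible bimodule over \<open>R\<close> is
  finitely generated projective as a left module, hence isomorphic to a bimodule carried by a
  subset of \<open>R\<^sup>n\<close>, and so by a subset of the type \<open>nat \<Rightarrow> 'r\<close>. Therefore
  \<open>small_bimodule\<close> represents all isomorphism classes of invertible bimodules, and inverses may
  be sought among the bimodules of this type. The class of a bimodule carried by any other type
  consists of the isomorphic bimodules carried by \<open>nat \<Rightarrow> 'r\<close>.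
\<close>

type_synonym 'r small_bimodule = "('r, nat \<Rightarrow> 'r) bimodule"

definition invertible_bimodule ::
  "('k::field \<Rightarrow> 'r::ring_1 \<Rightarrow> 'r) \<Rightarrow> ('r, 'm) bimodule \<Rightarrow> bool"
  where "invertible_bimodule scale P \<longleftrightarrow> central_bimodule scale P \<and>
    (\<exists>Q :: 'r small_bimodule. central_bimodule scale Q \<and>
       tensor_bimodule P Q \<cong>\<^sub>b (regular_bimodule :: ('r, 'r) bimodule) \<and>
       tensor_bimodule Q P \<cong>\<^sub>b (regular_bimodule :: ('r, 'r) bimodule))"

definition iso_class ::
  "('k::field \<Rightarrow> 'r::ring_1 \<Rightarrow> 'r) \<Rightarrow> ('r, 'm) bimodule \<Rightarrow> 'r small_bimodule set"
  where "iso_class scale P = {W. central_bimodule scale W \<and> W \<cong>\<^sub>b P}"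

definition Pic :: "('k::field \<Rightarrow> 'r::ring_1 \<Rightarrow> 'r) \<Rightarrow> 'r small_bimodule set monoid"
  where "Pic scale =
    \<lparr>carrier = {iso_class scale P |P :: 'r small_bimodule. invertible_bimodule scale P},
     monoid.mult = (\<lambda>A B. \<Union>U\<in>A. \<Union>V\<in>B. iso_class scale (tensor_bimodule U V)),
     one = iso_class scale regular_bimodule\<rparr>"

definition Aut :: "('k::field \<Rightarrow> 'r::ring_1 \<Rightarrow> 'r) \<Rightarrow> ('r \<Rightarrow> 'r) monoid"
  where "Aut scale =
    \<lparr>carrier = {f. Vector_Spaces.linear scale scale f \<and> bij f \<and> f 1 = 1 \<and>
                   (\<forall>a b. f (a * b) = f a * f b)},
     monoid.mult = (\<circ>),
     one = id\<rparr>"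

definition Inn :: "('r::ring_1 \<Rightarrow> 'r) set"
  where "Inn = {(\<lambda>r. v * r * u) |u v. u * v = 1 \<and> v * u = 1}"

definition Out :: "('k::field \<Rightarrow> 'r::ring_1 \<Rightarrow> 'r) \<Rightarrow> ('r \<Rightarrow> 'r) set monoid"
  where "Out scale = Aut scale Mod Inn"

definition Out_class :: "('k::field \<Rightarrow> 'r::ring_1 \<Rightarrow> 'r) \<Rightarrow> ('r \<Rightarrow> 'r) \<Rightarrow> ('r \<Rightarrow> 'r) set"
  where "Out_class scale f = Inn #>\<^bsub>Aut scale\<^esub> f"

definition dual_bimodule ::
  "('k::field \<Rightarrow> 'r::ring_1 \<Rightarrow> 'r) \<Rightarrow> ('r, 'r \<Rightarrow> 'k) bimodule"
  where "dual_bimodule scale =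
    \<lparr>carrier = {f. Vector_Spaces.linear scale (*) f},
     monoid.mult = (\<lambda>f g a. f a + g a),
     one = (\<lambda>a. 0),
     lact = (\<lambda>r f a. f (a * r)),
     ract = (\<lambda>f r a. f (r * a))\<rparr>"


section \<open>Hopf algebras\<close>

text \<open>Tensor products over \<open>K\<close> are the case where both actions are scalar multiplication.\<close>

definition space_bimodule ::
  "('k::field \<Rightarrow> 'v::ab_group_add \<Rightarrow> 'v) \<Rightarrow> ('k, 'v) bimodule"
  where "space_bimodule scale = \<lparr>carrier = UNIV, monoid.mult = (+), one = 0,
    lact = scale, ract = (\<lambda>v k. scale k v)\<rparr>"

definition dual_space ::
  "('k::field \<Rightarrow> 'v::ab_group_add \<Rightarrow> 'v) \<Rightarrow> ('k, 'v \<Rightarrow> 'k) bimodule"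
  where "dual_space scale =
    \<lparr>carrier = {f. Vector_Spaces.linear scale (*) f},
     monoid.mult = (\<lambda>f g a. f a + g a),
     one = (\<lambda>a. 0),
     lact = (\<lambda>k f a. k * f a),
     ract = (\<lambda>f k a. k * f a)\<rparr>"

text \<open>The multiplication \<open>(a \<otimes> b)(c \<otimes> d) = ac \<otimes> bd\<close> of \<open>A \<otimes> A\<close>.\<close>

definition tensor_mult ::
  "('k::field \<Rightarrow> 'a::ring_1 \<Rightarrow> 'a) \<Rightarrow> ('a, 'a) tensor \<Rightarrow> ('a, 'a) tensor \<Rightarrow> ('a, 'a) tensor"
  where "tensor_mult scale X Y =
    (\<Union>x\<in>X. \<Union>y\<in>Y. tensor_class (space_bimodule scale) (space_bimodule scale)
       (frag_extend (\<lambda>(a, b). frag_extend (\<lambda>(c, d). frag_of (a * c, b * d)) y) x))"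

abbreviation ground_field :: "('k::field, 'k) bimodule"
  where "ground_field \<equiv> space_bimodule (*)"

abbreviation (in unital_algebra) H :: "('k, 'r) bimodule"
  where "H \<equiv> space_bimodule scale"

abbreviation (in unital_algebra) HH :: "('k, ('r, 'r) tensor) bimodule"
  where "HH \<equiv> tensor_bimodule H H"

text \<open>
  Coassociativity is taken up to the canonical isomorphism \<open>tensor_assoc\<close>. The counit laws are
  equations in \<open>K \<otimes> H\<close> and \<open>H \<otimes> K\<close>, and \<open>tensor_lift (*)\<close> is the multiplication map
  \<open>H \<otimes> H \<rightarrow> H\<close>.
\<close>

locale hopf_algebra = unital_algebra scale
  for scale :: "'k::field \<Rightarrow> 'h::ring_1 \<Rightarrow> 'h" +
  fixes comul :: "'h \<Rightarrow> ('h, 'h) tensor"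
    and counit :: "'h \<Rightarrow> 'k"
    and antipode :: "'h \<Rightarrow> 'h"
  assumes comul_closed: "comul h \<in> carrier HH"
    and comul_add: "comul (a + b) = comul a \<otimes>\<^bsub>HH\<^esub> comul b"
    and comul_scale: "comul (scale k a) = lact HH k (comul a)"
    and counit_linear: "Vector_Spaces.linear scale (*) counit"
    and coassoc: "tensor_assoc H H H (tensor_map HH H comul id (comul h)) =
          tensor_map H HH id comul (comul h)"
    and counit_left: "tensor_map ground_field H counit id (comul h) = pure_tensor ground_field H 1 h"
    and counit_right: "tensor_map H ground_field id counit (comul h) = pure_tensor H ground_field h 1"
    and comul_mult: "comul (a * b) = tensor_mult scale (comul a) (comul b)"
    and comul_one: "comul 1 = pure_tensor H H 1 1"
    and counit_mult: "counit (a * b) = counit a * counit b"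
    and counit_one: "counit 1 = 1"
    and antipode_linear: "Vector_Spaces.linear scale scale antipode"
    and antipode_left: "tensor_lift (*) (tensor_map H H antipode id (comul h)) = scale (counit h) 1"
    and antipode_right: "tensor_lift (*) (tensor_map H H id antipode (comul h)) = scale (counit h) 1"

locale finite_dimensional_hopf_algebra = hopf_algebra +
  assumes finite_dim: "\<exists>B. finite_dimensional_vector_space scale B"

text \<open>
  The dual Hopf algebra: convolution product, unit \<open>\<epsilon>\<close>, counit \<open>f \<mapsto> f(1)\<close>, and comultiplication
  the dual of the multiplication, where \<open>H\<^sup>* \<otimes> H\<^sup>*\<close> is identified with \<open>(H \<otimes> H)\<^sup>*\<close>:
  \<open>\<Delta>(f) = \<Sum> f' \<otimes> f''\<close> is the tensor with \<open>f(ab) = \<Sum> f'(a) f''(b)\<close>.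
\<close>

definition convolution ::
  "('h \<Rightarrow> ('h, 'h) tensor) \<Rightarrow> ('h \<Rightarrow> 'k::field) \<Rightarrow> ('h \<Rightarrow> 'k) \<Rightarrow> 'h \<Rightarrow> 'k"
  where "convolution comul f g = (\<lambda>h. tensor_lift (\<lambda>a b. f a * g b) (comul h))"

definition dual_comul ::
  "('k::field \<Rightarrow> 'h::ring_1 \<Rightarrow> 'h) \<Rightarrow> ('h \<Rightarrow> 'k) \<Rightarrow> ('h \<Rightarrow> 'k, 'h \<Rightarrow> 'k) tensor"
  where "dual_comul scale f =
    (THE X. X \<in> carrier (tensor_bimodule (dual_space scale) (dual_space scale)) \<and>
       (\<forall>a b. tensor_lift (\<lambda>f' f''. f' a * f'' b) X = f (a * b)))"

definition dual_grouplikes ::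
  "('k::field \<Rightarrow> 'h::ring_1 \<Rightarrow> 'h) \<Rightarrow> ('h \<Rightarrow> ('h, 'h) tensor) \<Rightarrow> ('h \<Rightarrow> 'k) \<Rightarrow> ('h \<Rightarrow> 'k) monoid"
  where "dual_grouplikes scale comul counit =
    \<lparr>carrier = {g \<in> carrier (dual_space scale). g 1 = 1 \<and>
        dual_comul scale g = pure_tensor (dual_space scale) (dual_space scale) g g},
     monoid.mult = convolution comul,
     one = counit\<rparr>"

definition left_integral ::
  "('k::field \<Rightarrow> 'h::ring_1 \<Rightarrow> 'h) \<Rightarrow> ('h \<Rightarrow> 'k) \<Rightarrow> 'h \<Rightarrow> bool"
  where "left_integral scale counit t \<longleftrightarrow> (\<forall>h. h * t = scale (counit h) t)"

text \<open>
  In finite dimension the space of left integrals is one-dimensional, so that \<open>g\<close> below exists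
  and does not depend on \<open>t\<close>.
\<close>

definition modular_element ::
  "('k::field \<Rightarrow> 'h::ring_1 \<Rightarrow> 'h) \<Rightarrow> ('h \<Rightarrow> 'k) \<Rightarrow> 'h \<Rightarrow> 'k"
  where "modular_element scale counit =
    (THE g. Vector_Spaces.linear scale (*) g \<and>
       (\<exists>t. t \<noteq> 0 \<and> left_integral scale counit t \<and> (\<forall>h. t * h = scale (g h) t)))"

end

theory Submission
  imports Defs
begin

text \<open>
  Let \<open>\<Lambda>\<close> be a nonzero left integral of \<open>H\<close>. From \<open>S h \<Lambda>\<^sub>1 \<otimes> \<Lambda>\<^sub>2 = \<Lambda>\<^sub>1 \<otimes> h \<Lambda>\<^sub>2\<close> one sees that \<open>f \<mapsto> \<Lambda>\<^sub>1 f(\<Lambda>\<^sub>2)\<close> is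
  injective on \<open>H\<^sup>*\<close>, so some \<open>\<lambda>\<close> satisfies \<open>\<Lambda>\<^sub>1 \<lambda>(\<Lambda>\<^sub>2) = 1\<close>. It is a left integral of \<open>H\<^sup>*\<close>, the form
  \<open>(x, y) \<mapsto> \<lambda>(xy)\<close> is nondegenerate, and \<open>S x = \<Lambda>\<^sub>1 \<lambda>(x \<Lambda>\<^sub>2)\<close>. Hence \<open>H\<^sup>*\<close> is the regular bimodule
  twisted on the right by the automorphism \<open>\<nu>\<close> with \<open>\<lambda>(rx) = \<lambda>(x \<nu>(r))\<close>, and \<open>[H\<^sup>*]\<^sup>n = 1\<close> iff \<open>\<nu>\<^sup>n\<close> is
  inner.

  Moving an element across \<open>\<Delta> \<Lambda>\<close> from the right, where \<open>\<Lambda> h = \<G>(h) \<Lambda>\<close>, gives \<open>\<nu> = S\<^sup>2 \<circ> w\<close> with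
  \<open>w x = x\<^sub>1 \<gamma>(x\<^sub>2)\<close> and \<open>\<gamma> = \<G> \<circ> S\<close>, the inverse of \<open>\<G>\<close>. The factors commute, and \<open>w\<^sup>n\<close> is the map
  belonging to \<open>\<gamma>\<^sup>n\<close>, so \<open>\<epsilon> \<circ> \<nu>\<^sup>n = \<gamma>\<^sup>n\<close>. As \<open>\<epsilon>\<close> is invariant under inner automorphisms, \<open>\<nu>\<^sup>n\<close> is inner
  iff \<open>\<G>\<^sup>n = \<epsilon>\<close> and \<open>S\<^sup>2\<^sup>n\<close> is inner.
\<close>

section \<open>Tensor products of bimodules\<close>

text \<open>Neither a nonzero integral nor bijectivity of the antipode is among the axioms, so both
  have to be produced. The integral is a partial trace over a basis. Bijectivity of
  \<open>antipode\<close> appears only at the end, when a linear map is found that undoes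
  \<open>antipode\<close> after a winding map and finite dimension can be applied. Until then every
  identity must avoid the inverse of the antipode, which dictates the side on which S stands in the
  shift rules. Elements of a tensor product are cosets, and maps on them are unions over
  representatives. This is hidden behind the universal property; afterwards a coproduct is used only
  through Sweedler sums over one fixed basis, where the Hopf axioms become rules for finite sums.
  The Picard group lives on bimodules over one carrier type, while the dual and all tensor products
  live on others. Embedding the carrier of an invertible bimodule into that type is what makes
  isomorphism classes nonempty and the product well defined. Orders are compared through the
  exponents that kill an element, which treats infinite order, recorded as 0, like any
  other.\<close>

lemma comm_group_cong:
  assumes "comm_group G" "carrier G' = carrier G" "monoid.mult G' = monoid.mult G" "one G' = one G"
  shows "comm_group G'"
proof -
  interpret G: comm_group G by fact
  show ?thesis
    by (rule comm_groupI)
      (simp_all add: assms(2-4) G.m_assoc G.l_inv_ex, simp add: G.m_comm)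
qed

lemma hom_eq_on_generate:
  assumes "group G" "group H" "f \<in> hom G H" "g \<in> hom G H" "X \<subseteq> carrier G"
    and eq: "\<And>x. x \<in> X \<Longrightarrow> f x = g x" and x: "x \<in> generate G X"
  shows "f x = g x"
proof -
  interpret F: group_hom G H f by (simp add: assms group_hom_axioms_def group_hom_def)
  interpret G: group_hom G H g by (simp add: assms group_hom_axioms_def group_hom_def)
  from x have "x \<in> carrier G \<and> f x = g x"
  proof (induction rule: generate.induct)
    case (incl h) then show ?case using assms(5) eq by auto
  next
    case (inv h) then show ?case using assms(5) eq by auto
  qed auto
  then show ?thesis ..
qed

text \<open>The target is an arbitrary \<open>monoid_scheme\<close>, so that bimodules, spaces and
  the bare additive group of a ring can all receive maps from a tensor product.\<close>

definition balanced ::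
  "('r::ring_1, 'u) bimodule \<Rightarrow> ('r, 'v) bimodule \<Rightarrow> ('w, 'x) monoid_scheme \<Rightarrow> ('u \<Rightarrow> 'v \<Rightarrow> 'w) \<Rightarrow> bool"
  where "balanced U V W f \<longleftrightarrow>
    (\<forall>v\<in>carrier V. (\<lambda>u. f u v) \<in> hom U W) \<and> (\<forall>u\<in>carrier U. f u \<in> hom V W) \<and>
    (\<forall>u\<in>carrier U. \<forall>v\<in>carrier V. \<forall>r. f (ract U u r) v = f u (lact V r v))"

lemma balancedI:
  assumes "\<And>v. v \<in> carrier V \<Longrightarrow> (\<lambda>u. f u v) \<in> hom U W"
    and "\<And>u. u \<in> carrier U \<Longrightarrow> f u \<in> hom V W"
    and "\<And>u v r. u \<in> carrier U \<Longrightarrow> v \<in> carrier V \<Longrightarrow> f (ract U u r) v = f u (lact V r v)"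
  shows "balanced U V W f"
  using assms by (simp add: balanced_def)

lemma balancedD:
  assumes "balanced U V W f"
  shows "v \<in> carrier V \<Longrightarrow> (\<lambda>u. f u v) \<in> hom U W"
    and "u \<in> carrier U \<Longrightarrow> f u \<in> hom V W"
    and "u \<in> carrier U \<Longrightarrow> v \<in> carrier V \<Longrightarrow> f (ract U u r) v = f u (lact V r v)"
    and "u \<in> carrier U \<Longrightarrow> v \<in> carrier V \<Longrightarrow> f u v \<in> carrier W"
    and "u \<in> carrier U \<Longrightarrow> u' \<in> carrier U \<Longrightarrow> v \<in> carrier V \<Longrightarrow> f (u \<otimes>\<^bsub>U\<^esub> u') v = f u v \<otimes>\<^bsub>W\<^esub> f u' v"
    and "u \<in> carrier U \<Longrightarrow> v \<in> carrier V \<Longrightarrow> v' \<in> carrier V \<Longrightarrow> f u (v \<otimes>\<^bsub>V\<^esub> v') = f u v \<otimes>\<^bsub>W\<^esub> f u v'"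
  using assms by (auto simp: balanced_def hom_def Pi_iff)

section \<open>The tensor product as a quotient of a free abelian group\<close>

definition tensor_relators ::
  "('r::ring_1, 'u) bimodule \<Rightarrow> ('r, 'v) bimodule \<Rightarrow> ('u, 'v) tensor"
  where "tensor_relators U V =
     {frag_of (u \<otimes>\<^bsub>U\<^esub> u', v) - frag_of (u, v) - frag_of (u', v) |u u' v.
          u \<in> carrier U \<and> u' \<in> carrier U \<and> v \<in> carrier V} \<union>
      {frag_of (u, v \<otimes>\<^bsub>V\<^esub> v') - frag_of (u, v) - frag_of (u, v') |u v v'.
          u \<in> carrier U \<and> v \<in> carrier V \<and> v' \<in> carrier V} \<union>
      {frag_of (ract U u r, v) - frag_of (u, lact V r v) |u r v.
          u \<in> carrier U \<and> v \<in> carrier V}"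

lemma tensor_rel_eq: "tensor_rel U V = generate (tensor_free U V) (tensor_relators U V)"
  by (simp add: tensor_rel_def tensor_relators_def)

lemma comm_group_tensor_free: "comm_group (tensor_free U V)"
  by (simp add: tensor_free_def abelian_free_Abelian_group)

lemma keys_diff_subset:
  "Poly_Mapping.keys a \<subseteq> S \<Longrightarrow> Poly_Mapping.keys b \<subseteq> S \<Longrightarrow> Poly_Mapping.keys (a - b) \<subseteq> S" for a b :: "'a \<Rightarrow>\<^sub>0 int"
  using keys_diff[of a b] by blast

locale bimodule_pair = U: is_bimodule U + V: is_bimodule V
  for U :: "('r::ring_1, 'u) bimodule" and V :: "('r, 'v) bimodule"
begin

abbreviation (input) F where "F \<equiv> tensor_free U V"
abbreviation (input) N where "N \<equiv> tensor_rel U V"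
abbreviation (input) T where "T \<equiv> tensor_bimodule U V"

sublocale F: comm_group "tensor_free U V" by (rule comm_group_tensor_free)

lemma in_F: "x \<in> carrier F \<longleftrightarrow> Poly_Mapping.keys x \<subseteq> carrier U \<times> carrier V"
  by (simp add: tensor_free_def)

lemma F_simps [simp]: "x \<otimes>\<^bsub>F\<^esub> y = x + y" "\<one>\<^bsub>F\<^esub> = 0"
  by (simp_all add: tensor_free_def)

lemma inv_F: "x \<in> carrier F \<Longrightarrow> inv\<^bsub>F\<^esub> x = - x"
  by (simp add: tensor_free_def)

lemma frag_of_in_F [simp]: "frag_of (u, v) \<in> carrier F \<longleftrightarrow> u \<in> carrier U \<and> v \<in> carrier V"
  by (simp add: in_F)

lemma diff_in_F: "x \<in> carrier F \<Longrightarrow> y \<in> carrier F \<Longrightarrow> x - y \<in> carrier F"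
  by (simp add: in_F keys_diff_subset)

lemma relators_in_F: "tensor_relators U V \<subseteq> carrier F"
  unfolding tensor_relators_def
  by (auto intro!: diff_in_F simp: U.ract_closed V.lact_closed)

lemma N_subgroup: "subgroup N F"
  unfolding tensor_rel_eq by (rule F.generate_is_subgroup[OF relators_in_F])

lemma N_normal: "N \<lhd> F"
  by (simp add: F.normal_iff_subgroup N_subgroup)

lemma tensor_sel:
  "carrier T = carrier (F Mod N)" "monoid.mult T = monoid.mult (F Mod N)" "one T = N"
  by (simp_all add: tensor_bimodule_def)

lemma comm_group_T: "comm_group T"
  by (rule comm_group_cong[OF F.abelian_FactGroup[OF N_subgroup]])
    (simp_all add: tensor_bimodule_def)

sublocale T: comm_group "tensor_bimodule U V" by (rule comm_group_T)

lemma tensor_class_hom: "tensor_class U V \<in> hom F T"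
proof -
  have "(\<lambda>x. tensor_class U V x) \<in> hom F (F Mod N)"
    unfolding tensor_class_def by (rule normal.r_coset_hom_Mod[OF N_normal])
  then show ?thesis by (simp add: hom_def tensor_sel)
qed

lemma tensor_class_closed [simp]: "x \<in> carrier F \<Longrightarrow> tensor_class U V x \<in> carrier T"
  using tensor_class_hom by (rule hom_in_carrier)

lemma tensor_class_add:
  "x \<in> carrier F \<Longrightarrow> y \<in> carrier F \<Longrightarrow>
    tensor_class U V (x + y) = tensor_class U V x \<otimes>\<^bsub>T\<^esub> tensor_class U V y"
  using hom_mult[OF tensor_class_hom, of x y] by (simp only: F_simps)

lemma tensor_classE:
  assumes "X \<in> carrier T"
  obtains x where "x \<in> carrier F" "X = tensor_class U V x"
  using assms by (auto simp: tensor_sel carrier_FactGroup tensor_class_def)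

lemma tensor_class_N: "x \<in> N \<Longrightarrow> tensor_class U V x = \<one>\<^bsub>T\<^esub>"
  by (simp add: tensor_sel tensor_class_def subgroup.rcos_const[OF N_subgroup F.is_group])

lemma tensor_class_eqI:
  assumes "x - y \<in> N" "y \<in> carrier F"
  shows "tensor_class U V x = tensor_class U V y"
proof -
  have "tensor_class U V ((x - y) + y) = tensor_class U V (x - y) \<otimes>\<^bsub>T\<^esub> tensor_class U V y"
    by (rule tensor_class_add) (use assms N_subgroup subgroup.mem_carrier in auto)
  also have "\<dots> = tensor_class U V y"
    using tensor_class_closed[OF assms(2)] by (simp only: tensor_class_N[OF assms(1)] T.l_one)
  finally show ?thesis by simp
qed

text \<open>A tensor is literally a coset. Knowing its representatives is what evaluates definitions
  given by a union or an image over all of them.\<close>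

lemma mem_tensor_class:
  assumes "x \<in> carrier F"
  shows "y \<in> tensor_class U V x \<longleftrightarrow> y \<in> carrier F \<and> tensor_class U V y = tensor_class U V x"
proof
  assume y: "y \<in> tensor_class U V x"
  then have "y \<in> carrier F"
    using F.r_coset_subset_G[OF subgroup.subset[OF N_subgroup] assms]
    by (auto simp: tensor_class_def)
  moreover have "tensor_class U V x = tensor_class U V y"
    using F.repr_independence[OF _ assms N_subgroup, of y] y by (simp add: tensor_class_def)
  ultimately show "y \<in> carrier F \<and> tensor_class U V y = tensor_class U V x" by simp
next
  assume "y \<in> carrier F \<and> tensor_class U V y = tensor_class U V x"
  then show "y \<in> tensor_class U V x"
    using F.rcos_self[OF _ N_subgroup, of y] by (simp add: tensor_class_def)
qed

lemma pure_closed [simp]: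
  "u \<in> carrier U \<Longrightarrow> v \<in> carrier V \<Longrightarrow> pure_tensor U V u v \<in> carrier T"
  unfolding pure_tensor_def by (rule tensor_class_closed) simp

lemma relator_in_N: "x \<in> tensor_relators U V \<Longrightarrow> x \<in> N"
  by (simp add: tensor_rel_eq generate.incl)

lemma pure_balanced: "balanced U V T (pure_tensor U V)"
proof (rule balancedI)
  fix v assume v: "v \<in> carrier V"
  show "(\<lambda>u. pure_tensor U V u v) \<in> hom U T"
  proof (rule homI)
    fix u u' assume u: "u \<in> carrier U" "u' \<in> carrier U"
    have "tensor_class U V (frag_of (u \<otimes>\<^bsub>U\<^esub> u', v)) = tensor_class U V (frag_of (u, v) + frag_of (u', v))"
      by (rule tensor_class_eqI, rule relator_in_N)
        (use u v F.m_closed[of "frag_of (u, v)" "frag_of (u', v)"] in \<open>auto simp: tensor_relators_def diff_diff_add\<close>)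
    then show "pure_tensor U V (u \<otimes>\<^bsub>U\<^esub> u') v = pure_tensor U V u v \<otimes>\<^bsub>T\<^esub> pure_tensor U V u' v"
      using u v by (simp add: pure_tensor_def tensor_class_add)
  qed (use v in \<open>simp\<close>)
next
  fix u assume u: "u \<in> carrier U"
  show "pure_tensor U V u \<in> hom V T"
  proof (rule homI)
    fix v v' assume v: "v \<in> carrier V" "v' \<in> carrier V"
    have "tensor_class U V (frag_of (u, v \<otimes>\<^bsub>V\<^esub> v')) = tensor_class U V (frag_of (u, v) + frag_of (u, v'))"
      by (rule tensor_class_eqI, rule relator_in_N)
        (use u v F.m_closed[of "frag_of (u, v)" "frag_of (u, v')"] in \<open>auto simp: tensor_relators_def diff_diff_add\<close>)
    then show "pure_tensor U V u (v \<otimes>\<^bsub>V\<^esub> v') = pure_tensor U V u v \<otimes>\<^bsub>T\<^esub> pure_tensor U V u v'"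
      using u v by (simp add: pure_tensor_def tensor_class_add)
  qed (use u in \<open>simp\<close>)
next
  fix u v r assume "u \<in> carrier U" "v \<in> carrier V"
  then show "pure_tensor U V (ract U u r) v = pure_tensor U V u (lact V r v)"
    unfolding pure_tensor_def
    by (intro tensor_class_eqI relator_in_N) (auto simp: tensor_relators_def V.lact_closed)
qed

lemmas pure_add_left = balancedD(5)[OF pure_balanced]
lemmas pure_add_right = balancedD(6)[OF pure_balanced]
lemmas pure_move = balancedD(3)[OF pure_balanced]

text \<open>A balanced map extends to the free group, the extension kills each relator and hence the
  subgroup they generate, so it factors through the quotient. Maps out of a tensor product are
  obtained here first and only afterwards identified with the concrete \<open>tensor_map\<close> and
  \<open>tensor_lift\<close>.\<close>

lemma tensor_universal:
  assumes "comm_group W" and f: "balanced U V W f"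
  obtains h where "h \<in> hom T W"
    and "\<And>u v. u \<in> carrier U \<Longrightarrow> v \<in> carrier V \<Longrightarrow> h (pure_tensor U V u v) = f u v"
proof -
  interpret W: comm_group W by fact
  have "(\<lambda>p. f (fst p) (snd p)) ` (carrier U \<times> carrier V) \<subseteq> carrier W"
    using balancedD(4)[OF f] by auto
  from W.free_Abelian_group_universal[OF this]
  obtain g where g: "g \<in> hom F W"
    and gf: "\<And>u v. u \<in> carrier U \<Longrightarrow> v \<in> carrier V \<Longrightarrow> g (frag_of (u, v)) = f u v"
    unfolding tensor_free_def by (metis SigmaI fst_conv snd_conv)
  interpret g: group_hom F W g
    by (simp add: g group_hom_axioms_def group_hom_def)
  have gdiff: "g (a - b) = g a \<otimes>\<^bsub>W\<^esub> inv\<^bsub>W\<^esub> (g b)" if "a \<in> carrier F" "b \<in> carrier F" for a b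
    using g.hom_mult[OF that(1) F.inv_closed[OF that(2)]] g.hom_inv[OF that(2)]
    by (simp only: inv_F[OF that(2)] F_simps diff_conv_add_uminus)
  have cancel: "x \<otimes>\<^bsub>W\<^esub> y \<otimes>\<^bsub>W\<^esub> inv\<^bsub>W\<^esub> x \<otimes>\<^bsub>W\<^esub> inv\<^bsub>W\<^esub> y = \<one>\<^bsub>W\<^esub>"
    if "x \<in> carrier W" "y \<in> carrier W" for x y
    using that by (metis W.inv_closed W.inv_solve_right W.m_closed W.m_comm W.r_inv)
  have grel: "g x = \<one>\<^bsub>W\<^esub>" if "x \<in> tensor_relators U V" for x
    using that unfolding tensor_relators_def
  proof (elim UnE CollectE exE conjE)
    fix u u' v
    assume "x = frag_of (u \<otimes>\<^bsub>U\<^esub> u', v) - frag_of (u, v) - frag_of (u', v)"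
      and uv: "u \<in> carrier U" "u' \<in> carrier U" "v \<in> carrier V"
    then show ?thesis
      by (simp add: gdiff gf diff_in_F balancedD(5)[OF f] cancel balancedD(4)[OF f])
  next
    fix u v v'
    assume "x = frag_of (u, v \<otimes>\<^bsub>V\<^esub> v') - frag_of (u, v) - frag_of (u, v')"
      and uv: "u \<in> carrier U" "v \<in> carrier V" "v' \<in> carrier V"
    then show ?thesis
      by (simp add: gdiff gf diff_in_F balancedD(6)[OF f] cancel balancedD(4)[OF f])
  next
    fix u r v
    assume "x = frag_of (ract U u r, v) - frag_of (u, lact V r v)"
      and uv: "u \<in> carrier U" "v \<in> carrier V"
    then show ?thesis
      by (simp add: gdiff gf U.ract_closed V.lact_closed balancedD(3)[OF f] balancedD(4)[OF f])
  qed
  have gN: "g x = \<one>\<^bsub>W\<^esub>" if "x \<in> N" for x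
    by (rule hom_eq_on_generate[where X = "tensor_relators U V" and g = "\<lambda>_. \<one>\<^bsub>W\<^esub>"])
      (use that relators_in_F grel g in \<open>auto simp: tensor_rel_eq hom_def\<close>)
  have "g x = g y" if x: "x \<in> carrier F" "y \<in> carrier F" "N #>\<^bsub>F\<^esub> x = N #>\<^bsub>F\<^esub> y" for x y
  proof -
    have "x \<in> N #>\<^bsub>F\<^esub> y" using F.rcos_self[OF x(1) N_subgroup] x by simp
    then obtain n where "n \<in> N" "x = n + y" by (auto simp: r_coset_def)
    then show ?thesis
      using g.hom_mult[of n y] gN[of n] x subgroup.mem_carrier[OF N_subgroup] by simp
  qed
  from FactGroup_universal[OF g N_normal this]
  obtain h where h: "h \<in> hom (F Mod N) W" "\<And>x. x \<in> carrier F \<Longrightarrow> h (N #>\<^bsub>F\<^esub> x) = g x" by blast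
  show thesis
  proof (rule that)
    show "h \<in> hom T W" using h(1) by (simp add: hom_def tensor_sel)
    show "h (pure_tensor U V u v) = f u v" if "u \<in> carrier U" "v \<in> carrier V" for u v
      using that by (simp add: pure_tensor_def tensor_class_def h gf)
  qed
qed

lemma free_hom_eq:
  assumes "group W" "f \<in> hom F W" "g \<in> hom F W"
    and eq: "\<And>u v. u \<in> carrier U \<Longrightarrow> v \<in> carrier V \<Longrightarrow> f (frag_of (u, v)) = g (frag_of (u, v))"
    and x: "x \<in> carrier F"
  shows "f x = g x"
proof -
  interpret f: group_hom F W f by (simp add: assms group_hom_axioms_def group_hom_def)
  interpret g: group_hom F W g by (simp add: assms group_hom_axioms_def group_hom_def)
  show ?thesis
  proof (rule free_Abelian_group_induct[where P = "\<lambda>x. f x = g x"])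
    show "Poly_Mapping.keys x \<subseteq> carrier U \<times> carrier V" using x by (simp add: in_F)
    show "f 0 = g 0" using f.hom_one g.hom_one by simp
    fix x y assume xy: "Poly_Mapping.keys x \<subseteq> carrier U \<times> carrier V" "Poly_Mapping.keys y \<subseteq> carrier U \<times> carrier V" "f x = g x" "f y = g y"
    then show "f (x - y) = g (x - y)"
      using f.hom_mult[of x "inv\<^bsub>F\<^esub> y"] g.hom_mult[of x "inv\<^bsub>F\<^esub> y"] f.hom_inv[of y] g.hom_inv[of y]
      by (simp add: inv_F in_F)
  qed (use eq in auto)
qed

lemma tensor_hom_eq:
  assumes "group W" "f \<in> hom T W" "g \<in> hom T W"
    and eq: "\<And>u v. u \<in> carrier U \<Longrightarrow> v \<in> carrier V \<Longrightarrow> f (pure_tensor U V u v) = g (pure_tensor U V u v)"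
    and X: "X \<in> carrier T"
  shows "f X = g X"
proof -
  obtain x where x: "x \<in> carrier F" "X = tensor_class U V x" using X by (rule tensor_classE)
  have "(f \<circ> tensor_class U V) x = (g \<circ> tensor_class U V) x"
    by (rule free_hom_eq[OF assms(1) hom_compose[OF tensor_class_hom assms(2)] hom_compose[OF tensor_class_hom assms(3)] _ x(1)])
      (use eq in \<open>simp add: pure_tensor_def\<close>)
  then show ?thesis by (simp add: x)
qed

text \<open>Sums of pure tensors suffice because the inverse of u \<otimes> v is again pure: it is
  the inverse of u, tensored with v.\<close>

lemma tensor_induct [consumes 1, case_names zero pure add]:
  assumes X: "X \<in> carrier T" and "P \<one>\<^bsub>T\<^esub>"
    and pure: "\<And>u v. u \<in> carrier U \<Longrightarrow> v \<in> carrier V \<Longrightarrow> P (pure_tensor U V u v)"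
    and add: "\<And>X Y. X \<in> carrier T \<Longrightarrow> Y \<in> carrier T \<Longrightarrow> P X \<Longrightarrow> P Y \<Longrightarrow> P (X \<otimes>\<^bsub>T\<^esub> Y)"
  shows "P X"
proof -
  define X' where "X' = {pure_tensor U V u v |u v. u \<in> carrier U \<and> v \<in> carrier V}"
  have sub: "X' \<subseteq> carrier T" by (auto simp: X'_def)
  have inv_pure: "inv\<^bsub>T\<^esub> (pure_tensor U V u v) = pure_tensor U V (inv\<^bsub>U\<^esub> u) v" if "u \<in> carrier U" "v \<in> carrier V" for u v
  proof -
    interpret h: group_hom U T "\<lambda>u. pure_tensor U V u v"
      using balancedD(1)[OF pure_balanced that(2)]
      by (simp add: group_hom_def group_hom_axioms_def U.is_group T.is_group)
    show ?thesis using h.hom_inv[OF that(1)] by simp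
  qed
  have gen: "Y \<in> carrier T \<and> P Y" if "Y \<in> generate T X'" for Y
    using that
  proof (induction rule: generate.induct)
    case one then show ?case using assms(2) T.one_closed by blast
  next
    case (incl h) then show ?case using pure sub by (auto simp: X'_def)
  next
    case (inv h)
    then obtain u v where "u \<in> carrier U" "v \<in> carrier V" "h = pure_tensor U V u v"
      by (auto simp: X'_def)
    then show ?case using pure[of "inv\<^bsub>U\<^esub> u" v] pure_closed[of "inv\<^bsub>U\<^esub> u" v] by (simp add: inv_pure)
  next
    case (eng h1 h2) then show ?case using add T.m_closed by blast
  qed
  obtain x where x: "x \<in> carrier F" "X = tensor_class U V x" using X by (rule tensor_classE)
  have sg: "subgroup (generate T X') T" by (rule T.generate_is_subgroup[OF sub])
  have "tensor_class U V x \<in> generate T X'"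
  proof -
    interpret c: group_hom F T "tensor_class U V"
      by (simp add: group_hom_def group_hom_axioms_def T.is_group tensor_class_hom)
    show ?thesis
    proof (rule free_Abelian_group_induct[where P = "\<lambda>x. tensor_class U V x \<in> generate T X'"])
      show "Poly_Mapping.keys x \<subseteq> carrier U \<times> carrier V" using x by (simp add: in_F)
      show "tensor_class U V 0 \<in> generate T X'"
        using c.hom_one subgroup.one_closed[OF sg] by (simp only: F_simps)
      fix x y assume xy: "Poly_Mapping.keys x \<subseteq> carrier U \<times> carrier V" "Poly_Mapping.keys y \<subseteq> carrier U \<times> carrier V"
        "tensor_class U V x \<in> generate T X'" "tensor_class U V y \<in> generate T X'"
      then have F: "x \<in> carrier F" "y \<in> carrier F" by (auto simp: in_F)
      have "tensor_class U V (x - y) = tensor_class U V x \<otimes>\<^bsub>T\<^esub> inv\<^bsub>T\<^esub> tensor_class U V y"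
        using c.hom_mult[OF F(1) F.inv_closed[OF F(2)]] c.hom_inv[OF F(2)]
        by (simp only: F_simps inv_F[OF F(2)] diff_conv_add_uminus)
      then show "tensor_class U V (x - y) \<in> generate T X'"
        using sg xy by (simp only: subgroup.m_closed subgroup.m_inv_closed)
    next
      fix p assume "p \<in> carrier U \<times> carrier V"
      then show "tensor_class U V (frag_of p) \<in> generate T X'"
        by (intro generate.incl) (auto simp: X'_def pure_tensor_def)
    qed
  qed
  then show ?thesis using gen x(2) by blast
qed

end

section \<open>Maps between tensor products and the bimodule structure\<close>

lemma hom_pointwise_mult:
  assumes "comm_group H" "f \<in> hom G H" "g \<in> hom G H"
  shows "(\<lambda>x. f x \<otimes>\<^bsub>H\<^esub> g x) \<in> hom G H"
proof -
  interpret comm_group H by fact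
  show ?thesis
    using assms(2,3) by (auto simp: hom_def Pi_iff m_ac)
qed

lemma hom_cong_on:
  assumes "group G" "f \<in> hom G H" "\<And>x. x \<in> carrier G \<Longrightarrow> g x = f x"
  shows "g \<in> hom G H"
proof -
  interpret group G by fact
  show ?thesis using assms(2,3) by (auto simp: hom_def Pi_iff)
qed

lemma bimodule_pairI: "is_bimodule U \<Longrightarrow> is_bimodule V \<Longrightarrow> bimodule_pair U V"
  by (simp add: bimodule_pair_def)

definition bimodule_hom :: "('r::ring_1, 'm) bimodule \<Rightarrow> ('r, 'n) bimodule \<Rightarrow> ('m \<Rightarrow> 'n) \<Rightarrow> bool"
  where "bimodule_hom M N f \<longleftrightarrow> f \<in> hom M N \<and> (\<forall>r. \<forall>m\<in>carrier M.
    f (lact M r m) = lact N r (f m) \<and> f (ract M m r) = ract N (f m) r)"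

lemma bimodule_homD:
  assumes "bimodule_hom M N f"
  shows "f \<in> hom M N" "m \<in> carrier M \<Longrightarrow> f m \<in> carrier N"
    and "m \<in> carrier M \<Longrightarrow> f (lact M r m) = lact N r (f m)"
    and "m \<in> carrier M \<Longrightarrow> f (ract M m r) = ract N (f m) r"
  using assms by (auto simp: bimodule_hom_def hom_def)

context is_bimodule
begin

lemma lact_hom: "lact M r \<in> hom M M"
  by (rule homI) (simp_all add: lact_closed lact_add)

lemma ract_hom: "(\<lambda>m. ract M m r) \<in> hom M M"
  by (rule homI) (simp_all add: ract_closed ract_add)

lemma bimodule_hom_id: "bimodule_hom M M (\<lambda>x. x)"
  by (simp add: bimodule_hom_def hom_def)

end

lemma (in bimodule_pair) balanced_tensor_map:
  assumes "bimodule_pair U' V'" and f: "f \<in> hom U U'" and g: "g \<in> hom V V'"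
    and "\<And>u r. u \<in> carrier U \<Longrightarrow> f (ract U u r) = ract U' (f u) r"
    and "\<And>v r. v \<in> carrier V \<Longrightarrow> g (lact V r v) = lact V' r (g v)"
  shows "balanced U V (tensor_bimodule U' V') (\<lambda>u v. pure_tensor U' V' (f u) (g v))"
proof -
  interpret P: bimodule_pair U' V' by fact
  show ?thesis
    using hom_in_carrier[OF f] hom_in_carrier[OF g]
    by (intro balancedI homI)
      (simp_all add: hom_mult[OF f] hom_mult[OF g] P.pure_add_left P.pure_add_right assms(4,5) P.pure_move)
qed

context bimodule_pair
begin

context
  fixes U' :: "('r, 'u2) bimodule" and V' :: "('r, 'v2) bimodule" and f g
  assumes pair: "bimodule_pair U' V'"
    and f: "f \<in> carrier U \<rightarrow> carrier U'" and g: "g \<in> carrier V \<rightarrow> carrier V'"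
    and bal: "balanced U V (tensor_bimodule U' V') (\<lambda>u v. pure_tensor U' V' (f u) (g v))"
begin

interpretation P: bimodule_pair U' V' by (rule pair)

text \<open>The free extension of f and g followed by the quotient map agrees with h on generators,
  hence everywhere. Every representative of X therefore contributes the same coset
  \<open>h X\<close>, and the union in \<open>tensor_map\<close> collapses to it.\<close>

lemma tensor_map_eqI:
  assumes h: "h \<in> hom T (tensor_bimodule U' V')"
    and hp: "\<And>u v. u \<in> carrier U \<Longrightarrow> v \<in> carrier V \<Longrightarrow> h (pure_tensor U V u v) = pure_tensor U' V' (f u) (g v)"
    and X: "X \<in> carrier T"
  shows "tensor_map U' V' f g X = h X"
proof -
  let ?e = "frag_extend (\<lambda>(u, v). frag_of (f u, g v))"
  have e: "?e \<in> hom F P.F"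
  proof (rule homI)
    fix x assume "x \<in> carrier F"
    then have "fst p \<in> carrier U \<and> snd p \<in> carrier V" if "p \<in> Poly_Mapping.keys x" for p
      using that by (auto simp: in_F)
    then have "(\<Union>p\<in>Poly_Mapping.keys x. Poly_Mapping.keys ((\<lambda>(u, v). frag_of (f u, g v)) p :: _ \<Rightarrow>\<^sub>0 int))
       \<subseteq> carrier U' \<times> carrier V'"
      using f g by (force split: prod.splits)
    then show "?e x \<in> carrier P.F"
      unfolding P.in_F by (rule order_trans[OF keys_frag_extend])
  qed (simp add: frag_extend_add)
  have 1: "tensor_class U' V' (?e x) = h (tensor_class U V x)" if "x \<in> carrier F" for x
  proof -
    have "(tensor_class U' V' \<circ> ?e) x = (h \<circ> tensor_class U V) x"
      by (rule free_hom_eq[OF P.T.is_group hom_compose[OF e P.tensor_class_hom] hom_compose[OF tensor_class_hom h] _ that])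
        (use hp in \<open>simp add: pure_tensor_def\<close>)
    then show ?thesis by simp
  qed
  obtain x where x: "x \<in> carrier F" "X = tensor_class U V x" using X by (rule tensor_classE)
  have "tensor_class U' V' (?e y) = h X" if "y \<in> X" for y
    using that mem_tensor_class[OF x(1)] 1 x(2) by auto
  moreover have "x \<in> X" using mem_tensor_class[OF x(1)] x by simp
  ultimately show ?thesis by (auto simp: tensor_map_def)
qed

lemma tensor_map_hom: "tensor_map U' V' f g \<in> hom T (tensor_bimodule U' V')"
  and tensor_map_pure: "\<And>u v. u \<in> carrier U \<Longrightarrow> v \<in> carrier V \<Longrightarrow>
    tensor_map U' V' f g (pure_tensor U V u v) = pure_tensor U' V' (f u) (g v)"
proof -
  obtain h where h: "h \<in> hom T (tensor_bimodule U' V')"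
    "\<And>u v. u \<in> carrier U \<Longrightarrow> v \<in> carrier V \<Longrightarrow> h (pure_tensor U V u v) = pure_tensor U' V' (f u) (g v)"
    using tensor_universal[OF P.comm_group_T bal] by blast
  note eq = tensor_map_eqI[OF h]
  show "tensor_map U' V' f g \<in> hom T (tensor_bimodule U' V')"
    by (rule hom_cong_on[OF T.is_group h(1) eq])
  show "tensor_map U' V' f g (pure_tensor U V u v) = pure_tensor U' V' (f u) (g v)"
    if "u \<in> carrier U" "v \<in> carrier V" for u v
    using that by (simp add: eq h)
qed

end

lemma balanced_lact: "balanced U V T (\<lambda>u v. pure_tensor U V (lact U r u) (id v))"
  by (rule balanced_tensor_map)
    (use U.lact_hom in \<open>auto simp: bimodule_pair_axioms U.lact_ract id_def hom_def\<close>)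

lemma balanced_ract: "balanced U V T (\<lambda>u v. pure_tensor U V (id u) (ract V v r))"
  by (rule balanced_tensor_map)
    (use V.ract_hom in \<open>auto simp: bimodule_pair_axioms V.lact_ract id_def hom_def\<close>)

lemma tensor_act:
  "lact T r = tensor_map U V (lact U r) id" "ract T X r = tensor_map U V id (\<lambda>v. ract V v r) X"
  by (simp_all add: tensor_bimodule_def)

lemma tensor_lact_hom: "lact T r \<in> hom T T"
  unfolding tensor_act
  by (rule tensor_map_hom[OF bimodule_pair_axioms _ _ balanced_lact]) (simp_all add: U.lact_closed)

lemma tensor_ract_hom: "(\<lambda>X. ract T X r) \<in> hom T T"
  unfolding tensor_act
  by (rule tensor_map_hom[OF bimodule_pair_axioms _ _ balanced_ract]) (simp_all add: V.ract_closed)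

lemma lact_pure:
  assumes "u \<in> carrier U" "v \<in> carrier V"
  shows "lact T r (pure_tensor U V u v) = pure_tensor U V (lact U r u) v"
  unfolding tensor_act
  by (subst tensor_map_pure[OF bimodule_pair_axioms _ _ balanced_lact]) (simp_all add: U.lact_closed assms)

lemma ract_pure:
  assumes "u \<in> carrier U" "v \<in> carrier V"
  shows "ract T (pure_tensor U V u v) r = pure_tensor U V u (ract V v r)"
  unfolding tensor_act
  by (subst tensor_map_pure[OF bimodule_pair_axioms _ _ balanced_ract]) (simp_all add: V.ract_closed assms)

lemma tensor_is_bimodule: "is_bimodule T"
proof -
  note eqI = tensor_hom_eq[OF T.is_group]
  note lh = tensor_lact_hom and rh = tensor_ract_hom
  note pt = hom_pointwise_mult[OF comm_group_T]
  note cl = U.lact_closed V.ract_closed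
  have comp: "(\<lambda>x. p (q x)) \<in> hom T T" if "p \<in> hom T T" "q \<in> hom T T" for p q
    using hom_compose[OF that(2,1)] by (simp add: comp_def)
  have idh: "(\<lambda>x. x) \<in> hom T T" by (simp add: hom_def)
  show ?thesis
  proof (intro is_bimodule.intro comm_group_T is_bimodule_axioms.intro)
    fix m r s assume m: "m \<in> carrier T"
    show "lact T r m \<in> carrier T" by (rule hom_in_carrier[OF lh m])
    show "ract T m r \<in> carrier T" by (rule hom_in_carrier[OF rh m])
    show "lact T (r + s) m = lact T r m \<otimes>\<^bsub>T\<^esub> lact T s m"
      by (rule eqI[OF lh pt[OF lh lh] _ m]) (simp add: lact_pure U.lact_plus pure_add_left cl)
    show "ract T m (r + s) = ract T m r \<otimes>\<^bsub>T\<^esub> ract T m s"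
      by (rule eqI[OF rh pt[OF rh rh] _ m]) (simp add: ract_pure V.ract_plus pure_add_right cl)
    show "lact T (r * s) m = lact T r (lact T s m)"
      by (rule eqI[OF lh comp[OF lh lh] _ m]) (simp add: lact_pure U.lact_lact cl)
    show "ract T m (r * s) = ract T (ract T m r) s"
      by (rule eqI[OF rh comp[OF rh rh] _ m]) (simp add: ract_pure V.ract_ract cl)
    show "lact T 1 m = m"
      by (rule eqI[OF lh idh _ m]) (simp add: lact_pure U.lact_one)
    show "ract T m 1 = m"
      by (rule eqI[OF rh idh _ m]) (simp add: ract_pure V.ract_one)
    show "ract T (lact T r m) s = lact T r (ract T m s)"
      by (rule eqI[OF comp[OF rh lh] comp[OF lh rh] _ m]) (simp add: ract_pure lact_pure cl)
    fix n assume n: "n \<in> carrier T"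
    show "lact T r (m \<otimes>\<^bsub>T\<^esub> n) = lact T r m \<otimes>\<^bsub>T\<^esub> lact T r n" by (rule hom_mult[OF lh m n])
    show "ract T (m \<otimes>\<^bsub>T\<^esub> n) r = ract T m r \<otimes>\<^bsub>T\<^esub> ract T n r" by (rule hom_mult[OF rh m n])
  qed
qed

lemma bimodule_homI_pure:
  assumes W: "is_bimodule W" and h: "h \<in> hom T W"
    and "\<And>u v r. u \<in> carrier U \<Longrightarrow> v \<in> carrier V \<Longrightarrow>
      h (pure_tensor U V (lact U r u) v) = lact W r (h (pure_tensor U V u v))"
    and "\<And>u v r. u \<in> carrier U \<Longrightarrow> v \<in> carrier V \<Longrightarrow>
      h (pure_tensor U V u (ract V v r)) = ract W (h (pure_tensor U V u v)) r"
  shows "bimodule_hom T W h"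
proof -
  interpret W: is_bimodule W by fact
  have "h (lact T r m) = lact W r (h m)" "h (ract T m r) = ract W (h m) r" if m: "m \<in> carrier T" for r m
  proof -
    have "(h \<circ> lact T r) m = (lact W r \<circ> h) m"
      by (rule tensor_hom_eq[OF W.is_group hom_compose[OF tensor_lact_hom h] hom_compose[OF h W.lact_hom] _ m])
        (simp add: lact_pure assms(3))
    then show "h (lact T r m) = lact W r (h m)" by simp
    have "(h \<circ> (\<lambda>m. ract T m r)) m = ((\<lambda>m. ract W m r) \<circ> h) m"
      by (rule tensor_hom_eq[OF W.is_group hom_compose[OF tensor_ract_hom h] hom_compose[OF h W.ract_hom] _ m])
        (simp add: ract_pure assms(4))
    then show "h (ract T m r) = ract W (h m) r" by simp
  qed
  then show ?thesis using h by (simp add: bimodule_hom_def)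
qed

end

section \<open>Isomorphisms of bimodules\<close>

lemma bimodule_isoI:
  assumes f: "bimodule_hom M N f" and "g \<in> carrier N \<rightarrow> carrier M"
    and "\<And>m. m \<in> carrier M \<Longrightarrow> g (f m) = m" "\<And>n. n \<in> carrier N \<Longrightarrow> f (g n) = n"
  shows "M \<cong>\<^sub>b N"
proof -
  have "bij_betw f (carrier M) (carrier N)"
    by (rule bij_betw_byWitness[where f' = g]) (use assms bimodule_homD(2)[OF f] in auto)
  then show ?thesis
    using f by (auto simp: bimodule_iso_def bimodule_hom_def iso_def)
qed

lemma bimodule_isoE:
  assumes "M \<cong>\<^sub>b N" "is_bimodule M" "is_bimodule N"
  obtains f g where "bimodule_hom M N f" "bimodule_hom N M g"
    "\<And>m. m \<in> carrier M \<Longrightarrow> g (f m) = m" "\<And>n. n \<in> carrier N \<Longrightarrow> f (g n) = n"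
proof -
  interpret M: is_bimodule M by fact
  interpret N: is_bimodule N by fact
  obtain f where f: "f \<in> iso M N" "bimodule_hom M N f"
    using assms(1) by (auto simp: bimodule_iso_def bimodule_hom_def iso_def)
  then have bij: "bij_betw f (carrier M) (carrier N)" by (simp add: iso_def)
  define g where "g = inv_into (carrier M) f"
  have gf: "g (f m) = m" if "m \<in> carrier M" for m
    using bij that by (simp add: g_def bij_betw_def)
  have fg: "f (g n) = n" "g n \<in> carrier M" if "n \<in> carrier N" for n
    using bij that by (simp_all add: g_def bij_betw_inv_into_right bij_betw_def inv_into_into)
  have gI: "g n = m" if "f m = n" "m \<in> carrier M" for m n using gf that by auto
  note fD = bimodule_homD[OF f(2)]
  have "bimodule_hom N M g"
    unfolding bimodule_hom_def
  proof (intro conjI allI ballI homI)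
    fix n n' assume n: "n \<in> carrier N" "n' \<in> carrier N"
    then show "g (n \<otimes>\<^bsub>N\<^esub> n') = g n \<otimes>\<^bsub>M\<^esub> g n'"
      by (intro gI) (simp_all add: hom_mult[OF fD(1)] fg)
  qed (auto intro!: gI simp: fD fg M.lact_closed M.ract_closed)
  then show thesis using that f gf fg by blast
qed

lemma bimodule_iso_refl: "is_bimodule M \<Longrightarrow> M \<cong>\<^sub>b M"
  by (rule bimodule_isoI[OF is_bimodule.bimodule_hom_id]) auto

lemma bimodule_iso_sym: "M \<cong>\<^sub>b N \<Longrightarrow> is_bimodule M \<Longrightarrow> is_bimodule N \<Longrightarrow> N \<cong>\<^sub>b M"
  by (erule bimodule_isoE; assumption?)
    (rule bimodule_isoI, assumption, auto dest: bimodule_homD(2))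

lemma bimodule_iso_trans [trans]: "M \<cong>\<^sub>b N \<Longrightarrow> N \<cong>\<^sub>b P \<Longrightarrow> M \<cong>\<^sub>b P"
  unfolding bimodule_iso_def
  by (elim bexE, rule bexI[OF _ iso_set_trans]) (auto simp: iso_def hom_def Pi_iff)

lemma tensor_iso_cong:
  assumes "U \<cong>\<^sub>b U'" "V \<cong>\<^sub>b V'" "is_bimodule U" "is_bimodule U'" "is_bimodule V" "is_bimodule V'"
  shows "tensor_bimodule U V \<cong>\<^sub>b tensor_bimodule U' V'"
proof -
  interpret P: bimodule_pair U V using assms by (intro bimodule_pairI)
  interpret P': bimodule_pair U' V' using assms by (intro bimodule_pairI)
  obtain f f' where f: "bimodule_hom U U' f" "bimodule_hom U' U f'"
    "\<And>m. m \<in> carrier U \<Longrightarrow> f' (f m) = m" "\<And>n. n \<in> carrier U' \<Longrightarrow> f (f' n) = n"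
    using bimodule_isoE assms by metis
  obtain g g' where g: "bimodule_hom V V' g" "bimodule_hom V' V g'"
    "\<And>m. m \<in> carrier V \<Longrightarrow> g' (g m) = m" "\<And>n. n \<in> carrier V' \<Longrightarrow> g (g' n) = n"
    using bimodule_isoE assms by metis
  note fD = bimodule_homD[OF f(1)] bimodule_homD[OF f(2)]
  note gD = bimodule_homD[OF g(1)] bimodule_homD[OF g(2)]
  have b: "balanced U V P'.T (\<lambda>u v. pure_tensor U' V' (f u) (g v))"
    by (rule P.balanced_tensor_map) (simp_all add: P'.bimodule_pair_axioms fD gD)
  have b': "balanced U' V' P.T (\<lambda>u v. pure_tensor U V (f' u) (g' v))"
    by (rule P'.balanced_tensor_map) (simp_all add: P.bimodule_pair_axioms fD gD)
  note h = P.tensor_map_hom[OF P'.bimodule_pair_axioms _ _ b]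
    and hp = P.tensor_map_pure[OF P'.bimodule_pair_axioms _ _ b]
  note h' = P'.tensor_map_hom[OF P.bimodule_pair_axioms _ _ b']
    and hp' = P'.tensor_map_pure[OF P.bimodule_pair_axioms _ _ b']
  have H: "bimodule_hom P.T P'.T (tensor_map U' V' f g)"
    by (rule P.bimodule_homI_pure[OF P'.tensor_is_bimodule h])
      (simp_all add: fD gD hp Pi_iff P'.lact_pure P'.ract_pure P.U.lact_closed P.V.ract_closed)
  have h'2: "tensor_map U V f' g' \<in> hom P'.T P.T" by (rule h') (simp_all add: fD gD Pi_iff)
  have idh: "(\<lambda>x. x) \<in> hom P.T P.T" "(\<lambda>x. x) \<in> hom P'.T P'.T" by (simp_all add: hom_def)
  show ?thesis
  proof (rule bimodule_isoI[OF H])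
    show "tensor_map U V f' g' \<in> carrier P'.T \<rightarrow> carrier P.T"
      using h'2 by (simp add: hom_def)
    fix m assume m: "m \<in> carrier P.T"
    have "(tensor_map U V f' g' \<circ> tensor_map U' V' f g) m = (\<lambda>x. x) m"
      by (rule P.tensor_hom_eq[OF P.T.is_group hom_compose[OF bimodule_homD(1)[OF H] h'2] idh(1) _ m])
        (simp add: hp hp' fD gD f g Pi_iff)
    then show "tensor_map U V f' g' (tensor_map U' V' f g m) = m" by simp
  next
    fix m assume m: "m \<in> carrier P'.T"
    have "(tensor_map U' V' f g \<circ> tensor_map U V f' g') m = (\<lambda>x. x) m"
      by (rule P'.tensor_hom_eq[OF P'.T.is_group hom_compose[OF h'2 bimodule_homD(1)[OF H]] idh(2) _ m])
        (simp add: hp hp' fD gD f g Pi_iff)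
    then show "tensor_map U' V' f g (tensor_map U V f' g' m) = m" by simp
  qed
qed

section \<open>Iterated tensor products and associativity\<close>

locale bimodule_triple = UV: bimodule_pair U V + VW: bimodule_pair V W
  for U :: "('r::ring_1, 'u) bimodule" and V :: "('r, 'v) bimodule" and W :: "('r, 'w) bimodule"
begin

sublocale L: bimodule_pair "tensor_bimodule U V" W
  by (intro bimodule_pairI UV.tensor_is_bimodule VW.V.is_bimodule_axioms)

sublocale R: bimodule_pair U "tensor_bimodule V W"
  by (intro bimodule_pairI VW.tensor_is_bimodule UV.U.is_bimodule_axioms)

abbreviation (input) lpure
  where "lpure u v w \<equiv> pure_tensor UV.T W (pure_tensor U V u v) w"

abbreviation (input) rpure
  where "rpure u v w \<equiv> pure_tensor U VW.T u (pure_tensor V W v w)"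

lemma hom_eq_left:
  assumes "group G" "f \<in> hom L.T G" "g \<in> hom L.T G"
    and eq: "\<And>u v w. u \<in> carrier U \<Longrightarrow> v \<in> carrier V \<Longrightarrow> w \<in> carrier W \<Longrightarrow>
      f (lpure u v w) = g (lpure u v w)"
    and X: "X \<in> carrier L.T"
  shows "f X = g X"
proof (rule L.tensor_hom_eq[OF assms(1-3) _ X])
  fix Y w assume Y: "Y \<in> carrier UV.T" and w: "w \<in> carrier W"
  have "(f \<circ> (\<lambda>Y. pure_tensor UV.T W Y w)) Y = (g \<circ> (\<lambda>Y. pure_tensor UV.T W Y w)) Y"
    using balancedD(1)[OF L.pure_balanced w] w
    by (intro UV.tensor_hom_eq[OF assms(1) hom_compose hom_compose _ Y, OF _ assms(2) _ assms(3)])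
      (simp_all add: eq)
  then show "f (pure_tensor UV.T W Y w) = g (pure_tensor UV.T W Y w)" by simp
qed

lemma hom_eq_right:
  assumes "group G" "f \<in> hom R.T G" "g \<in> hom R.T G"
    and eq: "\<And>u v w. u \<in> carrier U \<Longrightarrow> v \<in> carrier V \<Longrightarrow> w \<in> carrier W \<Longrightarrow>
      f (rpure u v w) = g (rpure u v w)"
    and X: "X \<in> carrier R.T"
  shows "f X = g X"
proof (rule R.tensor_hom_eq[OF assms(1-3) _ X])
  fix Y u assume Y: "Y \<in> carrier VW.T" and u: "u \<in> carrier U"
  have "(f \<circ> pure_tensor U VW.T u) Y = (g \<circ> pure_tensor U VW.T u) Y"
    using balancedD(2)[OF R.pure_balanced u] u
    by (intro VW.tensor_hom_eq[OF assms(1) hom_compose hom_compose _ Y, OF _ assms(2) _ assms(3)])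
      (simp_all add: eq)
  then show "f (pure_tensor U VW.T u Y) = g (pure_tensor U VW.T u Y)" by simp
qed

text \<open>Currying: for fixed w, condition \<open>2\<close> gives a map \<open>k w\<close> on U
  \<otimes> V, and condition \<open>1\<close> makes the family balanced in X and w. The version for
  the other bracketing curries in u instead.\<close>

lemma ex_hom_left:
  assumes G: "comm_group G"
    and 1: "\<And>u. u \<in> carrier U \<Longrightarrow> balanced V W G (f u)"
    and 2: "\<And>w. w \<in> carrier W \<Longrightarrow> balanced U V G (\<lambda>u v. f u v w)"
  obtains h where "h \<in> hom L.T G"
    "\<And>u v w. u \<in> carrier U \<Longrightarrow> v \<in> carrier V \<Longrightarrow> w \<in> carrier W \<Longrightarrow>
      h (lpure u v w) = f u v w"
proof -
  interpret G: comm_group G by fact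
  have "\<exists>k. \<forall>w\<in>carrier W. k w \<in> hom UV.T G \<and>
    (\<forall>u\<in>carrier U. \<forall>v\<in>carrier V. k w (pure_tensor U V u v) = f u v w)"
    by (intro bchoice ballI) (metis UV.tensor_universal[OF G 2])
  then obtain k where k: "\<And>w. w \<in> carrier W \<Longrightarrow> k w \<in> hom UV.T G"
    "\<And>u v w. w \<in> carrier W \<Longrightarrow> u \<in> carrier U \<Longrightarrow> v \<in> carrier V \<Longrightarrow> k w (pure_tensor U V u v) = f u v w"
    by metis
  have "balanced UV.T W G (\<lambda>X w. k w X)"
  proof (rule balancedI)
    fix X assume X: "X \<in> carrier UV.T"
    show "(\<lambda>w. k w X) \<in> hom W G"
    proof (rule homI)
      fix w w' assume w: "w \<in> carrier W" "w' \<in> carrier W"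
      show "k (w \<otimes>\<^bsub>W\<^esub> w') X = k w X \<otimes>\<^bsub>G\<^esub> k w' X"
        by (rule UV.tensor_hom_eq[OF G.is_group k(1) hom_pointwise_mult[OF G k(1) k(1)] _ X])
          (simp_all add: w k balancedD(6)[OF 1])
    qed (use X in \<open>auto dest: k(1) hom_in_carrier\<close>)
    fix w r assume w: "w \<in> carrier W"
    have "(k w \<circ> (\<lambda>X. ract UV.T X r)) X = k (lact W r w) X"
      by (rule UV.tensor_hom_eq[OF G.is_group hom_compose[OF UV.tensor_ract_hom k(1)] k(1) _ X])
        (simp_all add: w VW.V.lact_closed UV.ract_pure k UV.V.ract_closed balancedD(3)[OF 1])
    then show "k w (ract UV.T X r) = k (lact W r w) X" by simp
  qed (simp add: k(1))
  from L.tensor_universal[OF G this] that k(2) show thesis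
    by (metis UV.pure_closed)
qed

lemma ex_hom_right:
  assumes G: "comm_group G"
    and 1: "\<And>u. u \<in> carrier U \<Longrightarrow> balanced V W G (f u)"
    and 2: "\<And>w. w \<in> carrier W \<Longrightarrow> balanced U V G (\<lambda>u v. f u v w)"
  obtains h where "h \<in> hom R.T G"
    "\<And>u v w. u \<in> carrier U \<Longrightarrow> v \<in> carrier V \<Longrightarrow> w \<in> carrier W \<Longrightarrow>
      h (rpure u v w) = f u v w"
proof -
  interpret G: comm_group G by fact
  have "\<exists>k. \<forall>u\<in>carrier U. k u \<in> hom VW.T G \<and>
    (\<forall>v\<in>carrier V. \<forall>w\<in>carrier W. k u (pure_tensor V W v w) = f u v w)"
    by (intro bchoice ballI) (metis VW.tensor_universal[OF G 1])
  then obtain k where k: "\<And>u. u \<in> carrier U \<Longrightarrow> k u \<in> hom VW.T G"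
    "\<And>u v w. u \<in> carrier U \<Longrightarrow> v \<in> carrier V \<Longrightarrow> w \<in> carrier W \<Longrightarrow> k u (pure_tensor V W v w) = f u v w"
    by metis
  have "balanced U VW.T G k"
  proof (rule balancedI)
    fix X assume X: "X \<in> carrier VW.T"
    show "(\<lambda>u. k u X) \<in> hom U G"
    proof (rule homI)
      fix u u' assume u: "u \<in> carrier U" "u' \<in> carrier U"
      show "k (u \<otimes>\<^bsub>U\<^esub> u') X = k u X \<otimes>\<^bsub>G\<^esub> k u' X"
        by (rule VW.tensor_hom_eq[OF G.is_group k(1) hom_pointwise_mult[OF G k(1) k(1)] _ X])
          (simp_all add: u k balancedD(5)[OF 2])
    qed (use X in \<open>auto dest: k(1) hom_in_carrier\<close>)
  next
    fix u X r assume u: "u \<in> carrier U" and X: "X \<in> carrier VW.T"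
    have "k (ract U u r) X = (k u \<circ> lact VW.T r) X"
      by (rule VW.tensor_hom_eq[OF G.is_group k(1) hom_compose[OF VW.tensor_lact_hom k(1)] _ X])
        (simp_all add: u UV.V.lact_closed VW.lact_pure k UV.U.ract_closed balancedD(3)[OF 2])
    then show "k (ract U u r) X = k u (lact VW.T r X)" by simp
  qed (simp add: k(1))
  from R.tensor_universal[OF G this] that k(2) show thesis
    by (metis VW.pure_closed)
qed

lemma balanced_assoc_left:
  assumes "u \<in> carrier U"
  shows "balanced V W R.T (\<lambda>v w. rpure u v w)"
  using assms
  by (intro balancedI homI)
    (simp_all add: VW.pure_add_left VW.pure_add_right R.pure_add_right VW.pure_move)

lemma balanced_assoc_left':
  assumes "w \<in> carrier W"
  shows "balanced U V R.T (\<lambda>u v. rpure u v w)"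
  using assms
  by (intro balancedI homI)
    (simp_all add: VW.pure_add_left R.pure_add_left R.pure_add_right R.pure_move VW.lact_pure)

lemma balanced_assoc_right:
  assumes "u \<in> carrier U"
  shows "balanced V W L.T (\<lambda>v w. lpure u v w)"
  using assms
  by (intro balancedI homI)
    (simp_all add: UV.pure_add_right L.pure_add_left L.pure_add_right L.pure_move[symmetric] UV.ract_pure)

lemma balanced_assoc_right':
  assumes "w \<in> carrier W"
  shows "balanced U V L.T (\<lambda>u v. lpure u v w)"
  using assms
  by (intro balancedI homI)
    (simp_all add: UV.pure_add_left UV.pure_add_right L.pure_add_left UV.pure_move)

text \<open>\<open>tensor_assoc\<close> is a choice; a candidate exists by the universal property
  for three factors, and the two properties shown here fix it on the whole carrier.\<close>

lemma tensor_assoc_hom: "tensor_assoc U V W \<in> hom L.T R.T"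
  and tensor_assoc_pure: "\<And>u v w. u \<in> carrier U \<Longrightarrow> v \<in> carrier V \<Longrightarrow> w \<in> carrier W \<Longrightarrow>
    tensor_assoc U V W (lpure u v w) = rpure u v w"
proof -
  obtain h where "h \<in> hom L.T R.T"
    "\<And>u v w. u \<in> carrier U \<Longrightarrow> v \<in> carrier V \<Longrightarrow> w \<in> carrier W \<Longrightarrow>
      h (lpure u v w) = rpure u v w"
    using ex_hom_left[OF R.comm_group_T balanced_assoc_left balanced_assoc_left'] by blast
  then have "tensor_assoc U V W \<in> hom L.T R.T \<and> (\<forall>u\<in>carrier U. \<forall>v\<in>carrier V. \<forall>w\<in>carrier W.
    tensor_assoc U V W (lpure u v w) = rpure u v w)"
    unfolding tensor_assoc_def by (intro someI_ex[where P = "\<lambda>a. a \<in> hom L.T R.T \<and> _ a"]) blast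
  then show "tensor_assoc U V W \<in> hom L.T R.T"
    "\<And>u v w. u \<in> carrier U \<Longrightarrow> v \<in> carrier V \<Longrightarrow> w \<in> carrier W \<Longrightarrow>
    tensor_assoc U V W (lpure u v w) = rpure u v w"
    by auto
qed

lemma tensor_assoc_iso: "L.T \<cong>\<^sub>b R.T"
proof -
  let ?a = "tensor_assoc U V W"
  \<comment> \<open>The inverse is the rebracketing in the other direction; both composites fix pure
    tensors.\<close>
  obtain b where b: "b \<in> hom R.T L.T"
    and bp: "\<And>u v w. u \<in> carrier U \<Longrightarrow> v \<in> carrier V \<Longrightarrow> w \<in> carrier W \<Longrightarrow>
      b (rpure u v w) = lpure u v w"
    using ex_hom_right[OF L.comm_group_T balanced_assoc_right balanced_assoc_right'] by blast
  note a = tensor_assoc_hom and ap = tensor_assoc_pure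
  have idh: "(\<lambda>x. x) \<in> hom L.T L.T" "(\<lambda>x. x) \<in> hom R.T R.T" by (simp_all add: hom_def)
  have "bimodule_hom L.T R.T ?a"
    unfolding bimodule_hom_def
  proof (intro conjI a ballI allI)
    fix r X assume X: "X \<in> carrier L.T"
    have "(?a \<circ> lact L.T r) X = (lact R.T r \<circ> ?a) X"
      by (rule hom_eq_left[OF R.T.is_group hom_compose[OF L.tensor_lact_hom a] hom_compose[OF a R.tensor_lact_hom] _ X])
        (simp add: ap L.lact_pure R.lact_pure UV.lact_pure UV.U.lact_closed)
    then show "?a (lact L.T r X) = lact R.T r (?a X)" by simp
    have "(?a \<circ> (\<lambda>X. ract L.T X r)) X = ((\<lambda>X. ract R.T X r) \<circ> ?a) X"
      by (rule hom_eq_left[OF R.T.is_group hom_compose[OF L.tensor_ract_hom a] hom_compose[OF a R.tensor_ract_hom] _ X])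
        (simp add: ap L.ract_pure R.ract_pure VW.ract_pure VW.V.ract_closed)
    then show "?a (ract L.T X r) = ract R.T (?a X) r" by simp
  qed
  moreover have "b \<in> carrier R.T \<rightarrow> carrier L.T" using b by (simp add: hom_def)
  moreover have "b (?a X) = X" if "X \<in> carrier L.T" for X
  proof -
    have "(b \<circ> ?a) X = (\<lambda>x. x) X"
      by (rule hom_eq_left[OF L.T.is_group hom_compose[OF a b] idh(1) _ that]) (simp add: ap bp)
    then show ?thesis by simp
  qed
  moreover have "?a (b X) = X" if "X \<in> carrier R.T" for X
  proof -
    have "(?a \<circ> b) X = (\<lambda>x. x) X"
      by (rule hom_eq_right[OF R.T.is_group hom_compose[OF b a] idh(2) _ that]) (simp add: ap bp)
    then show ?thesis by simp
  qed
  ultimately show ?thesis by (rule bimodule_isoI)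
qed

end

lemma bimodule_tripleI: "is_bimodule U \<Longrightarrow> is_bimodule V \<Longrightarrow> is_bimodule W \<Longrightarrow> bimodule_triple U V W"
  by (simp add: bimodule_triple_def bimodule_pair_def)

section \<open>Twisted regular bimodules\<close>

definition twist :: "('r::ring_1 \<Rightarrow> 'r) \<Rightarrow> ('r, 'r) bimodule"
  where "twist \<alpha> = \<lparr>carrier = UNIV, monoid.mult = (+), one = 0, lact = (*), ract = (\<lambda>m r. m * \<alpha> r)\<rparr>"

definition ring_aut :: "('r::ring_1 \<Rightarrow> 'r) \<Rightarrow> bool"
  where "ring_aut \<alpha> \<longleftrightarrow> bij \<alpha> \<and> \<alpha> 1 = 1 \<and> (\<forall>a b. \<alpha> (a + b) = \<alpha> a + \<alpha> b) \<and> (\<forall>a b. \<alpha> (a * b) = \<alpha> a * \<alpha> b)"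

lemma ring_aut_id: "ring_aut (\<lambda>x. x)"
  by (simp add: ring_aut_def bij_id[unfolded id_def])

lemma ring_aut_comp: "ring_aut \<alpha> \<Longrightarrow> ring_aut \<beta> \<Longrightarrow> ring_aut (\<alpha> \<circ> \<beta>)"
  by (simp add: ring_aut_def bij_comp)

lemma ring_aut_funpow: "ring_aut \<alpha> \<Longrightarrow> ring_aut (\<alpha> ^^ n)"
  by (induction n) (auto simp: ring_aut_id[folded id_def] ring_aut_comp)

lemma ring_aut_inv: "ring_aut \<alpha> \<Longrightarrow> ring_aut (inv_into UNIV \<alpha>)"
proof -
  assume a: "ring_aut \<alpha>"
  let ?b = "inv_into UNIV \<alpha>"
  have b: "bij \<alpha>" using a by (simp add: ring_aut_def)
  have ab: "\<alpha> (?b x) = x" for x using b by (simp add: bij_is_surj surj_f_inv_f)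
  have eq: "?b x = y" if "\<alpha> y = x" for x y using b that by (metis bij_inv_eq_iff)
  show ?thesis
    using a b by (auto simp: ring_aut_def ab bij_imp_bij_inv intro!: eq)
qed

lemma twist_sel [simp]:
  "carrier (twist \<alpha>) = UNIV" "monoid.mult (twist \<alpha>) = (+)" "one (twist \<alpha>) = 0"
  "lact (twist \<alpha>) = (*)" "ract (twist \<alpha>) m r = m * \<alpha> r"
  by (simp_all add: twist_def)

lemma regular_eq_twist: "regular_bimodule = twist (\<lambda>x. x)"
  by (simp add: regular_bimodule_def twist_def)

lemma comm_group_additive:
  "comm_group \<lparr>carrier = (UNIV :: 'a::ab_group_add set), monoid.mult = (+), one = 0\<rparr>"
proof (rule comm_groupI, goal_cases)
  case (6 x)
  show ?case by (auto intro: exI[of _ "- x"])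
qed (simp_all add: algebra_simps)

lemma twist_is_bimodule:
  assumes "ring_aut \<alpha>"
  shows "is_bimodule (twist \<alpha>)"
  by (intro is_bimodule.intro is_bimodule_axioms.intro comm_group_cong[OF comm_group_additive])
    (use assms in \<open>simp_all add: ring_aut_def algebra_simps\<close>)

text \<open>The map m \<otimes> n \<mapsto> m \<alpha>(n) has inverse m \<mapsto> m \<otimes> 1,
  since n can be moved across the tensor sign, where it acts on m through \<alpha>. This turns
  powers in the Picard group into powers of an automorphism.\<close>

lemma tensor_twist:
  assumes \<alpha>: "ring_aut \<alpha>" and \<beta>: "ring_aut \<beta>"
  shows "tensor_bimodule (twist \<alpha>) (twist \<beta>) \<cong>\<^sub>b twist (\<alpha> \<circ> \<beta>)"
proof -
  note ab = twist_is_bimodule[OF ring_aut_comp[OF \<alpha> \<beta>]]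
  interpret P: bimodule_pair "twist \<alpha>" "twist \<beta>"
    by (intro bimodule_pairI twist_is_bimodule assms)
  interpret AB: is_bimodule "twist (\<alpha> \<circ> \<beta>)" by (rule ab)
  have "balanced (twist \<alpha>) (twist \<beta>) (twist (\<alpha> \<circ> \<beta>)) (\<lambda>m n. m * \<alpha> n)"
    using \<alpha> by (intro balancedI) (simp_all add: hom_def ring_aut_def algebra_simps)
  then obtain h where h: "h \<in> hom P.T (twist (\<alpha> \<circ> \<beta>))"
    "\<And>u v. u \<in> carrier (twist \<alpha>) \<Longrightarrow> v \<in> carrier (twist \<beta>) \<Longrightarrow>
      h (pure_tensor (twist \<alpha>) (twist \<beta>) u v) = u * \<alpha> v"
    using P.tensor_universal[OF AB.comm_group_axioms] by blast
  have "bimodule_hom P.T (twist (\<alpha> \<circ> \<beta>)) h"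
    by (rule P.bimodule_homI_pure[OF ab h(1)]) (use \<alpha> in \<open>simp_all add: h ring_aut_def algebra_simps\<close>)
  moreover have g: "(\<lambda>m. pure_tensor (twist \<alpha>) (twist \<beta>) m 1) \<in> hom (twist (\<alpha> \<circ> \<beta>)) P.T"
    using balancedD(1)[OF P.pure_balanced, of 1] by (simp add: hom_def)
  moreover have "pure_tensor (twist \<alpha>) (twist \<beta>) (h X) 1 = X" if "X \<in> carrier P.T" for X
  proof -
    have "((\<lambda>m. pure_tensor (twist \<alpha>) (twist \<beta>) m 1) \<circ> h) X = (\<lambda>x. x) X"
    proof (rule P.tensor_hom_eq[OF P.T.is_group hom_compose[OF h(1) g] _ _ that])
      show "((\<lambda>m. pure_tensor (twist \<alpha>) (twist \<beta>) m 1) \<circ> h) (pure_tensor (twist \<alpha>) (twist \<beta>) u v)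
        = pure_tensor (twist \<alpha>) (twist \<beta>) u v" for u v
        using P.pure_move[of u 1 v] by (simp add: h)
    qed (simp add: hom_def)
    then show ?thesis by simp
  qed
  ultimately show ?thesis
    using \<alpha> h(2)[of _ 1]
    by (intro bimodule_isoI[where g = "\<lambda>m. pure_tensor (twist \<alpha>) (twist \<beta>) m 1"])
      (simp_all add: ring_aut_def)
qed

lemma tensor_regular_left:
  assumes "is_bimodule U"
  shows "tensor_bimodule (regular_bimodule :: ('r::ring_1, 'r) bimodule) U \<cong>\<^sub>b U"
proof -
  let ?R = "twist (\<lambda>x. x) :: ('r, 'r) bimodule"
  interpret P: bimodule_pair ?R U
    by (intro bimodule_pairI twist_is_bimodule ring_aut_id assms)
  have "balanced ?R U U (lact U)"
    by (intro balancedI P.V.lact_hom)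
      (simp_all add: hom_def P.V.lact_plus P.V.lact_closed P.V.lact_lact)
  then obtain h where h: "h \<in> hom P.T U"
    "\<And>r v. r \<in> carrier ?R \<Longrightarrow> v \<in> carrier U \<Longrightarrow> h (pure_tensor ?R U r v) = lact U r v"
    using P.tensor_universal[OF P.V.comm_group_axioms] by blast
  have "bimodule_hom P.T U h"
    by (rule P.bimodule_homI_pure[OF assms h(1)])
      (simp_all add: h P.V.lact_lact P.V.lact_ract P.V.ract_closed)
  moreover have g: "pure_tensor ?R U 1 \<in> hom U P.T"
    using balancedD(2)[OF P.pure_balanced, of 1] by simp
  moreover have "pure_tensor ?R U 1 (h X) = X" if "X \<in> carrier P.T" for X
  proof -
    have "(pure_tensor ?R U 1 \<circ> h) X = (\<lambda>x. x) X"
    proof (rule P.tensor_hom_eq[OF P.T.is_group hom_compose[OF h(1) g] _ _ that])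
      show "(pure_tensor ?R U 1 \<circ> h) (pure_tensor ?R U u v) = pure_tensor ?R U u v" if "v \<in> carrier U" for u v
        using P.pure_move[of 1 v u, symmetric] that by (simp add: h)
    qed (simp add: hom_def)
    then show ?thesis by simp
  qed
  ultimately have "P.T \<cong>\<^sub>b U"
    using h(2)[of 1] by (intro bimodule_isoI[where g = "pure_tensor ?R U 1"]) (simp_all add: P.V.lact_one)
  then show ?thesis by (simp add: regular_eq_twist)
qed

text \<open>A left linear map out of the regular bimodule is right multiplication by u = f 1.
  Bijectivity makes u a unit, and compatibility with the right actions reads u \<alpha>(r) = r u, so
  \<alpha> is conjugation by u.\<close>

lemma twist_iso_regular:
  assumes \<alpha>: "ring_aut \<alpha>"
  shows "twist \<alpha> \<cong>\<^sub>b regular_bimodule \<longleftrightarrow> \<alpha> \<in> Inn"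
proof
  assume "twist \<alpha> \<cong>\<^sub>b regular_bimodule"
  then have "regular_bimodule \<cong>\<^sub>b twist \<alpha>"
    unfolding regular_eq_twist by (rule bimodule_iso_sym) (intro twist_is_bimodule \<alpha> ring_aut_id)+
  then obtain f where "f \<in> iso regular_bimodule (twist \<alpha>)"
    and "bimodule_hom regular_bimodule (twist \<alpha>) f"
    unfolding bimodule_iso_def bimodule_hom_def iso_def by blast
  then have f: "bimodule_hom (twist (\<lambda>x. x)) (twist \<alpha>) f" and bij: "bij f"
    unfolding regular_eq_twist iso_def by simp_all
  note fD = bimodule_homD[OF f]
  define u where "u = f 1"
  have fm: "f m = m * u" for m using fD(3)[of 1 m] by (simp add: u_def)
  have ur: "u * \<alpha> r = r * u" for r using fD(4)[of 1 r] by (simp add: fm)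
  obtain v where "f v = 1" using bij_is_surj[OF bij] by (metis surjD)
  then have v: "v * u = 1" by (simp add: fm)
  \<comment> \<open>Surjectivity yields only a left inverse of u; the other side comes from
    injectivity of f.\<close>
  have "f (u * v) = f 1" by (simp add: fm mult.assoc v)
  then have uv: "u * v = 1" using bij by (metis bij_is_inj injD)
  have "\<alpha> r = v * r * u" for r
  proof -
    have "\<alpha> r = (v * u) * \<alpha> r" by (simp add: v)
    also have "\<dots> = v * r * u" by (simp only: mult.assoc ur)
    finally show ?thesis .
  qed
  then have "\<alpha> = (\<lambda>r. v * r * u)" by auto
  then show "\<alpha> \<in> Inn" unfolding Inn_def using uv v by blast
next
  assume "\<alpha> \<in> Inn"
  then obtain u v where \<alpha>': "\<alpha> = (\<lambda>r. v * r * u)" and uv: "u * v = 1" "v * u = 1"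
    by (auto simp: Inn_def)
  have 1: "m * u * v = m" "m * v * u = m" for m by (simp_all only: mult.assoc uv mult_1_right)
  \<comment> \<open>Right multiplication by v cancels the final u of m v r u, and so carries the
    twisted right action to the plain one.\<close>
  have "bimodule_hom (twist \<alpha>) (twist (\<lambda>x. x)) (\<lambda>m. m * v)"
    by (simp add: bimodule_hom_def hom_def \<alpha>' distrib_right) (simp add: mult.assoc uv)
  then have "twist \<alpha> \<cong>\<^sub>b twist (\<lambda>x. x)"
    by (rule bimodule_isoI[where g = "\<lambda>m. m * u"]) (simp_all add: 1)
  then show "twist \<alpha> \<cong>\<^sub>b regular_bimodule" by (simp add: regular_eq_twist)
qed

section \<open>The Picard group\<close>

lemma central_bimoduleD:
  assumes "central_bimodule scale M"
  shows "is_bimodule M" "m \<in> carrier M \<Longrightarrow> lact M (scale k 1) m = ract M m (scale k 1)"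
  using assms by (auto simp: central_bimodule_def)

text \<open>A scalar acting on the left factor is moved through the tensor sign to the right factor,
  with centrality used once in each.\<close>

lemma central_tensor:
  assumes U: "central_bimodule scale U" and V: "central_bimodule scale V"
  shows "central_bimodule scale (tensor_bimodule U V)"
proof -
  interpret bimodule_pair U V
    by (intro bimodule_pairI central_bimoduleD(1)[OF U] central_bimoduleD(1)[OF V])
  show ?thesis
    unfolding central_bimodule_def
  proof (intro conjI allI ballI tensor_is_bimodule)
    fix k X assume X: "X \<in> carrier T"
    show "lact T (scale k 1) X = ract T X (scale k 1)"
      by (rule tensor_hom_eq[OF T.is_group tensor_lact_hom tensor_ract_hom _ X])
        (simp add: lact_pure ract_pure central_bimoduleD(2)[OF U] pure_move central_bimoduleD(2)[OF V])
  qed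
qed

lemma central_bimodule_cong:
  assumes M: "central_bimodule scale M" and "M \<cong>\<^sub>b N" and N: "is_bimodule N"
  shows "central_bimodule scale N"
proof -
  obtain f g where fg: "bimodule_hom M N f" "bimodule_hom N M g" "\<And>n. n \<in> carrier N \<Longrightarrow> f (g n) = n"
    using bimodule_isoE[OF assms(2) central_bimoduleD(1)[OF M] N] by metis
  note fD = bimodule_homD[OF fg(1)] and gD = bimodule_homD[OF fg(2)]
  have "lact N (scale k 1) n = ract N n (scale k 1)" if "n \<in> carrier N" for k n
    using that fD(3)[of "g n" "scale k 1"] fD(4)[of "g n" "scale k 1"] gD(2)
    by (simp add: fg(3) central_bimoduleD(2)[OF M])
  then show ?thesis using N by (simp add: central_bimodule_def)
qed

section \<open>Representatives on a fixed carrier type\<close>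

lemma bimodule_copy:
  fixes P :: "('r::ring_1, 'm) bimodule" and F :: "'m \<Rightarrow> 'n"
  assumes "is_bimodule P" and inj: "inj_on F (carrier P)"
  obtains W :: "('r, 'n) bimodule" where "is_bimodule W" "W \<cong>\<^sub>b P"
proof -
  interpret P: is_bimodule P by fact
  define G where "G = inv_into (carrier P) F"
  have GF: "G (F p) = p" if "p \<in> carrier P" for p using inj that by (simp add: G_def)
  define W where "W = \<lparr>carrier = F ` carrier P, monoid.mult = (\<lambda>a b. F (G a \<otimes>\<^bsub>P\<^esub> G b)), one = F \<one>\<^bsub>P\<^esub>,
     lact = (\<lambda>r a. F (lact P r (G a))), ract = (\<lambda>a r. F (ract P (G a) r))\<rparr>"
  note cl = P.lact_closed P.ract_closed
  have "is_bimodule W"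
  proof (intro is_bimodule.intro comm_groupI is_bimodule_axioms.intro)
    fix x assume "x \<in> carrier W"
    then obtain p where p: "p \<in> carrier P" "x = F p" by (auto simp: W_def)
    show "\<exists>y\<in>carrier W. y \<otimes>\<^bsub>W\<^esub> x = \<one>\<^bsub>W\<^esub>"
      by (rule bexI[of _ "F (inv\<^bsub>P\<^esub> p)"]) (use p in \<open>auto simp: W_def GF\<close>)
  qed (auto simp: W_def GF cl P.m_ac P.lact_add P.ract_add P.lact_plus P.ract_plus
      P.lact_lact P.ract_ract P.lact_one P.ract_one P.lact_ract)
  moreover have "bimodule_hom W P G"
    by (auto simp: bimodule_hom_def hom_def W_def GF cl)
  then have "W \<cong>\<^sub>b P"
    by (rule bimodule_isoI[where g = F]) (auto simp: W_def GF)
  ultimately show thesis by (rule that)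
qed

text \<open>If \<open>1 \<in> R \<simeq> P \<otimes> Q\<close> corresponds to \<open>\<Sum> p\<^sub>i \<otimes> q\<^sub>i\<close>, then \<open>p \<mapsto> (q\<^sub>i \<otimes> p)\<^sub>i \<in> (Q \<otimes> P)\<^sup>n \<simeq> R\<^sup>n\<close> is injective.\<close>

lemma invertible_embedding:
  fixes P :: "('r::ring_1, 'p) bimodule" and Q :: "('r, 'q) bimodule"
  assumes "is_bimodule P" "is_bimodule Q"
    and PQ: "tensor_bimodule P Q \<cong>\<^sub>b regular_bimodule"
    and QP: "tensor_bimodule Q P \<cong>\<^sub>b regular_bimodule"
  obtains F :: "'p \<Rightarrow> nat \<Rightarrow> 'r" where "inj_on F (carrier P)"
proof -
  interpret PQP: bimodule_triple P Q P by (intro bimodule_tripleI assms)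
  let ?pP = "pure_tensor PQP.UV.T P" and ?qp = "pure_tensor Q P"
  let ?R = "regular_bimodule :: ('r, 'r) bimodule"
  have R: "is_bimodule ?R" unfolding regular_eq_twist by (intro twist_is_bimodule ring_aut_id)
  have Rsel: "carrier ?R = UNIV" "lact ?R = (*)" "ract ?R = (*)" "one ?R = 0" "monoid.mult ?R = (+)"
    by (simp_all add: regular_bimodule_def)
  obtain \<phi> \<phi>' where \<phi>: "bimodule_hom PQP.UV.T ?R \<phi>" "bimodule_hom ?R PQP.UV.T \<phi>'"
      "\<And>n. n \<in> carrier ?R \<Longrightarrow> \<phi> (\<phi>' n) = n"
    using bimodule_isoE[OF PQ PQP.UV.tensor_is_bimodule R] by metis
  obtain \<psi> \<psi>' where \<psi>: "bimodule_hom PQP.VW.T ?R \<psi>" "bimodule_hom ?R PQP.VW.T \<psi>'"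
      "\<And>m. m \<in> carrier PQP.VW.T \<Longrightarrow> \<psi>' (\<psi> m) = m"
    using bimodule_isoE[OF QP PQP.VW.tensor_is_bimodule R] by metis
  let ?LT = "PQP.L.T"
  \<comment> \<open>\<open>sep X qs\<close> says that the finitely many q in \<open>qs\<close>
    detect p inside X \<otimes> p. Proving by induction that every X has such a list replaces an
    explicit expansion of X into pure tensors.\<close>
  define sep where "sep X qs \<longleftrightarrow> set qs \<subseteq> carrier Q \<and> (\<forall>p\<in>carrier P. \<forall>p'\<in>carrier P.
      (\<forall>q\<in>set qs. ?qp q p = ?qp q p') \<longrightarrow>
      ?pP X p = ?pP X p')" for X qs
  have sep_ex: "\<exists>qs. sep X qs" if "X \<in> carrier PQP.UV.T" for X
    using that
  proof (induction rule: PQP.UV.tensor_induct)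
    case zero
    have "?pP \<one>\<^bsub>PQP.UV.T\<^esub> p = \<one>\<^bsub>?LT\<^esub>" if "p \<in> carrier P" for p
      by (rule hom_one[OF balancedD(1)[OF PQP.L.pure_balanced that] PQP.UV.T.is_group PQP.L.T.is_group])
    then have "sep \<one>\<^bsub>PQP.UV.T\<^esub> []" by (simp add: sep_def)
    then show ?case ..
  next
    case (pure u v)
    \<comment> \<open>Rebracketing writes (u \<otimes> v) \<otimes> p as the image of u \<otimes> (v
      \<otimes> p), which depends on p only through v \<otimes> p.\<close>
    obtain h where "h \<in> hom PQP.R.T PQP.L.T" and h: "\<And>u v w. u \<in> carrier P \<Longrightarrow> v \<in> carrier Q \<Longrightarrow> w \<in> carrier P \<Longrightarrow>
      h (pure_tensor P PQP.VW.T u (?qp v w)) = ?pP (pure_tensor P Q u v) w"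
      by (rule PQP.ex_hom_right[OF PQP.L.comm_group_T PQP.balanced_assoc_right PQP.balanced_assoc_right'])
        (assumption, assumption, rule that)
    have "sep (pure_tensor P Q u v) [v]"
      unfolding sep_def
    proof (intro conjI ballI impI)
      fix p p' assume p: "p \<in> carrier P" "p' \<in> carrier P"
        "\<forall>q\<in>set [v]. ?qp q p = ?qp q p'"
      show "?pP (pure_tensor P Q u v) p = ?pP (pure_tensor P Q u v) p'"
        using p h[of u v p] h[of u v p'] pure by simp
    qed (use pure in simp)
    then show ?case ..
  next
    case (add X Y)
    obtain qs qs' where IH: "sep X qs" "sep Y qs'" using add.IH by blast
    have "sep (X \<otimes>\<^bsub>PQP.UV.T\<^esub> Y) (qs @ qs')"
      unfolding sep_def
    proof (intro conjI ballI impI)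
      fix p p' assume p: "p \<in> carrier P" "p' \<in> carrier P"
        and "\<forall>q\<in>set (qs @ qs'). ?qp q p = ?qp q p'"
      then have "?pP X p = ?pP X p'"
        "?pP Y p = ?pP Y p'"
        using IH unfolding sep_def set_append ball_Un by blast+
      then show "?pP (X \<otimes>\<^bsub>PQP.UV.T\<^esub> Y) p = ?pP (X \<otimes>\<^bsub>PQP.UV.T\<^esub> Y) p'"
        by (simp only: PQP.L.pure_add_left[OF add.hyps(1,2)] p)
    qed (use IH in \<open>auto simp: sep_def\<close>)
    then show ?case ..
  qed
  have one: "\<phi>' 1 \<in> carrier PQP.UV.T" "\<phi> (\<phi>' 1) = 1"
    using bimodule_homD(2)[OF \<phi>(2), of 1] \<phi>(3) by (simp_all add: Rsel)
  obtain qs where qs1: "sep (\<phi>' 1) qs" using sep_ex[OF one(1)] ..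
  have qs: "set qs \<subseteq> carrier Q" using qs1 unfolding sep_def by (rule conjunct1)
  have inj: "?pP (\<phi>' 1) p = ?pP (\<phi>' 1) p'"
    if "p \<in> carrier P" "p' \<in> carrier P"
      "\<And>q. q \<in> set qs \<Longrightarrow> ?qp q p = ?qp q p'" for p p'
    using qs1 that unfolding sep_def by blast
  \<comment> \<open>The map X \<otimes> p \<mapsto> \<phi>(X) p returns p at X = \<phi>'(1), so
    equality of the tensors forces equality of the elements.\<close>
  have bal: "balanced PQP.UV.T P P (\<lambda>X p. lact P (\<phi> X) p)"
  proof (rule balancedI)
    fix v assume "v \<in> carrier P"
    then show "(\<lambda>X. lact P (\<phi> X) v) \<in> hom PQP.UV.T P"
      using hom_mult[OF bimodule_homD(1)[OF \<phi>(1)]]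
      by (intro homI) (simp_all add: PQP.UV.U.lact_closed Rsel PQP.UV.U.lact_plus)
  qed (simp_all add: PQP.UV.U.lact_hom bimodule_homD(4)[OF \<phi>(1)] Rsel PQP.UV.U.lact_lact)
  obtain k where "k \<in> hom PQP.L.T P" and k: "\<And>X p. X \<in> carrier PQP.UV.T \<Longrightarrow> p \<in> carrier P \<Longrightarrow>
      k (?pP X p) = lact P (\<phi> X) p"
    by (rule PQP.L.tensor_universal[OF PQP.UV.U.comm_group_axioms bal]) (rule that)
  define F where "F p i = (if i < length qs then \<psi> (?qp (qs ! i) p) else 0)" for p and i :: nat
  have "inj_on F (carrier P)"
  proof (rule inj_onI)
    fix p p' assume p: "p \<in> carrier P" "p' \<in> carrier P" "F p = F p'"
    have "?qp q p = ?qp q p'" if q: "q \<in> set qs" for q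
    proof -
      obtain i where i: "i < length qs" "q = qs ! i" using q by (auto simp: in_set_conv_nth)
      have "\<psi> (?qp q p) = \<psi> (?qp q p')"
        using fun_cong[OF p(3), of i] i by (simp add: F_def)
      then show ?thesis
        using \<psi>(3) q qs p PQP.VW.pure_closed by (metis subsetD)
    qed
    note eq = inj[OF p(1,2) this]
    have "p = k (?pP (\<phi>' 1) p)"
      by (simp only: k[OF one(1) p(1)] one PQP.UV.U.lact_one[OF p(1)])
    also have "\<dots> = p'"
      by (simp only: eq k[OF one(1) p(2)] one PQP.UV.U.lact_one[OF p(2)])
    finally show "p = p'" .
  qed
  then show thesis by (rule that)
qed

section \<open>Inverse pairs and the group of classes\<close>

lemma regular_is_bimodule: "is_bimodule (regular_bimodule :: ('r::ring_1, 'r) bimodule)"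
  unfolding regular_eq_twist by (intro twist_is_bimodule ring_aut_id)

text \<open>Unlike in \<open>invertible_bimodule\<close>, the partner may live on any carrier type.
  Tensor products leave the small type, so the group laws are proved for pairs and partners are made
  small afterwards.\<close>

definition inverse_pair ::
  "('k::field \<Rightarrow> 'r::ring_1 \<Rightarrow> 'r) \<Rightarrow> ('r, 'm) bimodule \<Rightarrow> ('r, 'n) bimodule \<Rightarrow> bool"
  where "inverse_pair scale P Q \<longleftrightarrow> central_bimodule scale P \<and> central_bimodule scale Q \<and>
    tensor_bimodule P Q \<cong>\<^sub>b regular_bimodule \<and>
    tensor_bimodule Q P \<cong>\<^sub>b regular_bimodule"

lemma inverse_pairD:
  assumes "inverse_pair scale P Q"
  shows "central_bimodule scale P" "central_bimodule scale Q" "is_bimodule P" "is_bimodule Q"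
    and "tensor_bimodule P Q \<cong>\<^sub>b regular_bimodule"
    and "tensor_bimodule Q P \<cong>\<^sub>b regular_bimodule"
  using assms by (auto simp: inverse_pair_def central_bimodule_def)

lemma inverse_pair_sym: "inverse_pair scale P Q \<Longrightarrow> inverse_pair scale Q P"
  by (simp add: inverse_pair_def)

lemma inverse_pair_cong:
  assumes P: "inverse_pair scale P Q" and PP': "P \<cong>\<^sub>b P'" and P': "is_bimodule P'"
  shows "inverse_pair scale P' Q"
proof -
  note D = inverse_pairD[OF P]
  note sym = bimodule_iso_sym[OF PP' D(3) P']
  have eq: "tensor_bimodule P' Q \<cong>\<^sub>b tensor_bimodule P Q" "tensor_bimodule Q P' \<cong>\<^sub>b tensor_bimodule Q P"
    by (rule tensor_iso_cong; intro sym D P' bimodule_iso_refl)+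
  show ?thesis
    unfolding inverse_pair_def
    by (intro conjI D(2) central_bimodule_cong[OF D(1) PP' P']
        bimodule_iso_trans[OF eq(1) D(5)] bimodule_iso_trans[OF eq(2) D(6)])
qed

text \<open>This makes \<open>iso_class\<close> nonempty for an invertible bimodule on any carrier
  type; an empty class would say nothing about its bimodule.\<close>

lemma small_representative:
  fixes P :: "('r::ring_1, 'p) bimodule"
  assumes P: "inverse_pair scale P Q"
  obtains W :: "'r small_bimodule" where "central_bimodule scale W" "W \<cong>\<^sub>b P"
proof -
  note D = inverse_pairD[OF P]
  obtain F :: "'p \<Rightarrow> nat \<Rightarrow> 'r" where F: "inj_on F (carrier P)"
    using invertible_embedding[OF D(3-6)] .
  obtain W :: "'r small_bimodule" where W: "is_bimodule W" "W \<cong>\<^sub>b P"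
    using bimodule_copy[OF D(3) F] .
  show thesis
    by (rule that[OF central_bimodule_cong[OF D(1) bimodule_iso_sym[OF W(2,1) D(3)] W(1)] W(2)])
qed

text \<open>The inner pair cancels first, leaving the outer one. The auxiliary \<open>key\<close>
  keeps all carrier types open because it serves both orders of the product.\<close>

lemma inverse_pair_tensor:
  assumes P: "inverse_pair scale P P'" and Q: "inverse_pair scale Q Q'"
  shows "inverse_pair scale (tensor_bimodule P Q) (tensor_bimodule Q' P')"
proof -
  note D = inverse_pairD[OF P] inverse_pairD[OF Q]
  have B: "is_bimodule (tensor_bimodule M N)" if "is_bimodule M" "is_bimodule N"
    for M :: "('b, 'm) bimodule" and N :: "('b, 'n) bimodule"
    using that by (rule bimodule_pair.tensor_is_bimodule[OF bimodule_pairI])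
  have assoc: "tensor_bimodule (tensor_bimodule U V) W \<cong>\<^sub>b tensor_bimodule U (tensor_bimodule V W)"
    if "is_bimodule U" "is_bimodule V" "is_bimodule W"
    for U :: "('b, 'u) bimodule" and V :: "('b, 'v) bimodule" and W :: "('b, 'w) bimodule"
    using that by (rule bimodule_triple.tensor_assoc_iso[OF bimodule_tripleI])
  have key: "tensor_bimodule (tensor_bimodule U V) (tensor_bimodule V' U') \<cong>\<^sub>b regular_bimodule"
    if U: "is_bimodule U" and V: "is_bimodule V" and V': "is_bimodule V'" and U': "is_bimodule U'"
      and VV': "tensor_bimodule V V' \<cong>\<^sub>b regular_bimodule"
      and UU': "tensor_bimodule U U' \<cong>\<^sub>b regular_bimodule"
    for U :: "('b, 'u) bimodule" and V :: "('b, 'v) bimodule"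
      and V' :: "('b, 'v2) bimodule" and U' :: "('b, 'u2) bimodule"
  proof -
    have "tensor_bimodule (tensor_bimodule U V) (tensor_bimodule V' U') \<cong>\<^sub>b
        tensor_bimodule U (tensor_bimodule V (tensor_bimodule V' U'))"
      by (intro assoc B U V V' U')
    also have "\<dots> \<cong>\<^sub>b tensor_bimodule U (tensor_bimodule (tensor_bimodule V V') U')"
      by (rule tensor_iso_cong[OF bimodule_iso_refl bimodule_iso_sym[OF assoc]]) (intro assoc B U V V' U')+
    also have "\<dots> \<cong>\<^sub>b tensor_bimodule U (tensor_bimodule regular_bimodule U')"
      by (rule tensor_iso_cong[OF bimodule_iso_refl tensor_iso_cong[OF VV' bimodule_iso_refl]])
        (intro B U V V' U' regular_is_bimodule)+
    also have "\<dots> \<cong>\<^sub>b tensor_bimodule U U'"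
      by (rule tensor_iso_cong[OF bimodule_iso_refl tensor_regular_left])
        (intro B U U' regular_is_bimodule)+
    also note UU'
    finally show ?thesis .
  qed
  show ?thesis
    unfolding inverse_pair_def
    by (intro conjI central_tensor key D)
qed

lemma inverse_pair_regular:
  assumes "unital_algebra scale"
  shows "inverse_pair scale regular_bimodule regular_bimodule"
proof -
  interpret unital_algebra scale by fact
  have "central_bimodule scale regular_bimodule"
    unfolding central_bimodule_def
    by (simp add: regular_is_bimodule) (simp add: regular_bimodule_def flip: scale_mult_left scale_mult_right)
  then show ?thesis
    unfolding inverse_pair_def by (intro conjI tensor_regular_left regular_is_bimodule)
qed

lemma inverse_pair_invertible:
  assumes "inverse_pair scale P Q"
  shows "invertible_bimodule scale P"
proof -
  obtain W :: "'b small_bimodule" where W: "central_bimodule scale W" "W \<cong>\<^sub>b Q"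
    by (rule small_representative[OF inverse_pair_sym[OF assms]])
  note D = inverse_pairD[OF assms]
  have "inverse_pair scale W P"
    by (rule inverse_pair_cong[OF inverse_pair_sym[OF assms] bimodule_iso_sym[OF W(2) _ D(4)]])
      (intro central_bimoduleD(1)[OF W(1)])+
  from inverse_pair_sym[OF this] show ?thesis
    unfolding invertible_bimodule_def inverse_pair_def by blast
qed

lemma invertible_inverse_pair:
  assumes "invertible_bimodule scale P"
  obtains Q :: "'r::ring_1 small_bimodule" where "inverse_pair scale P Q"
  using assms unfolding invertible_bimodule_def inverse_pair_def by blast

lemma iso_class_cong:
  assumes "P \<cong>\<^sub>b Q" "is_bimodule P" "is_bimodule Q"
  shows "iso_class scale P = iso_class scale Q"
  unfolding iso_class_def
  using bimodule_iso_trans[OF _ assms(1)] bimodule_iso_trans[OF _ bimodule_iso_sym[OF assms]] by blast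

text \<open>A member W of the nonempty class of P lies in both classes and so connects P with
  Q.\<close>

lemma iso_class_eq_iff:
  assumes P: "inverse_pair scale P P'" and Q: "is_bimodule Q"
  shows "iso_class scale P = iso_class scale Q \<longleftrightarrow> P \<cong>\<^sub>b Q"
proof
  note D = inverse_pairD[OF P]
  obtain W :: "'b small_bimodule" where W: "central_bimodule scale W" "W \<cong>\<^sub>b P"
    by (rule small_representative[OF P])
  assume "iso_class scale P = iso_class scale Q"
  then have "W \<cong>\<^sub>b Q" using W by (auto simp: iso_class_def)
  with bimodule_iso_sym[OF W(2) central_bimoduleD(1)[OF W(1)] D(3)] show "P \<cong>\<^sub>b Q"
    by (rule bimodule_iso_trans)
next
  assume "P \<cong>\<^sub>b Q"
  then show "iso_class scale P = iso_class scale Q"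
    by (rule iso_class_cong[OF _ inverse_pairD(3)[OF P] Q])
qed

lemma Pic_carrierI:
  assumes P: "inverse_pair scale P P'"
  shows "iso_class scale P \<in> carrier (Pic scale)"
proof -
  note D = inverse_pairD[OF P]
  obtain W :: "'b small_bimodule" where W: "central_bimodule scale W" "W \<cong>\<^sub>b P"
    by (rule small_representative[OF P])
  note W' = central_bimoduleD(1)[OF W(1)]
  have "iso_class scale P = iso_class scale W"
    by (rule iso_class_cong[OF bimodule_iso_sym[OF W(2) W' D(3)] D(3) W'])
  moreover have "invertible_bimodule scale W"
    by (rule inverse_pair_invertible[OF inverse_pair_cong[OF P bimodule_iso_sym[OF W(2) W' D(3)] W']])
  ultimately show ?thesis by (auto simp: Pic_def)
qed

lemma Pic_carrierE:
  assumes "A \<in> carrier (Pic scale)"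
  obtains P Q :: "'r::ring_1 small_bimodule" where "inverse_pair scale P Q" "A = iso_class scale P"
  using assms invertible_inverse_pair unfolding Pic_def by (auto; metis)

text \<open>The product is a union over representatives. All choices give one class because
  tensoring respects isomorphism, and the union is not an empty one because both classes have
  members.\<close>

lemma Pic_mult:
  assumes P: "inverse_pair scale P P'" and Q: "inverse_pair scale Q Q'"
  shows "iso_class scale P \<otimes>\<^bsub>Pic scale\<^esub> iso_class scale Q = iso_class scale (tensor_bimodule P Q)"
proof -
  note D = inverse_pairD[OF P] and E = inverse_pairD[OF Q]
  have eq: "iso_class scale (tensor_bimodule U V) = iso_class scale (tensor_bimodule P Q)"
    if "U \<in> iso_class scale P" "V \<in> iso_class scale Q" for U V :: "'b small_bimodule"
  proof -
    have U: "is_bimodule U" "U \<cong>\<^sub>b P" and V: "is_bimodule V" "V \<cong>\<^sub>b Q"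
      using that by (auto simp: iso_class_def central_bimodule_def)
    show ?thesis
      by (rule iso_class_cong[OF tensor_iso_cong[OF U(2) V(2)]])
        (intro U V D E bimodule_pair.tensor_is_bimodule bimodule_pairI)+
  qed
  obtain W :: "'b small_bimodule" where "W \<in> iso_class scale P"
    by (rule small_representative[OF P]) (auto simp: iso_class_def)
  moreover obtain W' :: "'b small_bimodule" where "W' \<in> iso_class scale Q"
    by (rule small_representative[OF Q]) (auto simp: iso_class_def)
  ultimately have "(\<Union>U\<in>iso_class scale P. \<Union>V\<in>iso_class scale Q. iso_class scale (tensor_bimodule U V))
      = iso_class scale (tensor_bimodule P Q)"
    using eq by blast
  then show ?thesis by (simp add: Pic_def)
qed

lemma group_Pic:
  assumes "unital_algebra scale"
  shows "group (Pic (scale :: 'k::field \<Rightarrow> 'r::ring_1 \<Rightarrow> 'r))"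
proof (rule groupI)
  let ?R = "regular_bimodule :: ('r, 'r) bimodule"
  have one: "\<one>\<^bsub>Pic scale\<^esub> = iso_class scale ?R" by (simp add: Pic_def)
  note R = inverse_pair_regular[OF assms]
  show "\<one>\<^bsub>Pic scale\<^esub> \<in> carrier (Pic scale)" unfolding one by (rule Pic_carrierI[OF R])
  fix A assume "A \<in> carrier (Pic scale)"
  then obtain P P' :: "'r small_bimodule" where P: "inverse_pair scale P P'" "A = iso_class scale P"
    by (rule Pic_carrierE)
  note PD = inverse_pairD[OF P(1)]
  have "iso_class scale ?R \<otimes>\<^bsub>Pic scale\<^esub> A = A"
    unfolding P(2) Pic_mult[OF R P(1)]
    by (rule iso_class_cong[OF tensor_regular_left[OF PD(3)]])
      (intro PD regular_is_bimodule bimodule_pair.tensor_is_bimodule bimodule_pairI)+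
  then show "\<one>\<^bsub>Pic scale\<^esub> \<otimes>\<^bsub>Pic scale\<^esub> A = A" unfolding one .
  show "\<exists>B\<in>carrier (Pic scale). B \<otimes>\<^bsub>Pic scale\<^esub> A = \<one>\<^bsub>Pic scale\<^esub>"
  proof (rule bexI)
    show "iso_class scale P' \<in> carrier (Pic scale)" by (rule Pic_carrierI[OF inverse_pair_sym[OF P(1)]])
    show "iso_class scale P' \<otimes>\<^bsub>Pic scale\<^esub> A = \<one>\<^bsub>Pic scale\<^esub>"
      unfolding P(2) Pic_mult[OF inverse_pair_sym[OF P(1)] P(1)] one
      by (rule iso_class_cong[OF PD(6)])
        (intro PD regular_is_bimodule bimodule_pair.tensor_is_bimodule bimodule_pairI)+
  qed
  fix B assume "B \<in> carrier (Pic scale)"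
  then obtain Q Q' :: "'r small_bimodule" where Q: "inverse_pair scale Q Q'" "B = iso_class scale Q"
    by (rule Pic_carrierE)
  note QD = inverse_pairD[OF Q(1)]
  show "A \<otimes>\<^bsub>Pic scale\<^esub> B \<in> carrier (Pic scale)"
    unfolding P(2) Q(2) Pic_mult[OF P(1) Q(1)] by (rule Pic_carrierI[OF inverse_pair_tensor[OF P(1) Q(1)]])
  fix C assume "C \<in> carrier (Pic scale)"
  then obtain W W' :: "'r small_bimodule" where W: "inverse_pair scale W W'" "C = iso_class scale W"
    by (rule Pic_carrierE)
  note WD = inverse_pairD[OF W(1)]
  show "A \<otimes>\<^bsub>Pic scale\<^esub> B \<otimes>\<^bsub>Pic scale\<^esub> C = A \<otimes>\<^bsub>Pic scale\<^esub> (B \<otimes>\<^bsub>Pic scale\<^esub> C)"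
    unfolding P(2) Q(2) W(2) Pic_mult[OF P(1) Q(1)] Pic_mult[OF Q(1) W(1)]
      Pic_mult[OF inverse_pair_tensor[OF P(1) Q(1)] W(1)] Pic_mult[OF P(1) inverse_pair_tensor[OF Q(1) W(1)]]
    by (rule iso_class_cong[OF bimodule_triple.tensor_assoc_iso[OF bimodule_tripleI]])
      (intro PD QD WD bimodule_pair.tensor_is_bimodule bimodule_pairI)+
qed

text \<open>That \<alpha> fixes the scalars is what makes the twist central. The inverse
  automorphism fixes them too, and the two twists compose to the identity twist.\<close>

lemma inverse_pair_twist:
  assumes \<alpha>: "ring_aut \<alpha>" and c: "\<And>k. \<alpha> (scale k 1) = scale k 1" and "unital_algebra scale"
  shows "inverse_pair scale (twist \<alpha>) (twist (inv_into UNIV \<alpha>))"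
proof -
  interpret unital_algebra scale by fact
  let ?b = "inv_into UNIV \<alpha>"
  have b: "ring_aut ?b" by (rule ring_aut_inv[OF \<alpha>])
  have bij: "bij \<alpha>" using \<alpha> by (simp add: ring_aut_def)
  have c': "?b (scale k 1) = scale k 1" for k using c bij by (metis bij_inv_eq_iff)
  have id: "\<alpha> \<circ> ?b = (\<lambda>x. x)" "?b \<circ> \<alpha> = (\<lambda>x. x)"
    using bij by (auto simp: fun_eq_iff bij_is_surj surj_f_inv_f bij_is_inj)
  have cen: "central_bimodule scale (twist \<gamma>)" if "ring_aut \<gamma>" "\<And>k. \<gamma> (scale k 1) = scale k 1" for \<gamma>
    unfolding central_bimodule_def
    by (simp add: twist_is_bimodule that flip: scale_mult_left scale_mult_right)
  show ?thesis
    unfolding inverse_pair_def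
    using cen[OF \<alpha> c] cen[OF b c'] tensor_twist[OF \<alpha> b] tensor_twist[OF b \<alpha>]
    by (simp add: id regular_eq_twist)
qed

lemma Pic_pow_twist:
  assumes \<alpha>: "ring_aut \<alpha>" and c: "\<And>k. \<alpha> (scale k 1) = scale k 1" and alg: "unital_algebra scale"
  shows "iso_class scale (twist \<alpha>) [^]\<^bsub>Pic scale\<^esub> n = iso_class scale (twist (\<alpha> ^^ n))"
proof (induction n)
  case 0
  show ?case by (simp add: Pic_def regular_eq_twist id_def)
next
  case (Suc n)
  have c': "(\<alpha> ^^ n) (scale k 1) = scale k 1" for k by (induction n) (simp_all add: c)
  note an = ring_aut_funpow[OF \<alpha>, of n]
  have "iso_class scale (twist \<alpha>) [^]\<^bsub>Pic scale\<^esub> Suc n =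
      iso_class scale (tensor_bimodule (twist (\<alpha> ^^ n)) (twist \<alpha>))"
    by (simp add: Suc Pic_mult[OF inverse_pair_twist[OF an c' alg] inverse_pair_twist[OF \<alpha> c alg]])
  also have "\<dots> = iso_class scale (twist (\<alpha> ^^ n \<circ> \<alpha>))"
    by (rule iso_class_cong[OF tensor_twist])
      (intro an \<alpha> ring_aut_comp twist_is_bimodule bimodule_pair.tensor_is_bimodule bimodule_pairI)+
  finally show ?case by (simp only: funpow_Suc_right)
qed

section \<open>Sweedler sums\<close>

lemmas lin_iff = Vector_Spaces.linear_iff

lemmas linear_sum = Vector_Spaces.linear.axioms(3)[THEN module_hom.sum]

lemma linear_additive:
  assumes "Vector_Spaces.linear s1 s2 f"
  shows "f (a + b) = f a + f b" "f (s1 k a) = s2 k (f a)" "f 0 = 0" "f (a - b) = f a - f b"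
proof -
  have add: "f (x + y) = f x + f y" for x y
    using assms by (simp add: lin_iff)
  show "f (a + b) = f a + f b" by (rule add)
  show "f (s1 k a) = s2 k (f a)" using assms by (simp add: lin_iff)
  show "f 0 = 0" using add[of 0 0] by simp
  show "f (a - b) = f a - f b" using add[of "a - b" b] by simp
qed

lemma space_sel [simp]:
  "carrier (space_bimodule s) = UNIV" "monoid.mult (space_bimodule s) = (+)" "one (space_bimodule s) = 0"
  "lact (space_bimodule s) = s" "ract (space_bimodule s) = (\<lambda>v k. s k v)"
  by (simp_all add: space_bimodule_def)

lemma space_is_bimodule:
  assumes "vector_space s"
  shows "is_bimodule (space_bimodule s)"
proof -
  interpret vector_space s by fact
  show ?thesis
    by (intro is_bimodule.intro is_bimodule_axioms.intro comm_group_cong[OF comm_group_additive])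
      (simp_all add: scale_right_distrib scale_left_distrib mult.commute)
qed

lemma vector_space_field: "vector_space ((*) :: 'k::field \<Rightarrow> 'k \<Rightarrow> 'k)"
  by unfold_locales (simp_all add: algebra_simps)

definition bilinear_map ::
  "('k::field \<Rightarrow> 'u::ab_group_add \<Rightarrow> 'u) \<Rightarrow> ('k \<Rightarrow> 'v::ab_group_add \<Rightarrow> 'v) \<Rightarrow>
   ('k \<Rightarrow> 'w::ab_group_add \<Rightarrow> 'w) \<Rightarrow> ('u \<Rightarrow> 'v \<Rightarrow> 'w) \<Rightarrow> bool"
  where "bilinear_map s1 s2 s3 f \<longleftrightarrow> (\<forall>v. Vector_Spaces.linear s1 s3 (\<lambda>u. f u v)) \<and> (\<forall>u. Vector_Spaces.linear s2 s3 (f u))"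

lemma bilinear_mapI:
  "(\<And>v. Vector_Spaces.linear s1 s3 (\<lambda>u. f u v)) \<Longrightarrow> (\<And>u. Vector_Spaces.linear s2 s3 (f u)) \<Longrightarrow> bilinear_map s1 s2 s3 f"
  by (simp add: bilinear_map_def)

lemma bilinear_mapD:
  assumes "bilinear_map s1 s2 s3 f"
  shows "Vector_Spaces.linear s1 s3 (\<lambda>u. f u v)" "Vector_Spaces.linear s2 s3 (f u)"
  using assms by (simp_all add: bilinear_map_def)

lemma balanced_bilinear:
  assumes "bilinear_map s1 s2 s3 f"
  shows "balanced (space_bimodule s1) (space_bimodule s2) (space_bimodule s3) f"
  using linear_additive[OF bilinear_mapD(1)[OF assms]] linear_additive[OF bilinear_mapD(2)[OF assms]]
  by (intro balancedI) (simp_all add: hom_def)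

text \<open>The integer combination agrees with the homomorphism from the universal property on the
  whole free group. Hence it has the same value on all representatives, and \<open>the_elem\<close>
  is taken of a singleton.\<close>

lemma (in bimodule_pair) tensor_lift:
  fixes f :: "'u \<Rightarrow> 'v \<Rightarrow> 'c::ring_1"
  assumes bal: "balanced U V \<lparr>carrier = UNIV, monoid.mult = (+), one = 0\<rparr> f"
  shows "tensor_lift f \<in> hom T \<lparr>carrier = UNIV, monoid.mult = (+), one = 0\<rparr>" (is "_ \<in> hom T ?A")
    and "\<And>u v. u \<in> carrier U \<Longrightarrow> v \<in> carrier V \<Longrightarrow> tensor_lift f (pure_tensor U V u v) = f u v"
proof -
  obtain h where h: "h \<in> hom T ?A"
    "\<And>u v. u \<in> carrier U \<Longrightarrow> v \<in> carrier V \<Longrightarrow> h (pure_tensor U V u v) = f u v"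
    by (rule tensor_universal[OF comm_group_additive bal]) (rule that)
  let ?s = "\<lambda>x. \<Sum>p\<in>Poly_Mapping.keys x. of_int (Poly_Mapping.lookup x p) * f (fst p) (snd p)"
  \<comment> \<open>Keys may cancel in x + y, so all three sums are taken over the union of the keys
    of x and y.\<close>
  have s_sup: "?s x = (\<Sum>p\<in>S. of_int (Poly_Mapping.lookup x p) * f (fst p) (snd p))"
    if "finite S" "Poly_Mapping.keys x \<subseteq> S" for x S
    using that by (intro sum.mono_neutral_left) (auto simp: in_keys_iff)
  have s_add: "?s (x + y) = ?s x + ?s y" for x y
  proof -
    let ?S = "Poly_Mapping.keys x \<union> Poly_Mapping.keys y"
    have "?s (x + y) = (\<Sum>p\<in>?S. of_int (Poly_Mapping.lookup (x + y) p) * f (fst p) (snd p))"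
      by (rule s_sup) (use keys_add[of x y] in auto)
    also have "\<dots> = (\<Sum>p\<in>?S. of_int (Poly_Mapping.lookup x p) * f (fst p) (snd p)) +
        (\<Sum>p\<in>?S. of_int (Poly_Mapping.lookup y p) * f (fst p) (snd p))"
      by (simp add: lookup_add distrib_right sum.distrib)
    also have "\<dots> = ?s x + ?s y"
      using s_sup[of ?S x] s_sup[of ?S y] by (simp only: finite_UnI finite_keys Un_upper1 Un_upper2)
    finally show ?thesis .
  qed
  have s: "?s \<in> hom F ?A" by (rule homI) (simp_all add: s_add)
  have eq: "?s x = h (tensor_class U V x)" if "x \<in> carrier F" for x
  proof -
    have "?s x = (h \<circ> tensor_class U V) x"
      by (rule free_hom_eq[OF comm_group.axioms(2)[OF comm_group_additive] s hom_compose[OF tensor_class_hom h(1)] _ that])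
        (simp add: h(2)[unfolded pure_tensor_def])
    then show ?thesis by simp
  qed
  have lift: "tensor_lift f X = h X" if X: "X \<in> carrier T" for X
  proof -
    obtain x where x: "x \<in> carrier F" "X = tensor_class U V x" using X by (rule tensor_classE)
    have "?s ` X = {h X}"
    proof (intro equalityI subsetI)
      fix z assume "z \<in> ?s ` X"
      then obtain y where y: "y \<in> X" "z = ?s y" by blast
      then have "y \<in> carrier F" "tensor_class U V y = X" using mem_tensor_class[OF x(1)] x by auto
      then show "z \<in> {h X}" using eq y by simp
    next
      fix z assume "z \<in> {h X}"
      moreover have "x \<in> X" using mem_tensor_class[OF x(1)] x by simp
      ultimately show "z \<in> ?s ` X" using eq[OF x(1)] x by (intro image_eqI[of _ _ x]) simp_all
    qed
    then show ?thesis unfolding tensor_lift_def by simp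
  qed
  show "tensor_lift f \<in> hom T ?A" by (rule hom_cong_on[OF T.is_group h(1) lift])
  show "tensor_lift f (pure_tensor U V u v) = f u v" if "u \<in> carrier U" "v \<in> carrier V" for u v
    using that by (simp add: lift h)
qed

section \<open>Closure rules for linear maps\<close>

context unital_algebra
begin

abbreviation (input) lin :: "('k \<Rightarrow> 'v::ab_group_add \<Rightarrow> 'v) \<Rightarrow> ('r \<Rightarrow> 'v) \<Rightarrow> bool"
  where "lin s f \<equiv> Vector_Spaces.linear scale s f"

lemmas scale_mult_simps = scale_mult_left[symmetric] scale_mult_right[symmetric]

lemma lin_id: "lin scale (\<lambda>x. x)"
  by (simp add: lin_iff vector_space_axioms)

lemma lin_mult_left: "lin scale f \<Longrightarrow> lin scale (\<lambda>x. c * f x)"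
  by (simp add: lin_iff distrib_left scale_mult_simps)

lemma lin_mult_right: "lin scale f \<Longrightarrow> lin scale (\<lambda>x. f x * c)"
  by (simp add: lin_iff distrib_right scale_mult_simps)

lemma lin_comp: "lin s p \<Longrightarrow> lin scale f \<Longrightarrow> lin s (\<lambda>x. p (f x))"
  by (simp add: lin_iff)

lemma lin_scale: "lin scale f \<Longrightarrow> lin scale (\<lambda>x. scale c (f x))"
  by (simp add: lin_iff scale_right_distrib mult.commute)

lemma lin_scale_vector: "lin (*) p \<Longrightarrow> lin scale (\<lambda>x. scale (p x) v)"
  by (simp add: lin_iff vector_space_axioms scale_left_distrib)

lemma lin_field_mult_left: "lin (*) p \<Longrightarrow> lin (*) (\<lambda>x. c * p x)"
  by (simp add: lin_iff algebra_simps)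

lemma lin_field_mult_right: "lin (*) p \<Longrightarrow> lin (*) (\<lambda>x. p x * c)"
  by (simp add: lin_iff algebra_simps)

lemma lin_sum:
  assumes "vector_space s" "\<And>i. i \<in> A \<Longrightarrow> lin s (f i)"
  shows "lin s (\<lambda>x. \<Sum>i\<in>A. f i x)"
proof -
  interpret V: vector_space s by fact
  show ?thesis
    unfolding lin_iff
    using assms(2) by (auto simp: lin_iff vector_space_axioms assms(1) sum.distrib V.scale_sum_right)
qed

end

lemma (in finite_dimensional_vector_space) linear_coordinate:
  "Vector_Spaces.linear scale (*) (\<lambda>v. representation Basis v b)"
  by (rule linear_representation[OF independent_Basis span_Basis])

lemma (in finite_dimensional_vector_space) sum_representation:
  "(\<Sum>b\<in>Basis. scale (representation Basis v b) b) = v"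
  by (rule sum_representation_eq[OF independent_Basis]) (simp_all add: span_Basis finite_Basis)

section \<open>Sweedler sums over a fixed basis\<close>

context finite_dimensional_hopf_algebra
begin

definition Bs :: "'b set"
  where "Bs = (SOME B. finite_dimensional_vector_space scale B)"

sublocale fd: finite_dimensional_vector_space scale Bs
  unfolding Bs_def by (rule someI_ex[OF finite_dim])

abbreviation crd :: "'b \<Rightarrow> 'b \<Rightarrow> 'a"
  where "crd b v \<equiv> representation Bs v b"

lemmas lin_crd = fd.linear_coordinate
lemmas sum_crd = fd.sum_representation

lemmas finite_Bs = fd.finite_Basis

abbreviation (input) Hm where "Hm \<equiv> space_bimodule scale"

abbreviation (input) hpure where "hpure \<equiv> pure_tensor Hm Hm"

sublocale HHp: bimodule_pair "space_bimodule scale" "space_bimodule scale"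
  by (intro bimodule_pairI space_is_bimodule vector_space_axioms)

sublocale HHH: bimodule_triple "space_bimodule scale" "space_bimodule scale" "space_bimodule scale"
  by (intro bimodule_tripleI space_is_bimodule vector_space_axioms)

text \<open>What is left in the second tensor factor of \<Delta> h when the first is paired with the
  coordinate functional of b.\<close>

definition D :: "'b \<Rightarrow> 'b \<Rightarrow> 'b"
  where "D b h = tensor_lift (\<lambda>u v. scale (crd b u) v) (comul h)"

text \<open>The Sweedler sum \<open>\<Sum> f h\<^sub>1 h\<^sub>2\<close>, computed from \<open>\<Delta> h = \<Sum>\<^sub>b b \<otimes> D b h\<close>.\<close>

definition sw :: "('b \<Rightarrow> 'b \<Rightarrow> 'v::comm_monoid_add) \<Rightarrow> 'b \<Rightarrow> 'v"
  where "sw f h = (\<Sum>b\<in>Bs. f b (D b h))"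

lemma bilinear_crd: "bilinear_map scale scale scale (\<lambda>u v. scale (crd b u) v)"
  by (intro bilinear_mapI lin_scale_vector lin_scale lin_id lin_crd)

text \<open>Homomorphisms and balanced maps see only the additive group of the target, so a space
  and the plain group used by \<open>tensor_lift\<close> are interchangeable.\<close>

lemma space_additive:
  "hom G (space_bimodule s) = hom G \<lparr>carrier = UNIV, monoid.mult = (+), one = 0\<rparr>"
  "balanced U V (space_bimodule s) f = balanced U V \<lparr>carrier = UNIV, monoid.mult = (+), one = 0\<rparr> f"
  by (simp_all add: balanced_def hom_def)

lemma tensor_lift_space:
  fixes f :: "'u::ab_group_add \<Rightarrow> 'v::ab_group_add \<Rightarrow> 'c::ring_1" and s3 :: "'a \<Rightarrow> 'c \<Rightarrow> 'c"
  assumes "vector_space s1" "vector_space s2" "bilinear_map s1 s2 s3 f"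
  shows "tensor_lift f \<in> hom (tensor_bimodule (space_bimodule s1) (space_bimodule s2)) (space_bimodule s3)"
    and "tensor_lift f (pure_tensor (space_bimodule s1) (space_bimodule s2) u v) = f u v"
proof -
  interpret P: bimodule_pair "space_bimodule s1" "space_bimodule s2"
    by (intro bimodule_pairI space_is_bimodule assms)
  note bal = balanced_bilinear[OF assms(3), unfolded space_additive]
  show "tensor_lift f \<in> hom P.T (space_bimodule s3)"
    unfolding space_additive by (rule P.tensor_lift[OF bal])
  show "tensor_lift f (pure_tensor (space_bimodule s1) (space_bimodule s2) u v) = f u v"
    by (rule P.tensor_lift(2)[OF bal]) simp_all
qed

lemma sum_hom:
  assumes "\<And>i. i \<in> A \<Longrightarrow> f i \<in> hom G (space_bimodule s)" "group G"
  shows "(\<lambda>x. \<Sum>i\<in>A. f i x) \<in> hom G (space_bimodule s)"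
  using assms(1) by (auto simp: hom_def sum.distrib)

text \<open>Both sides are values at \<Delta> h of additive maps on H \<otimes> H, and on u
  \<otimes> v these agree after u is expanded in the basis. This is the bridge from the tensor form
  of the Hopf axioms to Sweedler sums.\<close>

lemma hom_comul:
  assumes V: "vector_space s" and \<phi>: "\<phi> \<in> hom HHp.T (space_bimodule s)"
    and f: "\<And>u v. \<phi> (hpure u v) = f u v" and bil: "bilinear_map scale scale s f"
  shows "\<phi> (comul h) = sw f h"
proof -
  interpret V: is_bimodule "space_bimodule s" by (rule space_is_bimodule[OF V])
  let ?d = "\<lambda>b X. tensor_lift (\<lambda>u v. scale (crd b u) v) X"
  note d = tensor_lift_space[OF vector_space_axioms vector_space_axioms bilinear_crd]
  note f_add = linear_additive[OF bilinear_mapD(1)[OF bil]]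
  have f_sum: "(\<Sum>b\<in>A. f (g b) v) = f (\<Sum>b\<in>A. g b) v" for A v and g :: "'b \<Rightarrow> 'b"
    by (induction A rule: infinite_finite_induct) (simp_all add: f_add)
  have "\<phi> (comul h) = (\<Sum>b\<in>Bs. f b (?d b (comul h)))"
  proof (rule HHp.tensor_hom_eq[OF V.is_group \<phi> sum_hom _ comul_closed])
    show "(\<lambda>X. f b (?d b X)) \<in> hom HHp.T (space_bimodule s)" for b
      using hom_compose[OF d(1), of "f b" "space_bimodule s"] linear_additive(1)[OF bilinear_mapD(2)[OF bil]]
      by (simp add: comp_def hom_def)
    show "\<phi> (hpure u v) = (\<Sum>b\<in>Bs. f b (?d b (hpure u v)))" for u v
    proof -
      have "(\<Sum>b\<in>Bs. f b (?d b (hpure u v))) = (\<Sum>b\<in>Bs. f (scale (crd b u) b) v)"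
        by (simp add: d(2) f_add(2) linear_additive(2)[OF bilinear_mapD(2)[OF bil]])
      also have "\<dots> = f (\<Sum>b\<in>Bs. scale (crd b u) b) v"
        by (rule f_sum)
      finally show ?thesis by (simp add: f sum_crd)
    qed
  qed (rule HHp.T.is_group)
  then show ?thesis by (simp add: sw_def D_def)
qed

lemma tensor_lift_comul:
  fixes f :: "'b \<Rightarrow> 'b \<Rightarrow> 'c::ring_1"
  assumes "vector_space s" "bilinear_map scale scale s f"
  shows "tensor_lift f (comul h) = sw f h"
  by (rule hom_comul[OF assms(1) tensor_lift_space[OF vector_space_axioms vector_space_axioms assms(2)] assms(2)])

lemma lin_D: "lin scale (D b)"
proof -
  note d = tensor_lift_space[OF vector_space_axioms vector_space_axioms bilinear_crd[of b]]
  let ?d = "tensor_lift (\<lambda>u v. scale (crd b u) v)"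
  have "?d (X \<otimes>\<^bsub>HHp.T\<^esub> Y) = ?d X + ?d Y" if "X \<in> carrier HHp.T" "Y \<in> carrier HHp.T" for X Y
    using hom_mult[OF d(1) that] by simp
  then have 1: "D b (x + y) = D b x + D b y" for x y
    by (simp add: D_def comul_add comul_closed)
  have "?d (lact HHp.T k X) = scale k (?d X)" if X: "X \<in> carrier HHp.T" for X k
  proof -
    have "(?d \<circ> lact HHp.T k) X = (scale k \<circ> ?d) X"
    proof (rule HHp.tensor_hom_eq[OF HHp.U.is_group hom_compose[OF HHp.tensor_lact_hom d(1)] hom_compose[OF d(1)] _ X])
      show "scale k \<in> hom (space_bimodule scale) (space_bimodule scale)"
        by (simp add: hom_def scale_right_distrib)
      show "(?d \<circ> lact HHp.T k) (hpure u v) = (scale k \<circ> ?d) (hpure u v)" for u v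
        by (simp add: HHp.lact_pure d(2) linear_additive[OF lin_crd])
    qed
    then show ?thesis by simp
  qed
  then have "D b (scale k x) = scale k (D b x)" for x k
    by (simp add: D_def comul_scale comul_closed)
  with 1 show ?thesis by (simp add: lin_iff vector_space_axioms)
qed

lemma lin_sw:
  assumes "\<And>a b. lin s (\<lambda>x. f x a b)"
  shows "lin s (\<lambda>x. sw (f x) h)"
proof -
  have "vector_space s" using assms[of undefined undefined] by (simp add: lin_iff)
  then show ?thesis unfolding sw_def by (rule lin_sum) (rule assms)
qed

lemma lin_sw_arg:
  assumes "\<And>a. lin s (f a)" "lin scale g"
  shows "lin s (\<lambda>x. sw f (g x))"
proof -
  have "vector_space s" using assms(1)[of undefined] by (simp add: lin_iff)
  then show ?thesis unfolding sw_def by (rule lin_sum) (intro lin_comp[OF assms(1)] lin_comp[OF lin_D] assms(2))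
qed

lemma lin_sw_self: "(\<And>a. lin s (f a)) \<Longrightarrow> lin s (sw f)"
  by (rule lin_sw_arg[where g = "\<lambda>x. x", OF _ lin_id])

lemma bilinearI: "(\<And>v. lin s (\<lambda>u. f u v)) \<Longrightarrow> (\<And>u. lin s (f u)) \<Longrightarrow> bilinear_map scale scale s f"
  by (rule bilinear_mapI)

text \<open>The trilinear f factors through H \<otimes> (H \<otimes> H). Applying that map to the
  two sides of \<open>coassoc\<close>, and evaluating one coproduct at a time, gives the two
  iterated sums.\<close>

lemma sw_coassoc:
  assumes f: "\<And>b c. lin s (\<lambda>a. f a b c)" "\<And>a c. lin s (\<lambda>b. f a b c)" "\<And>a b. lin s (\<lambda>c. f a b c)"
  shows "sw (\<lambda>x c. sw (\<lambda>a b. f a b c) x) h = sw (\<lambda>a x. sw (\<lambda>b c. f a b c) x) h"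
proof -
  have V: "vector_space s" using f(1)[of undefined undefined] by (simp add: lin_iff)
  interpret V: is_bimodule "space_bimodule s" by (rule space_is_bimodule[OF V])
  have 1: "balanced Hm Hm (space_bimodule s) (f a)" for a by (intro balanced_bilinear bilinearI f)
  have 2: "balanced Hm Hm (space_bimodule s) (\<lambda>a b. f a b c)" for c by (intro balanced_bilinear bilinearI f)
  obtain \<phi> where \<phi>: "\<phi> \<in> hom HHH.R.T (space_bimodule s)"
    and \<phi>_pure: "\<And>u v w. u \<in> carrier Hm \<Longrightarrow> v \<in> carrier Hm \<Longrightarrow> w \<in> carrier Hm \<Longrightarrow>
      \<phi> (pure_tensor Hm HH u (hpure v w)) = f u v w"
    by (rule HHH.ex_hom_right[OF V.comm_group_axioms 1 2]) (rule that)
  have com: "comul \<in> hom Hm HH" by (simp add: hom_def comul_closed comul_add)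
  have comr: "comul (ract Hm u r) = ract HH (comul u) r" for u r
  proof -
    have "lact HHp.T r X = ract HHp.T X r" if X: "X \<in> carrier HHp.T" for X
      by (rule HHp.tensor_hom_eq[OF HHp.T.is_group HHp.tensor_lact_hom HHp.tensor_ract_hom _ X])
        (use HHp.pure_move in \<open>simp add: HHp.lact_pure HHp.ract_pure\<close>)
    then show ?thesis by (simp add: comul_scale comul_closed)
  qed
  have idh: "id \<in> hom Hm Hm" by (simp add: hom_def)
  have b1: "balanced Hm Hm HHH.L.T (\<lambda>u v. pure_tensor HH Hm (comul u) (id v))"
    by (rule HHp.balanced_tensor_map[OF HHH.L.bimodule_pair_axioms com idh comr]) simp_all
  have b2: "balanced Hm Hm HHH.R.T (\<lambda>u v. pure_tensor Hm HH (id u) (comul v))"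
    by (rule HHp.balanced_tensor_map[OF HHH.R.bimodule_pair_axioms idh com]) (simp_all add: comul_scale)
  note m1 = HHp.tensor_map_hom[OF HHH.L.bimodule_pair_axioms _ _ b1]
    HHp.tensor_map_pure[OF HHH.L.bimodule_pair_axioms _ _ b1]
  note m2 = HHp.tensor_map_hom[OF HHH.R.bimodule_pair_axioms _ _ b2]
    HHp.tensor_map_pure[OF HHH.R.bimodule_pair_axioms _ _ b2]
  have L: "\<phi> (tensor_assoc Hm Hm Hm (tensor_map HH Hm comul id (comul h))) = sw (\<lambda>x c. sw (\<lambda>a b. f a b c) x) h"
  proof -
    have "(\<phi> \<circ> tensor_assoc Hm Hm Hm \<circ> tensor_map HH Hm comul id) (comul h) = sw (\<lambda>x c. sw (\<lambda>a b. f a b c) x) h"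
    proof (rule hom_comul[OF V])
      show "\<phi> \<circ> tensor_assoc Hm Hm Hm \<circ> tensor_map HH Hm comul id \<in> hom HHp.T (space_bimodule s)"
        by (intro hom_compose[OF _ hom_compose[OF HHH.tensor_assoc_hom \<phi>]] m1) (simp_all add: comul_closed)
      fix u v
      have "(\<phi> \<circ> tensor_assoc Hm Hm Hm \<circ> (\<lambda>X. pure_tensor HH Hm X v)) (comul u) = sw (\<lambda>a b. f a b v) u"
        by (rule hom_comul[OF V hom_compose[OF _ hom_compose[OF HHH.tensor_assoc_hom \<phi>]]])
          (simp_all add: balancedD(1)[OF HHH.L.pure_balanced] HHH.tensor_assoc_pure \<phi>_pure bilinearI f)
      then show "(\<phi> \<circ> tensor_assoc Hm Hm Hm \<circ> tensor_map HH Hm comul id) (hpure u v) = sw (\<lambda>a b. f a b v) u"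
        by (simp add: m1 comul_closed)
    qed (intro bilinearI lin_sw lin_sw_arg lin_id f)
    then show ?thesis by simp
  qed
  have R: "\<phi> (tensor_map Hm HH id comul (comul h)) = sw (\<lambda>a x. sw (\<lambda>b c. f a b c) x) h"
  proof -
    have "(\<phi> \<circ> tensor_map Hm HH id comul) (comul h) = sw (\<lambda>a x. sw (\<lambda>b c. f a b c) x) h"
    proof (rule hom_comul[OF V])
      show "\<phi> \<circ> tensor_map Hm HH id comul \<in> hom HHp.T (space_bimodule s)"
        by (intro hom_compose[OF _ \<phi>] m2) (simp_all add: comul_closed)
      fix u v
      have "(\<phi> \<circ> (pure_tensor Hm HH u)) (comul v) = sw (\<lambda>b c. f u b c) v"
        by (rule hom_comul[OF V hom_compose[OF _ \<phi>]])
          (simp_all add: balancedD(2)[OF HHH.R.pure_balanced] \<phi>_pure bilinearI f)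
      then show "(\<phi> \<circ> tensor_map Hm HH id comul) (hpure u v) = sw (\<lambda>b c. f u b c) v"
        by (simp add: m2 comul_closed)
    qed (intro bilinearI lin_sw lin_sw_arg lin_id f)
    then show ?thesis by simp
  qed
  show ?thesis using L R coassoc[of h] by simp
qed

end

section \<open>The Hopf axioms as rules for Sweedler sums\<close>

context finite_dimensional_hopf_algebra
begin

lemma lin_eps: "lin (*) counit" by (rule counit_linear)

text \<open>The counit axiom is an equation in K \<otimes> H; the multiplication map k \<otimes> v
  \<mapsto> kv carries it into H.\<close>

lemma sw_counit_left: "sw (\<lambda>a b. scale (counit a) b) h = h"
proof -
  note vsf = vector_space_field[where 'k = 'a]
  interpret P: bimodule_pair "ground_field :: ('a, 'a) bimodule" Hm
    by (intro bimodule_pairI space_is_bimodule vsf vector_space_axioms)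
  have b: "balanced Hm Hm P.T (\<lambda>u v. pure_tensor ground_field Hm (counit u) (id v))"
    by (rule HHp.balanced_tensor_map[OF P.bimodule_pair_axioms])
      (simp_all add: hom_def linear_additive[OF lin_eps])
  note m = HHp.tensor_map_hom[OF P.bimodule_pair_axioms _ _ b] HHp.tensor_map_pure[OF P.bimodule_pair_axioms _ _ b]
  have bal: "balanced (ground_field :: ('a, 'a) bimodule) Hm Hm scale"
    by (intro balancedI) (simp_all add: hom_def scale_left_distrib scale_right_distrib mult.commute)
  obtain \<phi> where \<phi>: "\<phi> \<in> hom P.T Hm" "\<And>u v. u \<in> carrier (ground_field :: ('a, 'a) bimodule) \<Longrightarrow>
      v \<in> carrier Hm \<Longrightarrow> \<phi> (pure_tensor ground_field Hm u v) = scale u v"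
    by (rule P.tensor_universal[OF HHp.U.comm_group_axioms bal]) (rule that)
  have "(\<phi> \<circ> tensor_map ground_field Hm counit id) (comul h) = sw (\<lambda>a b. scale (counit a) b) h"
  proof (rule hom_comul[OF vector_space_axioms])
    show "\<phi> \<circ> tensor_map ground_field Hm counit id \<in> hom HHp.T Hm"
      by (intro hom_compose[OF _ \<phi>(1)] m) simp_all
    show "(\<phi> \<circ> tensor_map ground_field Hm counit id) (hpure u v) = scale (counit u) v" for u v
      by (simp add: m \<phi>)
  qed (intro bilinearI lin_scale_vector lin_eps lin_scale lin_id)
  then show ?thesis by (simp add: counit_left \<phi>)
qed

lemma sw_counit_right: "sw (\<lambda>a b. scale (counit b) a) h = h"
proof -
  note vsf = vector_space_field[where 'k = 'a]
  interpret P: bimodule_pair Hm "ground_field :: ('a, 'a) bimodule"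
    by (intro bimodule_pairI space_is_bimodule vsf vector_space_axioms)
  have b: "balanced Hm Hm P.T (\<lambda>u v. pure_tensor Hm ground_field (id u) (counit v))"
    by (rule HHp.balanced_tensor_map[OF P.bimodule_pair_axioms])
      (simp_all add: hom_def linear_additive[OF lin_eps])
  note m = HHp.tensor_map_hom[OF P.bimodule_pair_axioms _ _ b] HHp.tensor_map_pure[OF P.bimodule_pair_axioms _ _ b]
  have bal: "balanced Hm (ground_field :: ('a, 'a) bimodule) Hm (\<lambda>v k. scale k v)"
    by (intro balancedI) (simp_all add: hom_def scale_left_distrib scale_right_distrib mult.commute)
  obtain \<phi> where \<phi>: "\<phi> \<in> hom P.T Hm" "\<And>u v. u \<in> carrier Hm \<Longrightarrow>
      v \<in> carrier (ground_field :: ('a, 'a) bimodule) \<Longrightarrow> \<phi> (pure_tensor Hm ground_field u v) = scale v u"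
    by (rule P.tensor_universal[OF HHp.U.comm_group_axioms bal]) (rule that)
  have "(\<phi> \<circ> tensor_map Hm ground_field id counit) (comul h) = sw (\<lambda>a b. scale (counit b) a) h"
  proof (rule hom_comul[OF vector_space_axioms])
    show "\<phi> \<circ> tensor_map Hm ground_field id counit \<in> hom HHp.T Hm"
      by (intro hom_compose[OF _ \<phi>(1)] m) simp_all
    show "(\<phi> \<circ> tensor_map Hm ground_field id counit) (hpure u v) = scale (counit v) u" for u v
      by (simp add: m \<phi>)
  qed (intro bilinearI lin_scale_vector lin_eps lin_scale lin_id)
  then show ?thesis by (simp add: counit_right \<phi>)
qed

lemma sw_scale_counit_left: "lin s g \<Longrightarrow> sw (\<lambda>a b. s (counit a) (g b)) h = g h"
proof -
  assume g: "lin s g"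
  have "g (sw (\<lambda>a b. scale (counit a) b) h) = sw (\<lambda>a b. s (counit a) (g b)) h"
    unfolding sw_def by (subst linear_sum[OF g])
      (simp add: linear_additive(2)[OF g])
  then show ?thesis by (simp add: sw_counit_left)
qed

lemma linear_sw:
  assumes "Vector_Spaces.linear s1 s2 g"
  shows "g (sw f h) = sw (\<lambda>a b. g (f a b)) h"
  unfolding sw_def by (rule linear_sum[OF assms])

lemma sw_scale_counit_right: "lin s g \<Longrightarrow> sw (\<lambda>a b. s (counit b) (g a)) h = g h"
  using linear_sw[of scale s g "\<lambda>a b. scale (counit b) a" h]
  by (simp add: sw_counit_right linear_additive(2)[of scale s g])

lemma sw_one:
  assumes "vector_space s" "bilinear_map scale scale s f"
  shows "sw f 1 = f 1 1"
proof -
  note bal = balanced_bilinear[OF assms(2)]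
  interpret V: is_bimodule "space_bimodule s" by (rule space_is_bimodule[OF assms(1)])
  obtain \<phi> where \<phi>: "\<phi> \<in> hom HHp.T (space_bimodule s)" "\<And>u v. u \<in> carrier Hm \<Longrightarrow>
      v \<in> carrier Hm \<Longrightarrow> \<phi> (hpure u v) = f u v"
    by (rule HHp.tensor_universal[OF V.comm_group_axioms bal]) (rule that)
  have "\<phi> (comul 1) = sw f 1"
    by (rule hom_comul[OF assms(1) \<phi>(1) _ assms(2)]) (simp add: \<phi>)
  then show ?thesis by (simp add: comul_one \<phi>)
qed

lemma tensor_lift_map:
  assumes p: "lin scale p" and q: "lin scale q"
  shows "tensor_lift (*) (tensor_map Hm Hm p q (comul h)) = sw (\<lambda>a b. p a * q b) h"
proof -
  have b: "balanced Hm Hm HHp.T (\<lambda>u v. hpure (p u) (q v))"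
    by (rule HHp.balanced_tensor_map[OF HHp.bimodule_pair_axioms])
      (simp_all add: hom_def linear_additive[OF p] linear_additive[OF q])
  note m = HHp.tensor_map_hom[OF HHp.bimodule_pair_axioms _ _ b] HHp.tensor_map_pure[OF HHp.bimodule_pair_axioms _ _ b]
  have bil: "bilinear_map scale scale scale (*)"
    by (intro bilinearI lin_mult_left lin_mult_right lin_id)
  note t = tensor_lift_space[OF vector_space_axioms vector_space_axioms bil]
  have "(tensor_lift (*) \<circ> tensor_map Hm Hm p q) (comul h) = sw (\<lambda>a b. p a * q b) h"
  proof (rule hom_comul[OF vector_space_axioms])
    show "tensor_lift (*) \<circ> tensor_map Hm Hm p q \<in> hom HHp.T Hm"
      by (intro hom_compose[OF _ t(1)] m) simp_all
    show "(tensor_lift (*) \<circ> tensor_map Hm Hm p q) (hpure u v) = p u * q v" for u v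
      by (simp add: m t)
  qed (intro bilinearI lin_mult_left lin_mult_right p q)
  then show ?thesis by simp
qed

lemma sw_antipode_left: "sw (\<lambda>a b. antipode a * b) h = scale (counit h) 1"
  using tensor_lift_map[OF antipode_linear lin_id, of h] antipode_left[of h] by (simp add: id_def)

lemma sw_antipode_right: "sw (\<lambda>a b. a * antipode b) h = scale (counit h) 1"
  using tensor_lift_map[OF lin_id antipode_linear, of h] antipode_right[of h] by (simp add: id_def)

text \<open>Multiplicativity of the coproduct is given through representatives of both factors. They
  are absorbed one at a time: \<open>\<psi>\<close> turns a representative of \<open>comul y\<close>
  into a Sweedler sum for fixed a and b, then \<open>\<theta>\<close> does so for
  \<open>comul x\<close>.\<close>

lemma sw_mult:
  assumes V: "vector_space s" and f: "bilinear_map scale scale s f"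
  shows "sw f (x * y) = sw (\<lambda>a b. sw (\<lambda>c d. f (a * c) (b * d)) y) x"
proof -
  note fl = bilinear_mapD[OF f]
  interpret V: is_bimodule "space_bimodule s" by (rule space_is_bimodule[OF V])
  have ex: "\<exists>\<phi>. \<phi> \<in> hom HHp.T (space_bimodule s) \<and> (\<forall>u v. \<phi> (hpure u v) = g u v)"
    if gb: "bilinear_map scale scale s g" for g
  proof -
    obtain \<phi> where "\<phi> \<in> hom HHp.T (space_bimodule s)" "\<And>u v. u \<in> carrier Hm \<Longrightarrow>
        v \<in> carrier Hm \<Longrightarrow> \<phi> (hpure u v) = g u v"
      by (rule HHp.tensor_universal[OF V.comm_group_axioms balanced_bilinear[OF gb]]) (rule that)
    then show ?thesis by auto
  qed
  obtain \<phi> where \<phi>: "\<phi> \<in> hom HHp.T (space_bimodule s)" "\<And>u v. \<phi> (hpure u v) = f u v"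
    using ex[OF f] by blast
  let ?g = "\<lambda>a b c d. f (a * c) (b * d)"
  have g: "bilinear_map scale scale s (?g a b)" for a b
    by (intro bilinearI lin_comp[OF fl(1)] lin_comp[OF fl(2)] lin_mult_left lin_id)
  have "\<exists>\<psi>. \<forall>a b. \<psi> a b \<in> hom HHp.T (space_bimodule s) \<and> (\<forall>u v. \<psi> a b (hpure u v) = ?g a b u v)"
    using ex[OF g] by metis
  then obtain \<psi> where \<psi>: "\<And>a b. \<psi> a b \<in> hom HHp.T (space_bimodule s)"
    "\<And>a b u v. \<psi> a b (hpure u v) = ?g a b u v" by blast
  have \<psi>c: "\<psi> a b (comul y) = sw (?g a b) y" for a b by (rule hom_comul[OF V \<psi> g])
  have h: "bilinear_map scale scale s (\<lambda>a b. sw (?g a b) y)"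
    by (intro bilinearI lin_sw lin_comp[OF fl(1)] lin_comp[OF fl(2)] lin_mult_right lin_id)
  obtain \<theta> where \<theta>: "\<theta> \<in> hom HHp.T (space_bimodule s)" "\<And>u v. \<theta> (hpure u v) = sw (?g u v) y"
    using ex[OF h] by blast
  obtain x' where x': "x' \<in> carrier HHp.F" "comul x = tensor_class Hm Hm x'"
    using comul_closed by (rule HHp.tensor_classE)
  obtain y' where y': "y' \<in> carrier HHp.F" "comul y = tensor_class Hm Hm y'"
    using comul_closed by (rule HHp.tensor_classE)
  let ?e = "\<lambda>y a b. frag_extend (\<lambda>(c, d). frag_of (a * c, b * d)) y"
  let ?E = "frag_extend (\<lambda>(a, b). ?e y' a b)"
  have inF: "z \<in> carrier HHp.F" for z by (simp add: HHp.in_F)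
  have "x' \<in> comul x" "y' \<in> comul y"
    using HHp.mem_tensor_class[OF x'(1)] HHp.mem_tensor_class[OF y'(1)] x' y' by simp_all
  then have sub: "tensor_class Hm Hm (?E x') \<subseteq> comul (x * y)"
    unfolding comul_mult tensor_mult_def by blast
  \<comment> \<open>The union defining \<open>tensor_mult\<close> contains the coset of this
    combination. As \<open>comul (x * y)\<close> is itself a single coset, the two coincide.\<close>
  have "comul (x * y) = tensor_class Hm Hm (?E x')"
  proof -
    obtain z where z: "z \<in> carrier HHp.F" "comul (x * y) = tensor_class Hm Hm z"
      using comul_closed by (rule HHp.tensor_classE)
    have "?E x' \<in> tensor_class Hm Hm (?E x')" using HHp.mem_tensor_class[OF inF] inF by blast
    with sub z show ?thesis using HHp.mem_tensor_class[OF inF] by blast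
  qed
  moreover have e: "\<phi> (tensor_class Hm Hm (?e z a b)) = \<psi> a b (tensor_class Hm Hm z)" for z a b
  proof -
    have "(\<phi> \<circ> tensor_class Hm Hm \<circ> (\<lambda>z. ?e z a b)) z = (\<psi> a b \<circ> tensor_class Hm Hm) z"
    proof (rule HHp.free_hom_eq[OF V.is_group _ _ _ inF])
      show "\<phi> \<circ> tensor_class Hm Hm \<circ> (\<lambda>z. ?e z a b) \<in> hom HHp.F (space_bimodule s)"
        by (rule hom_compose[OF _ hom_compose[OF HHp.tensor_class_hom \<phi>(1)]])
          (simp add: hom_def inF frag_extend_add)
      show "\<psi> a b \<circ> tensor_class Hm Hm \<in> hom HHp.F (space_bimodule s)"
        by (rule hom_compose[OF HHp.tensor_class_hom \<psi>(1)])
    qed (use \<phi>(2) \<psi>(2) in \<open>simp add: pure_tensor_def\<close>)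
    then show ?thesis by simp
  qed
  moreover have "\<phi> (tensor_class Hm Hm (?E z)) = \<theta> (tensor_class Hm Hm z)" for z
  proof -
    have "(\<phi> \<circ> tensor_class Hm Hm \<circ> ?E) z = (\<theta> \<circ> tensor_class Hm Hm) z"
    proof (rule HHp.free_hom_eq[OF V.is_group _ _ _ inF])
      show "\<phi> \<circ> tensor_class Hm Hm \<circ> ?E \<in> hom HHp.F (space_bimodule s)"
        by (rule hom_compose[OF _ hom_compose[OF HHp.tensor_class_hom \<phi>(1)]])
          (simp add: hom_def inF frag_extend_add)
      show "(\<phi> \<circ> tensor_class Hm Hm \<circ> ?E) (frag_of (u, v)) = (\<theta> \<circ> tensor_class Hm Hm) (frag_of (u, v))" for u v
        using \<theta>(2)[of u v] \<psi>c[of u v] by (simp add: e y'(2) pure_tensor_def)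
    qed (intro hom_compose[OF HHp.tensor_class_hom \<theta>(1)])
    then show ?thesis by simp
  qed
  ultimately have "\<phi> (comul (x * y)) = \<theta> (comul x)" by (simp add: x'(2))
  moreover have "\<phi> (comul (x * y)) = sw f (x * y)" by (rule hom_comul[OF V \<phi> f])
  moreover have "\<theta> (comul x) = sw (\<lambda>a b. sw (?g a b) y) x" by (rule hom_comul[OF V \<theta> h])
  ultimately show ?thesis by simp
qed

lemma convolution_sw:
  assumes "lin (*) f" "lin (*) g"
  shows "convolution comul f g h = sw (\<lambda>a b. f a * g b) h"
  unfolding convolution_def
  by (rule tensor_lift_comul[OF vector_space_field]) (intro bilinearI lin_field_mult_left lin_field_mult_right assms)

end

section \<open>The antipode and the existence of integrals\<close>

context finite_dimensional_hopf_algebra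
begin

lemma lin_antipode: "lin scale f \<Longrightarrow> lin scale (\<lambda>x. antipode (f x))"
  by (rule lin_comp[OF antipode_linear])

lemma lin_counit: "lin scale f \<Longrightarrow> lin (*) (\<lambda>x. counit (f x))"
  by (rule lin_comp[OF counit_linear])

lemma lin_coord: "lin scale f \<Longrightarrow> lin (*) (\<lambda>x. crd b (f x))"
  by (rule lin_comp[OF lin_crd])

lemmas lins = lin_id lin_mult_left lin_mult_right lin_scale lin_scale_vector lin_field_mult_left
  lin_field_mult_right lin_antipode lin_counit lin_coord lin_sw lin_sw_arg

lemmas antipode_add = linear_additive[OF antipode_linear]
lemmas counit_add = linear_additive[OF counit_linear]

lemma vector_space_lin: "lin s f \<Longrightarrow> vector_space s"
  by (simp add: lin_iff)

lemma sw_swap: "sw (\<lambda>a b. sw (\<lambda>c d. f a b c d) y) x = sw (\<lambda>c d. sw (\<lambda>a b. f a b c d) x) y"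
  unfolding sw_def by (rule sum.swap)

lemma sum_sw: "(\<Sum>i\<in>A. sw (f i) x) = sw (\<lambda>a b. \<Sum>i\<in>A. f i a b) x"
  unfolding sw_def by (rule sum.swap)

lemma sw_mult_right: "sw f x * c = sw (\<lambda>a b. f a b * c) x" for c :: "'c::ring_1"
  unfolding sw_def by (rule sum_distrib_right)

lemma sw_mult_left: "c * sw f x = sw (\<lambda>a b. c * f a b) x" for c :: "'c::ring_1"
  unfolding sw_def by (rule sum_distrib_left)

lemma scale_sw: "scale k (sw f x) = sw (\<lambda>a b. scale k (f a b)) x"
  unfolding sw_def by (rule scale_sum_right)

lemma sw_scale: "scale (sw f x) v = sw (\<lambda>a b. scale (f a b) v) x"
  unfolding sw_def by (rule scale_sum_left)

lemma antipode_one: "antipode 1 = 1"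
proof -
  have "antipode 1 * 1 = sw (\<lambda>a b. antipode a * b) 1"
    by (rule sw_one[OF vector_space_axioms, symmetric]) (intro bilinearI lins)
  also have "\<dots> = 1" by (simp add: sw_antipode_left counit_one)
  finally show ?thesis by simp
qed

lemma counit_antipode: "counit (antipode x) = counit x"
proof -
  have "counit (antipode x) = sw (\<lambda>a b. counit b * counit (antipode a)) x"
    by (rule sw_scale_counit_right[symmetric]) (intro lins)
  also have "\<dots> = counit (sw (\<lambda>a b. antipode a * b) x)"
    by (simp add: linear_sw[OF counit_linear] counit_mult mult.commute)
  finally show ?thesis by (simp add: sw_antipode_left counit_add counit_one)
qed

text \<open>S(xy) and S(y) S(x) are both convolution inverses of the multiplication map. Concretely,
  S(x1 y1) x2 y2 S(y3) S(x3) is contracted once from its right end and once from its left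
  end.\<close>

lemma antipode_mult: "antipode (x * y) = antipode y * antipode x"
proof -
  let ?S = antipode
  let ?K = "\<lambda>p q c r s d. ?S (p * r) * (q * s) * (?S d * ?S c)"
  have M: "sw (\<lambda>r y'. sw (\<lambda>s d. ?K p q c r s d) y') y = ?S (p * y) * (q * ?S c)" for p q c
  proof -
    have "sw (\<lambda>s d. ?K p q c r s d) z = scale (counit z) (?S (p * r) * (q * ?S c))" for r z
    proof -
      have "sw (\<lambda>s d. ?K p q c r s d) z = ?S (p * r) * (q * (sw (\<lambda>s d. s * ?S d) z * ?S c))"
        by (simp only: sw_mult_left sw_mult_right mult.assoc)
      then show ?thesis by (simp add: sw_antipode_right scale_mult_simps)
    qed
    then show ?thesis
      by (simp only:) (rule sw_scale_counit_right, intro lins)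
  qed
  have "sw (\<lambda>a c. sw (\<lambda>b d. sw (\<lambda>p q. sw (\<lambda>r s. ?K p q c r s d) b) a) y) x
      = sw (\<lambda>a c. sw (\<lambda>p q. sw (\<lambda>b d. sw (\<lambda>r s. ?K p q c r s d) b) y) a) x"
    by (simp only: sw_swap[of _ _ y])
  also have "\<dots> = sw (\<lambda>a c. sw (\<lambda>p q. sw (\<lambda>r y'. sw (\<lambda>s d. ?K p q c r s d) y') y) a) x"
    by (subst sw_coassoc[where s = scale and h = y]) (intro lins | rule refl)+
  also have "\<dots> = sw (\<lambda>a c. sw (\<lambda>p q. ?S (p * y) * (q * ?S c)) a) x"
    by (simp only: M)
  also have "\<dots> = sw (\<lambda>p x'. sw (\<lambda>q c. ?S (p * y) * (q * ?S c)) x') x"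
    by (rule sw_coassoc[where s = scale]) (intro lins)+
  also have "\<dots> = sw (\<lambda>p x'. scale (counit x') (?S (p * y))) x"
    by (simp add: sw_antipode_right scale_mult_simps flip: sw_mult_left)
  also have "\<dots> = ?S (x * y)"
    by (rule sw_scale_counit_right) (intro lins)
  finally have 1: "sw (\<lambda>a c. sw (\<lambda>b d. sw (\<lambda>p q. sw (\<lambda>r s. ?K p q c r s d) b) a) y) x = ?S (x * y)" .
  have G: "sw (\<lambda>p q. sw (\<lambda>r s. ?K p q c r s d) b) a = scale (counit a) (scale (counit b) (?S d * ?S c))" for a b c d
  proof -
    have "sw (\<lambda>p q. sw (\<lambda>r s. ?S (p * r) * (q * s)) b) a = sw (\<lambda>u v. ?S u * v) (a * b)"
      by (rule sw_mult[OF vector_space_axioms, symmetric]) (intro bilinearI lins)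
    then have "sw (\<lambda>p q. sw (\<lambda>r s. ?S (p * r) * (q * s)) b) a * (?S d * ?S c) = scale (counit (a * b)) 1 * (?S d * ?S c)"
      by (simp only: sw_antipode_left)
    then show ?thesis by (simp add: sw_mult_right scale_mult_simps counit_mult)
  qed
  have "sw (\<lambda>a c. sw (\<lambda>b d. scale (counit a) (scale (counit b) (?S d * ?S c))) y) x
    = sw (\<lambda>a c. scale (counit a) (?S y * ?S c)) x"
  proof -
    have "sw (\<lambda>b d. scale (counit b) (?S d * ?S c)) y = ?S y * ?S c" for c
      by (rule sw_scale_counit_left) (intro lins)
    then show ?thesis by (simp only: scale_sw[symmetric])
  qed
  also have "\<dots> = ?S y * ?S x"
    by (rule sw_scale_counit_left) (intro lins)
  finally show ?thesis using 1 by (simp only: G)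
qed

lemma expand: "lin s g \<Longrightarrow> g z = (\<Sum>k\<in>Bs. s (crd k z) (g k))"
proof -
  assume g: "lin s g"
  have "g z = g (\<Sum>k\<in>Bs. scale (crd k z) k)" by (simp add: sum_crd)
  then show ?thesis
    by (simp add: linear_sum[OF g] linear_additive(2)[OF g])
qed

lemma trace_commute:
  assumes N: "lin scale N" and A: "lin scale A"
  shows "(\<Sum>b\<in>Bs. crd b (N (A b))) = (\<Sum>b\<in>Bs. crd b (A (N b)))"
proof -
  have *: "crd b (f v) = (\<Sum>c\<in>Bs. crd c v * crd b (f c))" if f: "lin scale f" for f b v
    by (rule expand[where g = "\<lambda>v. crd b (f v)"]) (intro lin_coord f)
  have "(\<Sum>b\<in>Bs. crd b (N (A b))) = (\<Sum>b\<in>Bs. \<Sum>c\<in>Bs. crd c (A b) * crd b (N c))"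
    by (rule sum.cong[OF refl *[OF N]])
  also have "\<dots> = (\<Sum>c\<in>Bs. \<Sum>b\<in>Bs. crd b (N c) * crd c (A b))"
    by (subst sum.swap) (simp only: mult.commute)
  also have "\<dots> = (\<Sum>c\<in>Bs. crd c (A (N c)))"
    by (rule sum.cong[OF refl *[OF A, symmetric]])
  finally show ?thesis .
qed

text \<open>A partial trace with values in H: on each slice \<open>D j\<close> it is the commutation
  of an ordinary trace, and the slices are then summed over the basis.\<close>

lemma trace_commute_sw:
  assumes N: "lin scale N" and A: "lin scale A" and g: "lin scale g"
  shows "(\<Sum>b\<in>Bs. sw (\<lambda>u v. scale (crd b (g v)) u) (N (A b))) =
    (\<Sum>b\<in>Bs. sw (\<lambda>u v. scale (crd b (A (g v))) u) (N b))"
proof -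
  have "(\<Sum>b\<in>Bs. crd b (g (D j (N (A b))))) = (\<Sum>b\<in>Bs. crd b (A (g (D j (N b)))))" for j
    by (rule trace_commute[where N = "\<lambda>b. g (D j (N b))"]) (intro lin_comp[OF g] lin_comp[OF lin_D] N A)+
  then show ?thesis
    unfolding sw_def by (subst (1 2) sum.swap) (simp flip: scale_sum_left)
qed

text \<open>
  The canonical element of \<open>H \<otimes> H\<^sup>*\<close> is invariant under the diagonal action of \<open>H\<close>; the isomorphism of
  \<open>H \<otimes> H\<^sup>*\<close> with a free \<open>H\<close>-module carries it to the following left integrals.
\<close>

definition trace_integral :: "'b \<Rightarrow> 'b"
  where "trace_integral x = (\<Sum>b\<in>Bs. sw (\<lambda>u v. scale (crd b (antipode (antipode v) * x)) u) b)"

lemma sw_antipode_antipode_left: "sw (\<lambda>p q. antipode (antipode p * q)) r = scale (counit r) 1"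
  by (simp add: sw_antipode_left antipode_add antipode_one flip: linear_sw[OF antipode_linear])

lemma sw_antipode_antipode_right: "sw (\<lambda>p q. antipode (p * antipode q)) r = scale (counit r) 1"
  by (simp add: sw_antipode_right antipode_add antipode_one flip: linear_sw[OF antipode_linear])

text \<open>Write \<epsilon>(h) b as h1 S(h2) b. The trace moves multiplication by S(h2) onto the
  functional, where it meets the square of S from \<open>trace_integral\<close>: S(h3) S(S(h2)) =
  S(S(h2) h3) collapses to the counit, and h1 remains as a left factor.\<close>

lemma trace_integral_left: "h * trace_integral x = scale (counit h) (trace_integral x)"
proof -
  let ?S = antipode
  let ?f = "\<lambda>b u v. scale (crd b (?S (?S v) * x)) u"
  have step: "sw (\<lambda>p q. sw (\<lambda>u v. scale (crd b (?S q * (?S (?S v) * x))) u) (p * b)) h = h * sw (?f b) b" for b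
  proof -
    have 1: "sw (\<lambda>u v. scale (crd b (?S q * (?S (?S v) * x))) u) (p * b) =
      sw (\<lambda>p1 p2. sw (\<lambda>u v. scale (crd b (?S (?S p2 * q) * (?S (?S v) * x))) (p1 * u)) b) p" for p q
      by (subst sw_mult[OF vector_space_axioms]) (intro bilinearI lins, simp only: antipode_mult mult.assoc)
    have 2: "sw (\<lambda>p2 q. sw (\<lambda>u v. scale (crd b (?S (?S p2 * q) * (?S (?S v) * x))) (p1 * u)) b) r
      = scale (counit r) (p1 * sw (?f b) b)" for p1 r
    proof -
      have "sw (\<lambda>p2 q. sw (\<lambda>u v. scale (crd b (?S (?S p2 * q) * (?S (?S v) * x))) (p1 * u)) b) r
        = sw (\<lambda>u v. scale (crd b (sw (\<lambda>p2 q. ?S (?S p2 * q)) r * (?S (?S v) * x))) (p1 * u)) b"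
        by (subst sw_swap) (simp only: sw_scale linear_sw[OF lin_crd] sw_mult_right)
      then show ?thesis
        by (simp add: sw_antipode_antipode_left scale_mult_simps linear_additive[OF lin_crd] scale_sw sw_mult_left)
    qed
    have "sw (\<lambda>p q. sw (\<lambda>u v. scale (crd b (?S q * (?S (?S v) * x))) u) (p * b)) h =
      sw (\<lambda>p q. sw (\<lambda>p1 p2. sw (\<lambda>u v. scale (crd b (?S (?S p2 * q) * (?S (?S v) * x))) (p1 * u)) b) p) h"
      by (simp only: 1)
    also have "\<dots> = sw (\<lambda>p1 r. sw (\<lambda>p2 q. sw (\<lambda>u v. scale (crd b (?S (?S p2 * q) * (?S (?S v) * x))) (p1 * u)) b) r) h"
      by (rule sw_coassoc[where s = scale]) (intro lins)+
    also have "\<dots> = h * sw (?f b) b"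
      unfolding 2 by (rule sw_scale_counit_right) (intro lins)
    finally show ?thesis .
  qed
  have "scale (counit h) (trace_integral x) = (\<Sum>b\<in>Bs. sw (?f b) (scale (counit h) b))"
  proof -
    have "sw (?f b) (scale (counit h) b) = scale (counit h) (sw (?f b) b)" for b
      by (rule linear_additive(2)[where f = "sw (?f b)"]) (intro lin_sw_self lins)
    then show ?thesis by (simp add: trace_integral_def scale_sum_right)
  qed
  also have "\<dots> = (\<Sum>b\<in>Bs. sw (\<lambda>p q. sw (?f b) (p * (?S q * b))) h)"
  proof -
    have "scale (counit h) b = sw (\<lambda>p q. p * (?S q * b)) h" for b
      using sw_mult_right[of "\<lambda>p q. p * ?S q" h b] by (simp add: sw_antipode_right mult.assoc scale_mult_simps)
    moreover have "sw (?f b) (sw (\<lambda>p q. p * (?S q * b)) h) = sw (\<lambda>p q. sw (?f b) (p * (?S q * b))) h" for b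
      by (rule linear_sw[of scale scale "sw (?f b)"]) (intro lin_sw_self lins)
    ultimately show ?thesis by simp
  qed
  also have "\<dots> = sw (\<lambda>p q. \<Sum>b\<in>Bs. sw (\<lambda>u v. scale (crd b (?S q * (?S (?S v) * x))) u) (p * b)) h"
    unfolding sum_sw by (subst trace_commute_sw[where N = "\<lambda>c. _ * c"]) (intro lins | rule refl)+
  also have "\<dots> = (\<Sum>b\<in>Bs. h * sw (?f b) b)"
    unfolding step[symmetric] sum_sw ..
  also have "\<dots> = h * trace_integral x"
    unfolding trace_integral_def by (simp add: sum_distrib_left)
  finally show ?thesis ..
qed

text \<open>
  If \<open>\<Sum>\<^sub>i z\<^sub>i \<otimes> \<kappa>\<^sub>i(w, c\<^sub>i)\<close> vanishes for all \<open>w\<close>, then \<open>\<Delta>\<close> may be applied to the \<open>z\<^sub>i\<close> and the second factor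
  absorbed into \<open>w\<close>.
\<close>

lemma sw_expand_zero:
  assumes \<kappa>: "\<And>i w. lin (*) (\<kappa> i w)" "\<And>i c. lin (*) (\<lambda>w. \<kappa> i w c)" and g: "lin scale g"
    and 0: "\<And>w. (\<Sum>i\<in>A. sw (\<lambda>z c. scale (\<kappa> i w c) z) (t i)) = 0"
  shows "(\<Sum>i\<in>A. sw (\<lambda>z c. sw (\<lambda>a d. scale (\<kappa> i (g d) c) a) z) (t i)) = 0"
proof -
  have "(\<Sum>i\<in>A. sw (\<lambda>z c. \<kappa> i (g (D j z)) c) (t i)) = 0" for j
  proof -
    \<comment> \<open>For fixed j the parameter \<open>g (D j k)\<close> depends only on the basis
      vector k, so each term becomes the k-th coordinate of hypothesis \<open>0\<close> at that
      parameter.\<close>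
    have ex: "\<kappa> i (g (D j z)) c = (\<Sum>k\<in>Bs. crd k z * \<kappa> i (g (D j k)) c)" for i z c
      by (rule expand[where g = "\<lambda>z. \<kappa> i (g (D j z)) c"]) (intro lin_comp[OF \<kappa>(2)] lin_comp[OF g] lin_D)
    have "(\<Sum>i\<in>A. sw (\<lambda>z c. \<kappa> i (g (D j z)) c) (t i)) =
      (\<Sum>i\<in>A. sw (\<lambda>z c. \<Sum>k\<in>Bs. crd k z * \<kappa> i (g (D j k)) c) (t i))"
      by (intro sum.cong refl arg_cong[where f = "\<lambda>f. sw f _"] ext ex)
    also have "\<dots> = (\<Sum>i\<in>A. \<Sum>k\<in>Bs. sw (\<lambda>z c. crd k z * \<kappa> i (g (D j k)) c) (t i))"
      by (simp only: sum_sw)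
    also have "\<dots> = (\<Sum>k\<in>Bs. \<Sum>i\<in>A. sw (\<lambda>z c. crd k z * \<kappa> i (g (D j k)) c) (t i))"
      by (rule sum.swap)
    also have "\<dots> = (\<Sum>k\<in>Bs. crd k (\<Sum>i\<in>A. sw (\<lambda>z c. scale (\<kappa> i (g (D j k)) c) z) (t i)))"
      by (simp add: linear_sum[OF lin_crd] linear_sw[OF lin_crd]
          linear_additive[OF lin_crd] mult.commute)
    finally show ?thesis by (simp add: 0 linear_additive[OF lin_crd])
  qed
  then have "(\<Sum>j\<in>Bs. scale (\<Sum>i\<in>A. sw (\<lambda>z c. \<kappa> i (g (D j z)) c) (t i)) j) = 0" by simp
  moreover have "(\<Sum>i\<in>A. sw (\<lambda>z c. sw (\<lambda>a d. scale (\<kappa> i (g d) c) a) z) (t i)) =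
    (\<Sum>j\<in>Bs. scale (\<Sum>i\<in>A. sw (\<lambda>z c. \<kappa> i (g (D j z)) c) (t i)) j)"
  proof -
    have "sw (\<lambda>a d. scale (\<kappa> i (g d) c) a) z = (\<Sum>j\<in>Bs. scale (\<kappa> i (g (D j z)) c) j)" for i c z
      by (simp only: sw_def)
    then have "(\<Sum>i\<in>A. sw (\<lambda>z c. sw (\<lambda>a d. scale (\<kappa> i (g d) c) a) z) (t i)) =
        (\<Sum>i\<in>A. \<Sum>j\<in>Bs. sw (\<lambda>z c. scale (\<kappa> i (g (D j z)) c) j) (t i))"
      by (simp only: sum_sw)
    also have "\<dots> = (\<Sum>j\<in>Bs. \<Sum>i\<in>A. sw (\<lambda>z c. scale (\<kappa> i (g (D j z)) c) j) (t i))"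
      by (rule sum.swap)
    finally show ?thesis by (simp only: scale_sum_left sw_scale)
  qed
  ultimately show ?thesis by simp
qed

text \<open>If all these integrals vanished, the free argument x could absorb S of a further
  coproduct factor. Then S(S(b3)) S(b2) = S(b2 S(b3)) collapses to the counit, and what remains is
  the sum of the basis vectors b weighted by the b-coordinates of 1, that is, 1 itself.\<close>

lemma trace_integral_nonzero: "\<exists>x. trace_integral x \<noteq> 0"
proof (rule ccontr)
  let ?S = antipode
  assume "\<nexists>x. trace_integral x \<noteq> 0"
  then have "(\<Sum>b\<in>Bs. sw (\<lambda>z c. sw (\<lambda>a d. scale (crd b (?S (?S c) * ?S d)) a) z) b) = 0"
    by (intro sw_expand_zero[where \<kappa> = "\<lambda>b w c. crd b (?S (?S c) * w)"] lins) (simp add: trace_integral_def)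
  moreover have "sw (\<lambda>z c. sw (\<lambda>a d. scale (crd b (?S (?S c) * ?S d)) a) z) b = scale (crd b 1) b" for b
  proof -
    have "sw (\<lambda>z c. sw (\<lambda>a d. scale (crd b (?S (?S c) * ?S d)) a) z) b =
       sw (\<lambda>a r. sw (\<lambda>d c. scale (crd b (?S (?S c) * ?S d)) a) r) b"
      by (rule sw_coassoc[where s = scale]) (intro lins)+
    also have "\<dots> = sw (\<lambda>a r. scale (crd b (sw (\<lambda>d c. ?S (d * ?S c)) r)) a) b"
      by (simp only: antipode_mult sw_scale linear_sw[OF lin_crd])
    also have "\<dots> = sw (\<lambda>a r. scale (counit r) (scale (crd b 1) a)) b"
      by (simp add: sw_antipode_antipode_right linear_additive[OF lin_crd])
    also have "\<dots> = scale (crd b 1) b"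
      by (rule sw_scale_counit_right) (intro lins)
    finally show ?thesis .
  qed
  ultimately show False by (simp add: sum_crd)
qed

end

section \<open>Shift rules for integrals and the Frobenius form\<close>

context finite_dimensional_hopf_algebra
begin

lemma sw_scale_lin: "lin s g \<Longrightarrow> g (sw (\<lambda>a b. scale (p a b) (q a b)) x) = sw (\<lambda>a b. s (p a b) (g (q a b))) x"
  by (subst linear_sw[of scale s g]) (simp_all add: linear_additive(2)[of scale s g])

text \<open>In t1 \<otimes> h t2 insert the counit in the form S(h1) h2 in front of t1. What stands
  behind S(h1) is then \<Delta> of the product of the remaining part of h with t, which the integral
  property reduces to a scalar multiple of \<Delta> t.\<close>

lemma left_integral_shift:
  assumes t: "\<And>h. h * t = scale (counit h) t"
    and f: "\<And>b. lin s (\<lambda>a. f a b)" "\<And>a. lin s (f a)"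
  shows "sw (\<lambda>a b. f (antipode h * a) b) t = sw (\<lambda>a b. f a (h * b)) t"
proof -
  have V: "vector_space s" by (rule vector_space_lin[OF f(1)])
  note fc1 = lin_comp[OF f(1)] and fc2 = lin_comp[OF f(2)]
  let ?S = antipode
  have 1: "sw (\<lambda>h1 h2. f (?S h1 * (h2 * a)) v) x = s (counit x) (f a v)" for x a v
  proof -
    have "sw (\<lambda>h1 h2. f (?S h1 * (h2 * a)) v) x = f (sw (\<lambda>h1 h2. ?S h1 * h2) x * a) v"
      by (simp only: linear_sw[OF f(1)] sw_mult_right mult.assoc)
    then show ?thesis
      by (simp add: sw_antipode_left scale_mult_simps linear_additive(2)[OF f(1)])
  qed
  have 2: "sw (\<lambda>h2 h3. sw (\<lambda>a b. f (?S h1 * (h2 * a)) (h3 * b)) t) y = s (counit y) (sw (\<lambda>a b. f (?S h1 * a) b) t)" for h1 y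
  proof -
    have "sw (\<lambda>a b. f (?S h1 * a) b) (y * t) = sw (\<lambda>h2 h3. sw (\<lambda>a b. f (?S h1 * (h2 * a)) (h3 * b)) t) y"
      by (rule sw_mult[OF V]) (intro bilinearI fc1 f lins)
    moreover have "sw (\<lambda>a b. f (?S h1 * a) b) (scale (counit y) t) = s (counit y) (sw (\<lambda>a b. f (?S h1 * a) b) t)"
      by (rule linear_additive(2)[where f = "sw (\<lambda>a b. f (?S h1 * a) b)"])
        (intro lin_sw_self f lins)
    ultimately show ?thesis by (simp add: t)
  qed
  have "sw (\<lambda>a b. f a (h * b)) t = sw (\<lambda>x h3. s (counit x) (sw (\<lambda>a b. f a (h3 * b)) t)) h"
    by (rule sw_scale_counit_left[symmetric]) (intro lins fc2)
  also have "\<dots> = sw (\<lambda>x h3. sw (\<lambda>h1 h2. sw (\<lambda>a b. f (?S h1 * (h2 * a)) (h3 * b)) t) x) h"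
  proof -
    have "s (counit x) (sw (\<lambda>a b. f a (h3 * b)) t) = sw (\<lambda>h1 h2. sw (\<lambda>a b. f (?S h1 * (h2 * a)) (h3 * b)) t) x" for x h3
    proof -
      interpret V: vector_space s by (rule V)
      have "s (counit x) (sw (\<lambda>a b. f a (h3 * b)) t) = sw (\<lambda>a b. s (counit x) (f a (h3 * b))) t"
        unfolding sw_def by (rule V.scale_sum_right)
      then show ?thesis by (subst sw_swap) (simp only: 1)
    qed
    then show ?thesis by simp
  qed
  also have "\<dots> = sw (\<lambda>h1 y. sw (\<lambda>h2 h3. sw (\<lambda>a b. f (?S h1 * (h2 * a)) (h3 * b)) t) y) h"
    by (rule sw_coassoc[where s = s]) (intro lins fc1 fc2)+
  also have "\<dots> = sw (\<lambda>a b. f (?S h * a) b) t"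
    unfolding 2 by (rule sw_scale_counit_right) (intro lins fc1)
  finally show ?thesis ..
qed

text \<open>The mirror image: t1 h \<otimes> t2 = t1 h1 \<otimes> t2 h2 S(h3), and the first two
  parts of h form \<Delta>(t h1), a multiple of \<Delta> t by G. The antipode now stands to the
  right of t2.\<close>

lemma right_integral_shift:
  assumes t: "\<And>h. t * h = scale (G h) t" and G: "lin (*) G"
    and f: "\<And>b. lin s (\<lambda>a. f a b)" "\<And>a. lin s (f a)"
  shows "sw (\<lambda>a b. f (a * h) b) t = sw (\<lambda>p q. s (G p) (sw (\<lambda>a b. f a (b * antipode q)) t)) h"
proof -
  have V: "vector_space s" by (rule vector_space_lin[OF f(1)])
  note fc1 = lin_comp[OF f(1)] and fc2 = lin_comp[OF f(2)]
  let ?S = antipode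
  have 1: "sw (\<lambda>h2 h3. f a (b * (h2 * ?S h3))) y = s (counit y) (f a b)" for a b y
  proof -
    have "sw (\<lambda>h2 h3. f a (b * (h2 * ?S h3))) y = f a (b * sw (\<lambda>h2 h3. h2 * ?S h3) y)"
      by (simp only: linear_sw[OF f(2)] sw_mult_left)
    then show ?thesis
      by (simp add: sw_antipode_right scale_mult_simps linear_additive(2)[OF f(2)])
  qed
  have 2: "sw (\<lambda>h1 h2. sw (\<lambda>a b. f (a * h1) (b * (h2 * ?S h3))) t) z = s (G z) (sw (\<lambda>a b. f a (b * ?S h3)) t)" for z h3
  proof -
    have "sw (\<lambda>a b. f a (b * ?S h3)) (t * z) = sw (\<lambda>a b. sw (\<lambda>h1 h2. f (a * h1) (b * h2 * ?S h3)) z) t"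
      by (rule sw_mult[OF V]) (intro bilinearI fc2 f lins)
    moreover have "sw (\<lambda>a b. f a (b * ?S h3)) (scale (G z) t) = s (G z) (sw (\<lambda>a b. f a (b * ?S h3)) t)"
      by (rule linear_additive(2)[where f = "sw (\<lambda>a b. f a (b * ?S h3))"])
        (intro lin_sw_self f fc2 lins)
    ultimately show ?thesis by (subst sw_swap) (simp add: t mult.assoc)
  qed
  have "sw (\<lambda>a b. f (a * h) b) t = sw (\<lambda>x y. s (counit y) (sw (\<lambda>a b. f (a * x) b) t)) h"
    by (rule sw_scale_counit_right[symmetric]) (intro lins fc1)
  also have "\<dots> = sw (\<lambda>x y. sw (\<lambda>h2 h3. sw (\<lambda>a b. f (a * x) (b * (h2 * ?S h3))) t) y) h"
  proof -
    have "s (counit y) (sw (\<lambda>a b. f (a * x) b) t) = sw (\<lambda>h2 h3. sw (\<lambda>a b. f (a * x) (b * (h2 * ?S h3))) t) y" for x y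
    proof -
      interpret V: vector_space s by (rule V)
      have "s (counit y) (sw (\<lambda>a b. f (a * x) b) t) = sw (\<lambda>a b. s (counit y) (f (a * x) b)) t"
        unfolding sw_def by (rule V.scale_sum_right)
      then show ?thesis by (subst sw_swap) (simp only: 1)
    qed
    then show ?thesis by simp
  qed
  also have "\<dots> = sw (\<lambda>z h3. sw (\<lambda>h1 h2. sw (\<lambda>a b. f (a * h1) (b * (h2 * ?S h3))) t) z) h"
    by (rule sw_coassoc[where s = s, symmetric]) (intro lins fc1 fc2)+
  finally show ?thesis unfolding 2 .
qed

lemma functional_eqI:
  assumes "lin (*) p" "lin (*) q" "\<And>b. b \<in> Bs \<Longrightarrow> p b = q b"
  shows "p x = q x"
  using expand[OF assms(1), of x] expand[OF assms(2), of x] assms(3) by simp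

lemma coords_eqI: "(\<And>b. b \<in> Bs \<Longrightarrow> crd b x = crd b y) \<Longrightarrow> x = y"
  using sum_crd[of x] sum_crd[of y] by (metis (no_types, lifting) sum.cong)

lemma crd_sum: 
  assumes "b \<in> Bs"
  shows "crd b (\<Sum>c\<in>Bs. scale (a c) c) = a b"
proof -
  have "crd b (\<Sum>c\<in>Bs. scale (a c) c) = (\<Sum>c\<in>Bs. a c * crd b c)"
    by (simp add: linear_sum[OF lin_crd] linear_additive[OF lin_crd])
  also have "\<dots> = (\<Sum>c\<in>Bs. if c = b then a c else 0)"
    by (rule sum.cong[OF refl]) (simp add: representation_basis fd.independent_Basis assms)
  finally show ?thesis using assms finite_Bs by simp
qed

context
  fixes t
  assumes t: "\<And>h. h * t = scale (counit h) t" and t0: "t \<noteq> 0"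
begin

text \<open>By the shift rule f(h t2) t1 = 0 for every h, and this passes to g(b) = f(x b). Putting
  S(t2) for h in g(h t3) t1 gives g(S(t2) t3) t1 = g(1) t, so g(1) = f(x) vanishes because t does
  not.\<close>

lemma integral_functional_zero:
  assumes f: "lin (*) f" and 0: "sw (\<lambda>a b. scale (f b) a) t = 0"
  shows "f x = 0"
proof -
  let ?S = antipode
  have one: "g 1 = 0" if g: "lin (*) g" and g0: "\<And>h. sw (\<lambda>a b. scale (g (h * b)) a) t = 0" for g
  proof -
    have "(\<Sum>i\<in>{()}. sw (\<lambda>z c. sw (\<lambda>a d. scale (g (?S d * c)) a) z) t) = 0"
      by (intro sw_expand_zero[where \<kappa> = "\<lambda>_ w c. g (w * c)" and t = "\<lambda>_. t"] lins lin_comp[OF g]) (simp add: g0)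
    moreover have "sw (\<lambda>z c. sw (\<lambda>a d. scale (g (?S d * c)) a) z) t = sw (\<lambda>a r. sw (\<lambda>d c. scale (g (?S d * c)) a) r) t"
      by (rule sw_coassoc[where s = scale]) (intro lins lin_comp[OF g])+
    moreover have "\<dots> = sw (\<lambda>a r. scale (counit r) (scale (g 1) a)) t"
      by (simp add: linear_additive[OF g] sw_antipode_left flip: sw_scale linear_sw[OF g])
    moreover have "\<dots> = scale (g 1) t"
      by (rule sw_scale_counit_right) (intro lins)
    ultimately show ?thesis using t0 by simp
  qed
  have shift: "sw (\<lambda>a b. scale (f (h * b)) a) t = 0" for h
  proof -
    have "sw (\<lambda>a b. scale (f b) (?S h * a)) t = sw (\<lambda>a b. scale (f (h * b)) a) t"
      by (rule left_integral_shift[OF t, where s = scale and f = "\<lambda>a b. scale (f b) a"]) (intro lins f)+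
    then have "?S h * sw (\<lambda>a b. scale (f b) a) t = sw (\<lambda>a b. scale (f (h * b)) a) t"
      by (simp add: sw_mult_left scale_mult_simps)
    then show ?thesis by (simp add: 0)
  qed
  have "f (x * 1) = 0"
    by (rule one[of "\<lambda>b. f (x * b)"]) (intro lin_comp[OF f] lins, simp add: shift flip: mult.assoc)
  then show ?thesis by simp
qed

lemma ex_dual_integral: "\<exists>l. lin (*) l \<and> sw (\<lambda>a b. scale (l b) a) t = 1"
proof -
  \<comment> \<open>\<open>f v\<close> is the functional whose values on the basis are the
    coordinates of v. This identifies H with its dual, so that injectivity implies surjectivity for
    an endomorphism of H.\<close>
  define f where "f v x = (\<Sum>c\<in>Bs. crd c v * crd c x)" for v x
  have f: "lin (*) (f v)" "lin (*) (\<lambda>v. f v x)" for v x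
    unfolding f_def by (intro lin_sum[OF vector_space_field] lins lin_crd)+
  let ?T = "\<lambda>v. sw (\<lambda>a b. scale (f v b) a) t"
  have lT: "lin scale ?T" by (intro lins f)
  have "inj ?T"
  proof (rule injI)
    fix v w assume "?T v = ?T w"
    then have "?T (v - w) = 0" using linear_additive(4)[OF lT, of v w] by simp
    then have z: "f (v - w) x = 0" for x by (rule integral_functional_zero[OF f(1)])
    show "v = w"
    proof (rule coords_eqI)
      fix b assume b: "b \<in> Bs"
      have "f (v - w) b = (\<Sum>c\<in>Bs. if c = b then crd c (v - w) else 0)"
        unfolding f_def by (rule sum.cong[OF refl]) (simp add: representation_basis fd.independent_Basis b)
      also have "\<dots> = crd b (v - w)" using b finite_Bs by simp
      finally have "crd b (v - w) = 0" by (simp only: z)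
      then show "crd b v = crd b w" by (simp add: linear_additive(4)[OF lin_crd])
    qed
  qed
  then have "surj ?T" by (rule fd.linear_inj_imp_surj[OF lT])
  then obtain v where "1 = ?T v" by (rule surjE)
  then show ?thesis using f(1)[of v] by (intro exI[of _ "f v"]) simp
qed

context
  fixes l
  assumes l: "lin (*) l" and l1: "sw (\<lambda>a b. scale (l b) a) t = 1"
begin

lemmas lin_l = lin_comp[OF l]
lemmas llins = lins lin_l l

lemma dual_integral_apply: "l t = 1"
proof -
  have "l t = sw (\<lambda>a b. counit a * l b) t"
    by (rule sw_scale_counit_left[symmetric]) (rule l)
  also have "\<dots> = counit (sw (\<lambda>a b. scale (l b) a) t)"
    by (simp add: sw_scale_lin[OF counit_linear] mult.commute)
  finally show ?thesis by (simp add: l1 counit_one)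
qed

lemma antipode_formula: "antipode x = sw (\<lambda>a b. scale (l (x * b)) a) t"
proof -
  have "sw (\<lambda>a b. scale (l b) (antipode x * a)) t = sw (\<lambda>a b. scale (l (x * b)) a) t"
    by (rule left_integral_shift[OF t, where s = scale and f = "\<lambda>a b. scale (l b) a"]) (intro llins)+
  then have "antipode x * sw (\<lambda>a b. scale (l b) a) t = sw (\<lambda>a b. scale (l (x * b)) a) t"
    by (simp add: sw_mult_left scale_mult_simps)
  then show ?thesis by (simp add: l1)
qed

text \<open>This is the statement that l is a left integral of the dual, tested on each coordinate
  functional g. The difference of the convolution g l and g(1) l is killed when paired with the
  second factor of \<Delta> t: coassociativity turns t1 g(t2) l(t3) into the coproduct of t1 l(t2) =
  1. Such a functional is zero.\<close>

lemma dual_integral: "sw (\<lambda>a b. scale (l b) a) x = scale (l x) 1"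
proof (rule coords_eqI)
  fix k assume "k \<in> Bs"
  let ?g = "crd k"
  let ?R = "\<lambda>z. sw (\<lambda>a b. scale (?g b) a) z"
  let ?f = "\<lambda>x. sw (\<lambda>a b. ?g a * l b) x - ?g 1 * l x"
  have h: "lin (*) (\<lambda>x. sw (\<lambda>a b. ?g a * l b) x)" by (intro llins lin_sw_self lin_crd)
  have f: "lin (*) ?f"
    using linear_additive[OF h] linear_additive[OF l]
    by (simp add: lin_iff vector_space_axioms vector_space_field algebra_simps)
  have "sw (\<lambda>a z. scale (sw (\<lambda>b c. ?g b * l c) z) a) t = sw (\<lambda>a z. sw (\<lambda>b c. scale (?g b * l c) a) z) t"
    by (simp only: sw_scale)
  also have "\<dots> = sw (\<lambda>z c. sw (\<lambda>a b. scale (?g b * l c) a) z) t"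
    by (rule sw_coassoc[where s = scale, symmetric]) (intro llins lin_crd)+
  also have "\<dots> = sw (\<lambda>z c. scale (l c) (?R z)) t"
    by (simp add: scale_sw mult.commute)
  also have "\<dots> = ?R (sw (\<lambda>z c. scale (l c) z) t)"
    by (rule sw_scale_lin[symmetric]) (intro lin_sw_self lins lin_crd)
  also have "\<dots> = scale (?g 1) 1"
    unfolding l1 by (rule sw_one[OF vector_space_axioms]) (intro bilinearI lins lin_crd)
  finally have e: "sw (\<lambda>a z. scale (sw (\<lambda>b c. ?g b * l c) z) a) t = scale (?g 1) 1" .
  have "sw (\<lambda>a b. scale (?f b) a) t = sw (\<lambda>a z. scale (sw (\<lambda>b c. ?g b * l c) z) a) t - scale (?g 1) (sw (\<lambda>a b. scale (l b) a) t)"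
    unfolding scale_left_diff_distrib scale_sw by (simp add: sw_def sum_subtractf)
  then have "sw (\<lambda>a b. scale (?f b) a) t = 0" by (simp add: e l1)
  then have "?f x = 0" by (rule integral_functional_zero[OF f])
  then show "?g (sw (\<lambda>a b. scale (l b) a) x) = ?g (scale (l x) 1)"
    by (simp add: sw_scale_lin[OF lin_crd] linear_additive[OF lin_crd] mult.commute)
qed

text \<open>The dual of \<open>left_integral_shift\<close>: insert S(x1) x2 in front of y1 in y1 l(x
  y2), and apply \<open>dual_integral\<close> to the product of the second part of x with y.\<close>

lemma dual_integral_shift: "sw (\<lambda>u v. scale (l (v * y)) (antipode u)) x = sw (\<lambda>a b. scale (l (x * b)) a) y"
proof -
  let ?S = antipode
  have 1: "sw (\<lambda>u v. ?S u * (v * a)) q = scale (counit q) a" for q a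
    using sw_mult_right[of "\<lambda>u v. ?S u * v" q a] by (simp add: sw_antipode_left mult.assoc scale_mult_simps)
  have 2: "sw (\<lambda>x2 x3. sw (\<lambda>a b. scale (l (x3 * b)) (?S x1 * (x2 * a))) y) r = scale (l (r * y)) (?S x1)" for x1 r
  proof -
    have "sw (\<lambda>a b. scale (l b) a) (r * y) = sw (\<lambda>x2 x3. sw (\<lambda>a b. scale (l (x3 * b)) (x2 * a)) y) r"
      by (rule sw_mult[OF vector_space_axioms]) (intro bilinearI llins)
    then have "?S x1 * scale (l (r * y)) 1 = ?S x1 * sw (\<lambda>x2 x3. sw (\<lambda>a b. scale (l (x3 * b)) (x2 * a)) y) r"
      by (simp only: dual_integral)
    then show ?thesis by (simp add: sw_mult_left scale_mult_simps)
  qed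
  have "sw (\<lambda>a b. scale (l (x * b)) a) y = sw (\<lambda>q z. scale (counit q) (sw (\<lambda>a b. scale (l (z * b)) a) y)) x"
    by (rule sw_scale_counit_left[symmetric]) (intro llins)
  also have "\<dots> = sw (\<lambda>q z. sw (\<lambda>u v. sw (\<lambda>a b. scale (l (z * b)) (?S u * (v * a))) y) q) x"
  proof -
    have "sw (\<lambda>u v. sw (\<lambda>a b. scale (l (z * b)) (?S u * (v * a))) y) q = scale (counit q) (sw (\<lambda>a b. scale (l (z * b)) a) y)" for q z
      by (subst sw_swap) (simp add: 1 mult.commute scale_sw flip: scale_sw[where x = q])
    then show ?thesis by simp
  qed
  also have "\<dots> = sw (\<lambda>u r. sw (\<lambda>v z. sw (\<lambda>a b. scale (l (z * b)) (?S u * (v * a))) y) r) x"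
    by (rule sw_coassoc[where s = scale]) (intro llins)+
  finally show ?thesis by (simp only: 2)
qed

text \<open>The shift rule turns the hypothesis into y1 l(w y2) = 0 for all w. With w = t S(y2) and
  y3 in place of y2, the argument collapses to t and the left side becomes l(t) y = y.\<close>

lemma frobenius_nondegenerate:
  assumes "\<And>x. l (x * y) = 0"
  shows "y = 0"
proof -
  let ?S = antipode
  have "sw (\<lambda>u v. scale (l (v * y)) (?S u)) w = 0" for w
    by (simp add: assms sw_def)
  then have "sw (\<lambda>a b. scale (l (w * b)) a) y = 0" for w
    by (simp only: dual_integral_shift)
  then have "(\<Sum>i\<in>{()}. sw (\<lambda>z c. sw (\<lambda>a d. scale (l ((t * ?S d) * c)) a) z) y) = 0"
    by (intro sw_expand_zero[where \<kappa> = "\<lambda>_ w c. l (w * c)" and t = "\<lambda>_. y"] llins) simp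
  then have "0 = sw (\<lambda>z c. sw (\<lambda>a d. scale (l ((t * ?S d) * c)) a) z) y" by simp
  also have "\<dots> = sw (\<lambda>a r. sw (\<lambda>d c. scale (l ((t * ?S d) * c)) a) r) y"
    by (rule sw_coassoc[where s = scale]) (intro llins)+
  also have "\<dots> = sw (\<lambda>a r. scale (counit r) a) y"
  proof -
    have "sw (\<lambda>d c. l ((t * ?S d) * c)) r = l (t * sw (\<lambda>d c. ?S d * c) r)" for r
      by (simp only: linear_sw[OF l] sw_mult_left mult.assoc)
    then have "sw (\<lambda>d c. scale (l ((t * ?S d) * c)) a) r = scale (counit r) a" for a r
      by (simp add: sw_antipode_left scale_mult_simps linear_additive[OF l] dual_integral_apply flip: sw_scale)
    then show ?thesis by simp
  qed
  also have "\<dots> = y" by (rule sw_counit_right)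
  finally show ?thesis ..
qed

lemma frobenius_surj:
  assumes p: "lin (*) p"
  shows "\<exists>y. \<forall>x. l (x * y) = p x"
proof -
  \<comment> \<open>The functional x \<mapsto> l(xy) is encoded as the vector of its values on the
    basis, again to make injectivity of an endomorphism of H yield surjectivity.\<close>
  let ?T = "\<lambda>y. \<Sum>c\<in>Bs. scale (l (c * y)) c"
  have lT: "lin scale ?T" by (intro lin_sum[OF vector_space_axioms] llins)
  have eq: "l (x * y) = q x" if "\<And>c. c \<in> Bs \<Longrightarrow> l (c * y) = q c" "lin (*) q" for x y q
    by (rule functional_eqI) (intro llins that)+
  have z: "lin (*) (\<lambda>x. 0)" by (simp add: lin_iff vector_space_axioms vector_space_field)
  have "inj ?T"
  proof (rule injI)
    fix v w assume "?T v = ?T w"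
    then have "?T (v - w) = 0" using linear_additive(4)[OF lT, of v w] by simp
    then have "l (c * (v - w)) = 0" if "c \<in> Bs" for c
      using crd_sum[OF that, of "\<lambda>c. l (c * (v - w))"] by (simp add: linear_additive[OF lin_crd])
    then have "l (x * (v - w)) = 0" for x by (rule eq[of _ "\<lambda>_. 0"]) (auto intro: z)
    then show "v = w" using frobenius_nondegenerate[of "v - w"] by simp
  qed
  then have "surj ?T" by (rule fd.linear_inj_imp_surj[OF lT])
  then obtain y where "(\<Sum>c\<in>Bs. scale (p c) c) = ?T y" by (rule surjE)
  then have "l (c * y) = p c" if "c \<in> Bs" for c
    using crd_sum[OF that, of "\<lambda>c. l (c * y)"] crd_sum[OF that, of p] by simp
  then show ?thesis using eq[OF _ p] by blast
qed

text \<open>Take the coproduct in S(x) = t1 l(x t2), which gives t1 \<otimes> t2 l(x t3). The dual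
  shift replaces t2 l(x t3) by S(x1) l(x2 t2), and t1 l(x2 t2) is S(x2) by the same formula; hence
  the two factors appear in reverse order.\<close>

lemma antipode_comult:
  assumes f: "\<And>b. lin s (\<lambda>a. f a b)" "\<And>a. lin s (f a)"
  shows "sw f (antipode x) = sw (\<lambda>a b. f (antipode b) (antipode a)) x"
proof -
  have V: "vector_space s" by (rule vector_space_lin[OF f(1)])
  interpret V: vector_space s by (rule V)
  have ss: "s k (sw g y) = sw (\<lambda>a b. s k (g a b)) y" for k g y
    unfolding sw_def by (rule V.scale_sum_right)
  have ls: "lin s (\<lambda>x. s k (g x))" if "lin s g" for k g
    using that by (simp add: lin_iff V.scale_right_distrib mult.commute)
  have lv: "lin s (\<lambda>x. s (p x) v)" if "lin (*) p" for p v
    using that by (simp add: lin_iff V V.scale_left_distrib)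
  have "sw f (antipode x) = sw f (sw (\<lambda>a b. scale (l (x * b)) a) t)"
    by (simp only: antipode_formula[of x])
  also have "\<dots> = sw (\<lambda>z c. s (l (x * c)) (sw f z)) t"
    by (rule sw_scale_lin) (intro lin_sw_self f lins)
  also have "\<dots> = sw (\<lambda>z c. sw (\<lambda>a b. s (l (x * c)) (f a b)) z) t"
    by (simp only: ss)
  also have "\<dots> = sw (\<lambda>a r. sw (\<lambda>b c. s (l (x * c)) (f a b)) r) t"
    by (rule sw_coassoc[where s = s]) (intro ls lv f llins)+
  also have "\<dots> = sw (\<lambda>a r. f a (sw (\<lambda>b c. scale (l (x * c)) b) r)) t"
    by (simp only: sw_scale_lin[OF f(2)])
  also have "\<dots> = sw (\<lambda>a r. f a (sw (\<lambda>u v. scale (l (v * r)) (antipode u)) x)) t"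
    by (simp only: dual_integral_shift)
  also have "\<dots> = sw (\<lambda>u v. sw (\<lambda>a r. s (l (v * r)) (f a (antipode u))) t) x"
    by (subst sw_swap) (simp only: sw_scale_lin[OF f(2)])
  also have "\<dots> = sw (\<lambda>u v. f (antipode v) (antipode u)) x"
    by (simp only: antipode_formula[of "_ :: 'b"] sw_scale_lin[OF f(1)])
  finally show ?thesis .
qed

end

end

end

section \<open>Characters as grouplike elements of the dual\<close>

lemma dual_space_sel [simp]:
  "carrier (dual_space scale) = {f. Vector_Spaces.linear scale (*) f}"
  "monoid.mult (dual_space scale) = (\<lambda>f g a. f a + g a)" "one (dual_space scale) = (\<lambda>a. 0)"
  "lact (dual_space scale) = (\<lambda>k f a. k * f a)" "ract (dual_space scale) = (\<lambda>f k a. k * f a)"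
  by (simp_all add: dual_space_def)

lemma linear_functional_simps:
  assumes "vector_space s"
  shows "Vector_Spaces.linear s (*) f \<Longrightarrow> Vector_Spaces.linear s (*) g \<Longrightarrow> Vector_Spaces.linear s (*) (\<lambda>a. f a + g a)"
    and "Vector_Spaces.linear s (*) f \<Longrightarrow> Vector_Spaces.linear s (*) (\<lambda>a. k * f a)"
    and "Vector_Spaces.linear s (*) (\<lambda>a. 0)"
    and "Vector_Spaces.linear s (*) f \<Longrightarrow> Vector_Spaces.linear s (*) (\<lambda>a. - f a)"
  using assms vector_space_field by (auto simp: lin_iff algebra_simps)

lemma comm_group_functionals:
  assumes "vector_space s"
  shows "comm_group \<lparr>carrier = {f. Vector_Spaces.linear s (*) f}, monoid.mult = (\<lambda>f g a. f a + g a), one = (\<lambda>a. 0)\<rparr>"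
proof (rule comm_groupI, goal_cases)
  case (6 f)
  then show ?case
    using linear_functional_simps(4)[OF assms] by (intro bexI[of _ "\<lambda>a. - f a"]) auto
qed (auto simp: linear_functional_simps[OF assms] algebra_simps)

lemma dual_space_is_bimodule:
  assumes "vector_space s"
  shows "is_bimodule (dual_space s)"
  by (intro is_bimodule.intro is_bimodule_axioms.intro comm_group_cong[OF comm_group_functionals[OF assms]])
    (auto simp: linear_functional_simps[OF assms] algebra_simps)

context finite_dimensional_hopf_algebra
begin

abbreviation (input) Ds where "Ds \<equiv> dual_space scale"

abbreviation (input) dpure where "dpure \<equiv> pure_tensor Ds Ds"

sublocale DD: bimodule_pair "dual_space scale" "dual_space scale"
  by (intro bimodule_pairI dual_space_is_bimodule vector_space_axioms)

definition dual_pairing :: "('b \<Rightarrow> 'a, 'b \<Rightarrow> 'a) tensor \<Rightarrow> 'b \<Rightarrow> 'b \<Rightarrow> 'a"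
  where "dual_pairing X a b = tensor_lift (\<lambda>f' f''. f' a * f'' b) X"

lemma dual_pairing_balanced:
  "balanced Ds Ds \<lparr>carrier = UNIV, monoid.mult = (+), one = 0\<rparr> (\<lambda>f' f''. f' a * f'' b)"
  by (intro balancedI) (simp_all add: hom_def algebra_simps)

lemma dual_pairing_hom: "(\<lambda>X. dual_pairing X a b) \<in> hom DD.T \<lparr>carrier = UNIV, monoid.mult = (+), one = 0\<rparr>"
  unfolding dual_pairing_def by (rule DD.tensor_lift(1)[OF dual_pairing_balanced])

lemma dual_pairing_add:
  "X \<in> carrier DD.T \<Longrightarrow> Y \<in> carrier DD.T \<Longrightarrow>
    dual_pairing (X \<otimes>\<^bsub>DD.T\<^esub> Y) a b = dual_pairing X a b + dual_pairing Y a b"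
  using hom_mult[OF dual_pairing_hom] by simp

lemma dual_pairing_zero: "dual_pairing \<one>\<^bsub>DD.T\<^esub> a b = 0"
  using hom_one[OF dual_pairing_hom DD.T.is_group comm_group.axioms(2)[OF comm_group_additive]] by simp

lemma dual_pairing_pure:
  "lin (*) f \<Longrightarrow> lin (*) g \<Longrightarrow> dual_pairing (dpure f g) a b = f a * g b"
  unfolding dual_pairing_def by (rule DD.tensor_lift(2)[OF dual_pairing_balanced]) simp_all

lemma dual_pairing_linear:
  assumes "X \<in> carrier DD.T"
  shows "lin (*) (dual_pairing X a)"
  using assms
proof (induction rule: DD.tensor_induct)
  case zero
  have "dual_pairing \<one>\<^bsub>DD.T\<^esub> a = (\<lambda>_. 0)" by (simp add: fun_eq_iff dual_pairing_zero)
  then show ?case by (simp add: linear_functional_simps[OF vector_space_axioms])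
next
  case (pure u v)
  then have "dual_pairing (dpure u v) a = (\<lambda>b. u a * v b)" by (simp add: fun_eq_iff dual_pairing_pure)
  then show ?case using pure by (simp add: linear_functional_simps[OF vector_space_axioms])
next
  case (add X Y)
  then have "dual_pairing (X \<otimes>\<^bsub>DD.T\<^esub> Y) a = (\<lambda>b. dual_pairing X a b + dual_pairing Y a b)"
    by (simp add: fun_eq_iff dual_pairing_add)
  then show ?case using add by (simp add: linear_functional_simps[OF vector_space_axioms])
qed

text \<open>A tensor over the dual is recovered from its values on pairs, so the map from the tensor
  square of the dual to bilinear forms is injective. This is what makes \<open>dual_comul\<close>
  well defined.\<close>

lemma dual_tensor_expand:
  assumes "X \<in> carrier DD.T"
  shows "X = finprod DD.T (\<lambda>b. dpure (crd b) (dual_pairing X b)) Bs"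
  using assms
proof (induction rule: DD.tensor_induct)
  case zero
  have z: "dpure (crd b) (\<lambda>_. 0) = \<one>\<^bsub>DD.T\<^esub>" for b
  proof -
    have "dpure (crd b) \<one>\<^bsub>Ds\<^esub> = \<one>\<^bsub>DD.T\<^esub>"
      by (rule hom_one[OF balancedD(2)[OF DD.pure_balanced] DD.U.is_group DD.T.is_group]) (simp add: lin_crd)
    then show ?thesis by simp
  qed
  have "dual_pairing \<one>\<^bsub>DD.T\<^esub> b = (\<lambda>_. 0)" for b by (simp add: fun_eq_iff dual_pairing_zero)
  then show ?case by (simp add: z)
next
  case (pure f g)
  then have f: "lin (*) f" and g: "lin (*) g" by simp_all
  \<comment> \<open>The scalar \<open>f b\<close> crosses the tensor sign, after which the sum over
    b reassembles f in the first factor.\<close>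
  have eq: "dpure (crd b) (dual_pairing (dpure f g) b) = dpure (\<lambda>x. f b * crd b x) g" for b
  proof -
    have "dual_pairing (dpure f g) b = lact Ds (f b) g"
      by (simp add: fun_eq_iff dual_pairing_pure f g)
    then show ?thesis
      using DD.pure_move[of "crd b" g "f b"] by (simp add: lin_crd g)
  qed
  have fin: "dpure (\<lambda>x. \<Sum>b\<in>A. f b * crd b x) g = finprod DD.T (\<lambda>b. dpure (\<lambda>x. f b * crd b x) g) A"
    if "finite A" for A
    using that
  proof (induction A)
    case empty
    have "dpure \<one>\<^bsub>Ds\<^esub> g = \<one>\<^bsub>DD.T\<^esub>"
      by (rule hom_one[OF balancedD(1)[OF DD.pure_balanced] DD.U.is_group DD.T.is_group]) (simp add: g)
    then show ?case by simp
  next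
    case (insert b A)
    have l: "lin (*) (\<lambda>x. f b * crd b x)" for b by (intro lin_field_mult_left lin_crd)
    have "lin (*) (\<lambda>x. \<Sum>b\<in>A. f b * crd b x)" by (rule lin_sum[OF vector_space_field l])
    with l have "dpure (\<lambda>x. f b * crd b x + (\<Sum>b\<in>A. f b * crd b x)) g =
      dpure (\<lambda>x. f b * crd b x) g \<otimes>\<^bsub>DD.T\<^esub> dpure (\<lambda>x. \<Sum>b\<in>A. f b * crd b x) g"
      using DD.pure_add_left[of "\<lambda>x. f b * crd b x" "\<lambda>x. \<Sum>b\<in>A. f b * crd b x" g] g by simp
    with insert show ?case by (simp add: DD.T.finprod_insert Pi_iff l g)
  qed
  have "(\<lambda>x. \<Sum>b\<in>Bs. f b * crd b x) = f"
  proof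
    show "(\<Sum>b\<in>Bs. f b * crd b x) = f x" for x
      using expand[OF f, of x] by (simp add: mult.commute)
  qed
  then show ?case unfolding eq using fin[OF finite_Bs] by simp
next
  case (add X Y)
  let ?E = "\<lambda>X. finprod DD.T (\<lambda>b. dpure (crd b) (dual_pairing X b)) Bs"
  note l = dual_pairing_linear[OF add.hyps(1)] dual_pairing_linear[OF add.hyps(2)]
  have "dual_pairing (X \<otimes>\<^bsub>DD.T\<^esub> Y) b = (\<lambda>y. dual_pairing X b y + dual_pairing Y b y)" for b
    by (simp add: fun_eq_iff dual_pairing_add add.hyps)
  then have "dpure (crd b) (dual_pairing (X \<otimes>\<^bsub>DD.T\<^esub> Y) b) =
     dpure (crd b) (dual_pairing X b) \<otimes>\<^bsub>DD.T\<^esub> dpure (crd b) (dual_pairing Y b)" for b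
    using DD.pure_add_right[of "crd b" "dual_pairing X b" "dual_pairing Y b"] l by (simp add: lin_crd)
  then have "?E (X \<otimes>\<^bsub>DD.T\<^esub> Y) =
     ?E X \<otimes>\<^bsub>DD.T\<^esub>
     ?E Y"
    by (simp only:) (rule DD.T.finprod_multf, auto simp: l lin_crd)
  moreover have "X \<otimes>\<^bsub>DD.T\<^esub> Y = ?E X \<otimes>\<^bsub>DD.T\<^esub>
     ?E Y"
    by (rule arg_cong2[where f = "monoid.mult DD.T", OF add.IH])
  ultimately show ?case by (simp only:)
qed

lemma dual_comul_unique:
  assumes "X \<in> carrier DD.T" "Y \<in> carrier DD.T" "\<And>a b. dual_pairing X a b = dual_pairing Y a b"
  shows "X = Y"
proof -
  have eq: "dual_pairing X = dual_pairing Y" using assms(3) by (simp add: fun_eq_iff)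
  have "X = finprod DD.T (\<lambda>b. dpure (crd b) (dual_pairing X b)) Bs"
    by (rule dual_tensor_expand[OF assms(1)])
  also have "\<dots> = Y"
    unfolding eq by (rule dual_tensor_expand[OF assms(2), symmetric])
  finally show ?thesis .
qed

text \<open>The witness is the dual basis expansion of the bilinear form g(ab): each coordinate
  functional of b is tensored with y \<mapsto> g(by).\<close>

lemma dual_comul_ex:
  assumes g: "lin (*) g"
  shows "\<exists>X \<in> carrier DD.T. \<forall>a b. dual_pairing X a b = g (a * b)"
proof -
  define X where "X A = finprod DD.T (\<lambda>b. dpure (crd b) (\<lambda>y. g (b * y))) A" for A
  have l: "lin (*) (\<lambda>y. g (b * y))" for b by (intro lin_comp[OF g] lin_mult_left lin_id)
  have cl: "X A \<in> carrier DD.T" for A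
    unfolding X_def by (rule DD.T.finprod_closed) (simp add: lin_crd l Pi_iff)
  have pair: "dual_pairing (X A) a c = (\<Sum>b\<in>A. crd b a * g (b * c))" if "finite A" for A a c
    using that
  proof (induction A)
    case empty show ?case by (simp add: X_def dual_pairing_zero)
  next
    case (insert b A)
    have "X (insert b A) = dpure (crd b) (\<lambda>y. g (b * y)) \<otimes>\<^bsub>DD.T\<^esub> X A"
      unfolding X_def by (rule DD.T.finprod_insert) (use insert in \<open>auto simp: lin_crd l\<close>)
    then show ?case using insert by (simp add: dual_pairing_add cl lin_crd l dual_pairing_pure)
  qed
  have ex: "g (a * c) = (\<Sum>b\<in>Bs. crd b a * g (b * c))" for a c
    by (rule expand[where g = "\<lambda>a. g (a * c)"]) (intro lin_comp[OF g] lin_mult_right lin_id)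
  show ?thesis
  proof (intro bexI allI)
    show "dual_pairing (X Bs) a c = g (a * c)" for a c
      by (simp only: pair[OF finite_Bs] ex[of a c])
  qed (rule cl)
qed

lemma dual_comul_eq_iff:
  assumes g: "lin (*) g" and X: "X \<in> carrier DD.T"
  shows "dual_comul scale g = X \<longleftrightarrow> (\<forall>a b. dual_pairing X a b = g (a * b))"
proof -
  obtain Y where Y: "Y \<in> carrier DD.T" "\<forall>a b. dual_pairing Y a b = g (a * b)"
    using dual_comul_ex[OF g] by blast
  have "dual_comul scale g = Y"
    unfolding dual_comul_def dual_pairing_def[symmetric]
  proof (rule the_equality)
    fix Z assume Z: "Z \<in> carrier DD.T \<and> (\<forall>a b. dual_pairing Z a b = g (a * b))"
    show "Z = Y"
      by (rule dual_comul_unique) (use Y Z in simp_all)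
  qed (use Y in blast)
  moreover have "Y = X \<longleftrightarrow> (\<forall>a b. dual_pairing X a b = g (a * b))"
  proof
    assume "\<forall>a b. dual_pairing X a b = g (a * b)"
    then show "Y = X" by (intro dual_comul_unique Y X) (simp add: Y(2))
  qed (use Y(2) in simp)
  ultimately show ?thesis by (simp only:)
qed

definition character :: "('b \<Rightarrow> 'a) \<Rightarrow> bool"
  where "character g \<longleftrightarrow> lin (*) g \<and> g 1 = 1 \<and> (\<forall>a b. g (a * b) = g a * g b)"

abbreviation grouplikes :: "('b \<Rightarrow> 'a) monoid"
  where "grouplikes \<equiv> dual_grouplikes scale comul counit"

text \<open>Pairing the equation for a grouplike with (a, b) turns it into multiplicativity of
  g.\<close>

lemma carrier_dual_grouplikes:
  "g \<in> carrier grouplikes \<longleftrightarrow> character g"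
proof -
  have "dual_comul scale g = dpure g g \<longleftrightarrow> (\<forall>a b. g (a * b) = g a * g b)" if g: "lin (*) g"
    using g by (subst dual_comul_eq_iff) (auto simp: dual_pairing_pure)
  then show ?thesis by (auto simp: dual_grouplikes_def character_def)
qed

lemma characterD:
  assumes "character g"
  shows "lin (*) g" "g 1 = 1" "g (a * b) = g a * g b"
  using assms by (simp_all add: character_def)

lemma character_convolution:
  assumes f: "character f" and g: "character g"
  shows "character (convolution comul f g)"
proof -
  note fD = characterD[OF f] and gD = characterD[OF g]
  have c: "convolution comul f g = (\<lambda>h. sw (\<lambda>a b. f a * g b) h)"
    by (rule ext) (rule convolution_sw[OF fD(1) gD(1)])
  have bil: "bilinear_map scale scale (*) (\<lambda>a b. f a * g b)"
    by (intro bilinearI lin_field_mult_left lin_field_mult_right fD gD)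
  have "sw (\<lambda>a b. f a * g b) (x * y) = sw (\<lambda>a b. f a * g b) x * sw (\<lambda>a b. f a * g b) y" for x y
    unfolding sw_mult[OF vector_space_field bil] fD gD
    by (subst sw_mult_right) (simp add: sw_mult_left algebra_simps)
  then show ?thesis
    unfolding c character_def
    using sw_one[OF vector_space_field bil]
    by (auto intro!: lin_sw_self lin_id lin_field_mult_left gD simp: fD gD)
qed

lemma character_counit: "character counit"
  by (simp add: character_def counit_linear counit_one counit_mult)

lemma character_antipode:
  assumes g: "character g"
  shows "character (\<lambda>x. g (antipode x))"
  using lin_comp[OF characterD(1)[OF g] antipode_linear]
  by (simp add: character_def characterD[OF g] antipode_one antipode_mult mult.commute)

lemma character_inverse:
  assumes g: "character g"
  shows "convolution comul (\<lambda>x. g (antipode x)) g = counit"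
proof
  fix h
  note gD = characterD[OF g]
  have "convolution comul (\<lambda>x. g (antipode x)) g h = sw (\<lambda>a b. g (antipode a) * g b) h"
    by (intro convolution_sw lin_comp[OF gD(1)] antipode_linear gD)
  also have "\<dots> = g (sw (\<lambda>a b. antipode a * b) h)"
    by (simp add: linear_sw[OF gD(1)] gD)
  finally show "convolution comul (\<lambda>x. g (antipode x)) g h = counit h"
    by (simp add: sw_antipode_left linear_additive[OF gD(1)] gD)
qed

lemma group_dual_grouplikes: "group grouplikes"
proof (rule groupI)
  let ?G = grouplikes
  have sel: "monoid.mult ?G = convolution comul" "one ?G = counit" by (simp_all add: dual_grouplikes_def)
  note cs = carrier_dual_grouplikes
  show "\<one>\<^bsub>?G\<^esub> \<in> carrier ?G" by (simp add: cs sel character_counit)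
  fix f assume f: "f \<in> carrier ?G"
  then have f: "character f" by (simp add: cs)
  show "\<one>\<^bsub>?G\<^esub> \<otimes>\<^bsub>?G\<^esub> f = f"
    unfolding sel using characterD(1)[OF f] counit_linear
    by (simp add: fun_eq_iff convolution_sw sw_scale_counit_left)
  show "\<exists>g\<in>carrier ?G. g \<otimes>\<^bsub>?G\<^esub> f = \<one>\<^bsub>?G\<^esub>"
    unfolding sel cs[THEN eq_reflection] using character_inverse[OF f] character_antipode[OF f] cs by blast
  fix g assume "g \<in> carrier ?G"
  then have g: "character g" by (simp add: cs)
  show "f \<otimes>\<^bsub>?G\<^esub> g \<in> carrier ?G" by (simp add: cs sel character_convolution f g)
  fix h assume "h \<in> carrier ?G"
  then have h: "character h" by (simp add: cs)
  note l = characterD(1)[OF f] characterD(1)[OF g] characterD(1)[OF h]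
  show "f \<otimes>\<^bsub>?G\<^esub> g \<otimes>\<^bsub>?G\<^esub> h = f \<otimes>\<^bsub>?G\<^esub> (g \<otimes>\<^bsub>?G\<^esub> h)"
    unfolding sel
  proof
    fix x
    have "convolution comul (convolution comul f g) h x = sw (\<lambda>z c. sw (\<lambda>a b. f a * g b * h c) z) x"
      by (simp add: convolution_sw characterD(1) character_convolution f g h sw_mult_right)
    also have "\<dots> = sw (\<lambda>a z. sw (\<lambda>b c. f a * g b * h c) z) x"
      by (rule sw_coassoc[where s = "(*)"]) (intro lin_field_mult_left lin_field_mult_right l)+
    also have "\<dots> = convolution comul f (convolution comul g h) x"
      by (simp add: convolution_sw characterD(1) character_convolution f g h sw_mult_left mult.assoc)
    finally show "convolution comul (convolution comul f g) h x = convolution comul f (convolution comul g h) x" .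
  qed
qed

lemma dual_grouplikes_inv:
  assumes "character g"
  shows "inv\<^bsub>grouplikes\<^esub> g = (\<lambda>x. g (antipode x))"
proof -
  interpret G: group grouplikes by (rule group_dual_grouplikes)
  show ?thesis
    by (rule G.inv_equality)
      (use assms in \<open>simp_all add: carrier_dual_grouplikes character_antipode\<close>,
        simp add: dual_grouplikes_def character_inverse)
qed

text \<open>Composition with S is inversion in the group of grouplikes, and inverting twice changes
  nothing.\<close>

lemma character_antipode_antipode:
  assumes "character g"
  shows "g (antipode (antipode x)) = g x"
proof -
  interpret G: group grouplikes by (rule group_dual_grouplikes)
  have "inv\<^bsub>grouplikes\<^esub> (inv\<^bsub>grouplikes\<^esub> g) = g"
    by (rule G.inv_inv) (simp add: carrier_dual_grouplikes assms)
  then show ?thesis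
    by (simp add: dual_grouplikes_inv assms character_antipode fun_eq_iff)
qed

end

section \<open>Outer automorphisms\<close>

lemma (in unital_algebra) group_Aut: "group (Aut scale)"
proof (rule groupI)
  fix f assume "f \<in> carrier (Aut scale)"
  then have f: "Vector_Spaces.linear scale scale f" "bij f" "f 1 = 1" "\<And>a b. f (a * b) = f a * f b"
    by (auto simp: Aut_def)
  let ?g = "inv_into UNIV f"
  have fg: "f (?g x) = x" for x using f(2) by (simp add: bij_is_surj surj_f_inv_f)
  have eq: "?g x = y" if "f y = x" for x y using f(2) that by (metis bij_inv_eq_iff)
  have "Vector_Spaces.linear scale scale ?g"
    unfolding lin_iff
    by (intro conjI allI vector_space_axioms eq) (simp_all add: linear_additive[OF f(1)] fg)
  moreover have "?g 1 = 1" "?g (a * b) = ?g a * ?g b" for a b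
    by (auto intro!: eq simp: f fg)
  moreover have "?g \<circ> f = id" using eq by auto
  ultimately show "\<exists>g\<in>carrier (Aut scale). g \<otimes>\<^bsub>Aut scale\<^esub> f = \<one>\<^bsub>Aut scale\<^esub>"
    using f(2) by (intro bexI[of _ ?g]) (simp_all add: Aut_def bij_imp_bij_inv)
qed (auto simp: Aut_def bij_comp lin_iff vector_space_axioms comp_assoc)

lemma (in unital_algebra) Inn_subset_Aut: "Inn \<subseteq> carrier (Aut scale)"
proof
  fix f assume "f \<in> (Inn :: ('r \<Rightarrow> 'r) set)"
  then obtain u v where f: "f = (\<lambda>r. v * r * u)" and uv: "u * v = 1" "v * u = 1" by (auto simp: Inn_def)
  have "f (a * b) = f a * f b" for a b
  proof -
    have "f a * f b = v * a * (u * v) * b * u" by (simp only: f mult.assoc)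
    then show ?thesis by (simp add: f uv mult.assoc)
  qed
  moreover have "bij f"
  proof (rule o_bij)
    show "(\<lambda>r. u * r * v) \<circ> f = id" "f \<circ> (\<lambda>r. u * r * v) = id"
      by (auto simp: fun_eq_iff f mult.assoc uv) (simp_all flip: mult.assoc add: uv)
  qed
  moreover have "lin scale f" unfolding f by (intro lin_mult_left lin_mult_right lin_id)
  ultimately show "f \<in> carrier (Aut scale)" by (simp add: Aut_def f uv)
qed

lemma (in unital_algebra) Inn_normal: "Inn \<lhd> Aut scale"
proof -
  interpret A: group "Aut scale" by (rule group_Aut)
  have sel: "monoid.mult (Aut scale) = (\<circ>)" "one (Aut scale) = id" by (simp_all add: Aut_def)
  have InnI: "f \<in> Inn" if "u * v = 1" "v * u = 1" "\<And>r. f r = v * r * u" for f :: "'r \<Rightarrow> 'r" and u v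
    using that by (auto simp: Inn_def)
  show ?thesis
    unfolding A.normal_inv_iff
  proof (intro conjI ballI A.subgroupI Inn_subset_Aut)
    have "id \<in> (Inn :: ('r \<Rightarrow> 'r) set)" by (rule InnI[of 1 1]) simp_all
    then show "Inn \<noteq> ({} :: ('r \<Rightarrow> 'r) set)" by blast
  next
    fix f g assume "f \<in> (Inn :: ('r \<Rightarrow> 'r) set)" "g \<in> (Inn :: ('r \<Rightarrow> 'r) set)"
    then obtain u v w z where f: "f = (\<lambda>r. v * r * u)" "u * v = 1" "v * u = 1"
      and g: "g = (\<lambda>r. z * r * w)" "w * z = 1" "z * w = 1" by (auto simp: Inn_def)
    have "(w * u) * (v * z) = w * (u * v) * z" "(v * z) * (w * u) = v * (z * w) * u" by (simp_all only: mult.assoc)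
    then show "f \<otimes>\<^bsub>Aut scale\<^esub> g \<in> Inn"
      by (intro InnI[of "w * u" "v * z"]) (simp_all add: f g sel mult.assoc)
  next
    fix f assume f': "f \<in> (Inn :: ('r \<Rightarrow> 'r) set)"
    then obtain u v where f: "f = (\<lambda>r. v * r * u)" "u * v = 1" "v * u = 1" by (auto simp: Inn_def)
    let ?g = "\<lambda>r. u * r * v"
    have g: "?g \<in> Inn" by (rule InnI[of v u]) (simp_all add: f)
    have "?g \<circ> f = id"
      by (auto simp: fun_eq_iff f mult.assoc) (simp_all flip: mult.assoc add: f)
    then have "inv\<^bsub>Aut scale\<^esub> f = ?g"
      by (intro A.inv_equality) (use f' g Inn_subset_Aut in \<open>auto simp: sel\<close>)
    then show "inv\<^bsub>Aut scale\<^esub> f \<in> Inn" using g by simp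
  next
    fix x h assume x: "x \<in> carrier (Aut scale)" and "h \<in> (Inn :: ('r \<Rightarrow> 'r) set)"
    then obtain u v where h: "h = (\<lambda>r. v * r * u)" "u * v = 1" "v * u = 1" by (auto simp: Inn_def)
    let ?y = "inv\<^bsub>Aut scale\<^esub> x"
    have xm: "x (a * b) = x a * x b" "x 1 = 1" for a b using x by (auto simp: Aut_def)
    have "x \<otimes>\<^bsub>Aut scale\<^esub> ?y = \<one>\<^bsub>Aut scale\<^esub>" by (rule A.r_inv[OF x])
    then have xy: "x (?y r) = r" for r by (simp add: sel fun_eq_iff)
    \<comment> \<open>Conjugating r \<mapsto> v r u by x gives r \<mapsto> x(v) r x(u), so the new
      unit is the image of the old one.\<close>
    have "x u * x v = 1" "x v * x u = 1" using h xm by metis+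
    then show "x \<otimes>\<^bsub>Aut scale\<^esub> h \<otimes>\<^bsub>Aut scale\<^esub> ?y \<in> Inn"
      by (intro InnI[of "x u" "x v"]) (simp_all add: sel h xm xy)
  qed
qed

lemma Aut_pow: "f [^]\<^bsub>Aut scale\<^esub> (n::nat) = f ^^ n"
  by (induction n) (simp_all add: Aut_def funpow_swap1 fun_eq_iff del: funpow.simps(2) add: funpow_Suc_right)

lemma (in unital_algebra) Out_class_pow_eq_one:
  assumes "f \<in> carrier (Aut scale)"
  shows "Out_class scale f [^]\<^bsub>Out scale\<^esub> (n::nat) = \<one>\<^bsub>Out scale\<^esub> \<longleftrightarrow> f ^^ n \<in> Inn"
proof -
  interpret A: group "Aut scale" by (rule group_Aut)
  interpret I: normal Inn "Aut scale" by (rule Inn_normal)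
  have "Out_class scale f [^]\<^bsub>Out scale\<^esub> n = Inn #>\<^bsub>Aut scale\<^esub> (f ^^ n)"
    unfolding Out_class_def Out_def by (simp add: I.FactGroup_pow assms Aut_pow)
  moreover have "f ^^ n \<in> carrier (Aut scale)" using A.nat_pow_closed[OF assms, of n] by (simp add: Aut_pow)
  ultimately show ?thesis
    unfolding Out_def using I.rcos_const[OF A.is_group] A.rcos_self[OF _ I.subgroup_axioms] by auto
qed

lemma (in unital_algebra) Out_class_closed:
  assumes "f \<in> carrier (Aut scale)"
  shows "Out_class scale f \<in> carrier (Out scale)"
  using assms by (simp add: Out_def Out_class_def carrier_FactGroup)

lemma (in unital_algebra) group_Out: "group (Out scale)"
  unfolding Out_def by (rule normal.factorgroup_is_group[OF Inn_normal])

section \<open>The Nakayama automorphism\<close>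

context finite_dimensional_hopf_algebra
begin

definition Lam :: 'b
  where "Lam = (SOME t. t \<noteq> 0 \<and> (\<forall>h. h * t = scale (counit h) t))"

lemma Lam_nonzero: "Lam \<noteq> 0" and Lam_left: "h * Lam = scale (counit h) Lam"
proof -
  have "\<exists>t. t \<noteq> 0 \<and> (\<forall>h. h * t = scale (counit h) t)"
    using trace_integral_nonzero trace_integral_left by blast
  from someI_ex[OF this] show "Lam \<noteq> 0" "h * Lam = scale (counit h) Lam"
    unfolding Lam_def by blast+
qed

definition lam :: "'b \<Rightarrow> 'a"
  where "lam = (SOME l. lin (*) l \<and> sw (\<lambda>a b. scale (l b) a) Lam = 1)"

lemma lam_linear: "lin (*) lam" and sw_lam: "sw (\<lambda>a b. scale (lam b) a) Lam = 1"
  using someI_ex[OF ex_dual_integral[OF Lam_left Lam_nonzero]] unfolding lam_def by blast+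

lemmas lam_facts = Lam_left Lam_nonzero lam_linear sw_lam
lemmas lam_Lam = dual_integral_apply[OF lam_facts]
lemmas antipode_lam = antipode_formula[OF lam_facts]
lemmas lam_nondegenerate = frobenius_nondegenerate[OF lam_facts]
lemmas lam_surj = frobenius_surj[OF lam_facts]
lemmas sw_antipode = antipode_comult[OF lam_facts]
lemmas lam_lins = lins lin_comp[OF lam_linear] lam_linear
lemmas lam_add = linear_additive[OF lam_linear]

lemma lam_cancel: "(\<And>x. lam (x * y) = lam (x * z)) \<Longrightarrow> y = z"
  using lam_nondegenerate[of "y - z"] by (simp add: right_diff_distrib lam_add)

text \<open>One-dimensionality of the left integrals: multiplied by y from the left, both sides have
  the same value \<epsilon>(y) \<lambda>(x) under \<lambda>, and the form is nondegenerate.\<close>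

lemma left_integral_eq:
  assumes "\<And>h. h * x = scale (counit h) x"
  shows "x = scale (lam x) Lam"
  by (rule lam_cancel) (simp add: assms Lam_left scale_mult_simps lam_add lam_Lam mult.commute)

text \<open>\<Lambda>h is again a left integral, hence a multiple of \<Lambda>; as
  \<lambda>(\<Lambda>) = 1, applying \<lambda> reads off the factor.\<close>

definition G :: "'b \<Rightarrow> 'a"
  where "G h = lam (Lam * h)"

lemma Lam_right: "Lam * h = scale (G h) Lam"
  unfolding G_def
  by (rule left_integral_eq) (simp add: Lam_left scale_mult_simps flip: mult.assoc)

lemma character_G: "character G"
proof -
  have "lin (*) G" unfolding G_def by (intro lam_lins)
  moreover have "G 1 = 1" by (simp add: G_def lam_Lam)
  moreover have "G (a * b) = G a * G b" for a b
  proof -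
    have "Lam * (a * b) = scale (G a) (scale (G b) Lam)"
      by (simp add: Lam_right scale_mult_simps flip: mult.assoc)
    then show ?thesis by (simp add: G_def[of "a * b"] lam_add lam_Lam)
  qed
  ultimately show ?thesis by (simp add: character_def)
qed

text \<open>The description quantifies over the integral t as well; every choice is a nonzero
  multiple of \<Lambda> and so yields the same functional.\<close>

lemma modular_element_eq: "modular_element scale counit = G"
  unfolding modular_element_def
proof (rule the_equality)
  show "lin (*) G \<and> (\<exists>t. t \<noteq> 0 \<and> left_integral scale counit t \<and> (\<forall>h. t * h = scale (G h) t))"
    using characterD(1)[OF character_G] Lam_nonzero Lam_left Lam_right by (auto simp: left_integral_def)
next
  fix g assume "lin (*) g \<and> (\<exists>t. t \<noteq> 0 \<and> left_integral scale counit t \<and> (\<forall>h. t * h = scale (g h) t))"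
  then obtain t where t: "t \<noteq> 0" "\<And>h. h * t = scale (counit h) t" "\<And>h. t * h = scale (g h) t"
    by (auto simp: left_integral_def)
  show "g = G"
  proof
    fix h
    have e: "t = scale (lam t) Lam" by (rule left_integral_eq[OF t(2)])
    have "scale (g h) t = scale (lam t) Lam * h" using t(3)[of h] e by simp
    also have "\<dots> = scale (G h) (scale (lam t) Lam)" by (simp add: scale_mult_simps Lam_right mult.commute)
    also have "\<dots> = scale (G h) t" using e by simp
    finally show "g h = G h" using t(1) by simp
  qed
qed

definition nakayama :: "'b \<Rightarrow> 'b"
  where "nakayama r = (SOME y. \<forall>x. lam (x * y) = lam (r * x))"

lemma lam_nakayama: "lam (r * x) = lam (x * nakayama r)"
proof -
  have "lin (*) (\<lambda>x. lam (r * x))" by (intro lam_lins)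
  from someI_ex[OF lam_surj[OF this]] show ?thesis unfolding nakayama_def by simp
qed

lemma nakayama_mult: "nakayama (r * s) = nakayama r * nakayama s"
proof (rule lam_cancel)
  fix x
  have "lam (x * nakayama (r * s)) = lam (r * (s * x))" by (simp flip: lam_nakayama add: mult.assoc)
  also have "\<dots> = lam (s * (x * nakayama r))" by (simp add: lam_nakayama[of r] mult.assoc)
  also have "\<dots> = lam (x * (nakayama r * nakayama s))" by (simp add: lam_nakayama[of s] mult.assoc)
  finally show "lam (x * nakayama (r * s)) = lam (x * (nakayama r * nakayama s))" .
qed

lemma nakayama_linear: "lin scale nakayama"
  unfolding lin_iff
proof (intro conjI allI vector_space_axioms; rule lam_cancel)
  fix a b x
  show "lam (x * nakayama (a + b)) = lam (x * (nakayama a + nakayama b))"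
    by (simp add: distrib_left distrib_right lam_add flip: lam_nakayama)
next
  fix k a x
  show "lam (x * nakayama (scale k a)) = lam (x * scale k (nakayama a))"
    by (simp add: scale_mult_simps lam_add flip: lam_nakayama)
qed

lemma nakayama_one: "nakayama 1 = 1"
  by (rule lam_cancel) (simp flip: lam_nakayama)

text \<open>The left winding endomorphism attached to the modular element; \<open>wind\<close> below
  acts on the other tensor factor.\<close>

definition left_wind :: "'b \<Rightarrow> 'b"
  where "left_wind h = sw (\<lambda>p q. scale (G p) q) h"

text \<open>The formula for the antipode with z moved to the right of the integral factor. By the
  defining property of \<open>nakayama\<close>, this makes Q after \<nu> equal to S.\<close>

definition Q :: "'b \<Rightarrow> 'b"
  where "Q z = sw (\<lambda>a b. scale (lam (b * z)) a) Lam"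

lemma Q_linear: "lin scale Q"
  unfolding Q_def by (intro lam_lins)

lemma Q_nakayama: "Q (nakayama x) = antipode x"
  by (simp add: Q_def antipode_lam[of x] lam_nakayama[of x])

text \<open>Start from h = \<Lambda>1 h \<lambda>(\<Lambda>2) and push h across by
  \<open>right_integral_shift\<close>; the scalar G(h1) and the factor S(h2) combine into S of the
  wound element.\<close>

lemma Q_antipode_wind: "Q (antipode (left_wind h)) = h"
proof -
  have "h = sw (\<lambda>a b. scale (lam b) (a * h)) Lam"
    using sw_mult_right[of "\<lambda>a b. scale (lam b) a" Lam h] by (simp add: sw_lam scale_mult_simps)
  also have "\<dots> = sw (\<lambda>p q. scale (G p) (sw (\<lambda>a b. scale (lam (b * antipode q)) a) Lam)) h"
    by (rule right_integral_shift[OF Lam_right characterD(1)[OF character_G], where s = scale and f = "\<lambda>a b. scale (lam b) a"])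
      (intro lam_lins)+
  also have "\<dots> = Q (antipode (left_wind h))"
    by (simp add: left_wind_def sw_scale_lin[OF antipode_linear] sw_scale_lin[OF Q_linear] flip: Q_def)
  finally show ?thesis ..
qed

lemma left_wind_linear: "lin scale left_wind"
  unfolding left_wind_def by (intro lin_sw_self lins)

text \<open>Q has a right inverse, so in finite dimension it is injective as well. Then S after
  \<open>left_wind\<close> is a two-sided inverse of Q, which gives injectivity of the winding and
  surjectivity of S; dimension supplies the rest.\<close>

lemma bij_antipode: "bij antipode" and bij_left_wind: "bij left_wind" and inj_Q: "inj Q"
proof -
  have "surj Q" using Q_antipode_wind by (rule surjI)
  then show Q: "inj Q" by (rule fd.linear_surj_imp_inj[OF Q_linear])
  have w: "inj left_wind" using Q_antipode_wind by (intro inj_on_inverseI[where g = "\<lambda>x. Q (antipode x)"]) simp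
  then show "bij left_wind"
    using fd.linear_inj_imp_surj[OF left_wind_linear] by (simp add: bij_def)
  have "antipode (left_wind (Q z)) = z" for z
    using Q Q_antipode_wind[of "Q z"] by (simp add: inj_eq)
  then have "surj antipode" by (rule surjI)
  then show "bij antipode"
    using fd.linear_surj_imp_inj[OF antipode_linear] by (simp add: bij_def)
qed

text \<open>Q takes the value S(x) on both sides, and Q is injective.\<close>

lemma nakayama_eq: "nakayama x = antipode (left_wind (antipode x))"
  using inj_Q Q_antipode_wind[of "antipode x"] Q_nakayama[of x] by (metis injD)

lemma ring_aut_nakayama: "ring_aut nakayama"
proof -
  have "bij (antipode \<circ> left_wind \<circ> antipode)" by (intro bij_comp bij_antipode bij_left_wind)
  moreover have "nakayama = antipode \<circ> left_wind \<circ> antipode" by (simp add: fun_eq_iff nakayama_eq)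
  ultimately have "bij nakayama" by simp
  then show ?thesis
    by (simp add: ring_aut_def nakayama_one nakayama_mult linear_additive[OF nakayama_linear])
qed

lemma nakayama_scale_one: "nakayama (scale k 1) = scale k 1"
  by (simp add: linear_additive[OF nakayama_linear] nakayama_one)

lemma dual_is_bimodule: "is_bimodule (dual_bimodule scale)"
  unfolding dual_bimodule_def
  by (intro is_bimodule.intro is_bimodule_axioms.intro comm_group_cong[OF comm_group_functionals[OF vector_space_axioms]])
    (auto simp: linear_functional_simps[OF vector_space_axioms] linear_additive distrib_left distrib_right mult.assoc
      intro: lin_comp[OF _ lin_mult_right[OF lin_id]] lin_comp[OF _ lin_mult_left[OF lin_id]])

text \<open>Send m to the functional a \<mapsto> \<lambda>(a m). The twist is what makes right
  actions match: \<lambda>(a m \<nu>(r)) = \<lambda>(r a m). Bijectivity is that of the Frobenius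
  form.\<close>

lemma twist_nakayama_iso_dual: "twist nakayama \<cong>\<^sub>b dual_bimodule scale"
proof -
  define f where "f m = (\<lambda>a. lam (a * m))" for m
  have sel: "carrier (dual_bimodule scale) = {f. lin (*) f}" by (simp add: dual_bimodule_def)
  have hom: "bimodule_hom (twist nakayama) (dual_bimodule scale) f"
    unfolding bimodule_hom_def
  proof (intro conjI homI allI ballI)
    show "f m \<in> carrier (dual_bimodule scale)" for m
      unfolding sel f_def by (rule CollectI) (intro lam_lins)
    show "f (m \<otimes>\<^bsub>twist nakayama\<^esub> n) = f m \<otimes>\<^bsub>dual_bimodule scale\<^esub> f n" for m n
      by (simp add: dual_bimodule_def f_def distrib_left lam_add)
    show "f (lact (twist nakayama) r m) = lact (dual_bimodule scale) r (f m)" for r m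
      by (simp add: dual_bimodule_def f_def mult.assoc)
    show "f (ract (twist nakayama) m r) = ract (dual_bimodule scale) (f m) r" for r m
      by (simp add: dual_bimodule_def f_def fun_eq_iff mult.assoc) (simp flip: mult.assoc lam_nakayama)
  qed
  have inj: "inj f"
  proof (rule injI)
    fix y z assume "f y = f z"
    then show "y = z" by (intro lam_cancel) (simp add: f_def fun_eq_iff)
  qed
  have surj: "\<exists>y. f y = p" if "lin (*) p" for p
    using lam_surj[OF that] by (auto simp: f_def fun_eq_iff)
  show ?thesis
  proof (rule bimodule_isoI[OF hom, where g = "inv_into UNIV f"])
    fix p assume "p \<in> carrier (dual_bimodule scale)"
    then have "p \<in> range f" using surj by (auto simp: sel)
    then show "f (inv_into UNIV f p) = p" by (rule f_inv_into_f)
  qed (simp_all add: inv_f_f[OF inj])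
qed

section \<open>Right winding maps and the powers of the Nakayama automorphism\<close>

definition wind :: "('b \<Rightarrow> 'a) \<Rightarrow> 'b \<Rightarrow> 'b"
  where "wind g x = sw (\<lambda>a b. scale (g b) a) x"

lemma wind_linear: "lin (*) g \<Longrightarrow> lin scale (wind g)"
  unfolding wind_def by (intro lin_sw_self lins)

text \<open>By coassociativity, right winding carries convolution to composition without reversing
  the order, so powers of a character become iterates.\<close>

lemma wind_wind:
  assumes "lin (*) g" "lin (*) h"
  shows "wind g (wind h x) = wind (convolution comul g h) x"
proof -
  have "wind g (wind h x) = sw (\<lambda>z c. sw (\<lambda>a b. scale (g b * h c) a) z) x"
    by (simp add: wind_def[of h] sw_scale_lin[OF wind_linear[OF assms(1)]]) (simp add: wind_def scale_sw mult.commute)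
  also have "\<dots> = sw (\<lambda>a z. sw (\<lambda>b c. scale (g b * h c) a) z) x"
    by (rule sw_coassoc[where s = scale]) (intro lins assms)+
  finally show ?thesis by (simp add: wind_def convolution_sw assms sw_scale)
qed

lemma wind_counit: "wind counit = id"
  by (simp add: fun_eq_iff wind_def sw_counit_right)

text \<open>A winding map determines its functional. This is how the power of \<gamma> is recovered
  from an iterate of \<nu>.\<close>

lemma counit_wind: "lin (*) g \<Longrightarrow> counit (wind g x) = g x"
  by (simp add: wind_def sw_scale_lin[OF counit_linear]) (simp add: mult.commute sw_scale_counit_left)

abbreviation \<gamma> :: "'b \<Rightarrow> 'a"
  where "\<gamma> \<equiv> \<lambda>x. G (antipode x)"

lemma character_\<gamma>: "character \<gamma>"
  by (rule character_antipode[OF character_G])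

text \<open>S reverses the coproduct, so left winding by G after S equals S after right winding by
  \<gamma>.\<close>

lemma nakayama_wind: "nakayama x = antipode (antipode (wind \<gamma> x))"
proof -
  have "left_wind (antipode x) = sw (\<lambda>a b. scale (\<gamma> b) (antipode a)) x"
    unfolding left_wind_def
    by (rule sw_antipode[where s = scale]) (intro lins characterD(1)[OF character_G])+
  then show ?thesis
    by (simp add: nakayama_eq wind_def sw_scale_lin[OF antipode_linear])
qed

text \<open>Two reversals show that the square of S respects the coproduct, and \<gamma> is
  unchanged by composition with that square.\<close>

lemma wind_antipode_antipode: "wind \<gamma> (antipode (antipode x)) = antipode (antipode (wind \<gamma> x))"
proof -
  note l = characterD(1)[OF character_\<gamma>]
  have "wind \<gamma> (antipode (antipode x)) = sw (\<lambda>a b. scale (\<gamma> (antipode a)) (antipode b)) (antipode x)"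
    unfolding wind_def by (rule sw_antipode[where s = scale]) (intro lins l)+
  also have "\<dots> = sw (\<lambda>a b. scale (\<gamma> (antipode (antipode b))) (antipode (antipode a))) x"
    by (rule sw_antipode[where s = scale]) (intro lins lin_comp[OF l])+
  finally show ?thesis
    by (simp add: character_antipode_antipode[OF character_\<gamma>] wind_def sw_scale_lin[OF antipode_linear])
qed

lemma nakayama_pow: "nakayama ^^ n = (antipode \<circ> antipode) ^^ n \<circ> wind (\<gamma> [^]\<^bsub>grouplikes\<^esub> n)"
proof (induction n)
  case 0
  show ?case by (simp add: dual_grouplikes_def wind_counit)
next
  case (Suc n)
  interpret D: group grouplikes by (rule group_dual_grouplikes)
  let ?pow = "\<gamma> [^]\<^bsub>grouplikes\<^esub> n"
  have "?pow \<in> carrier grouplikes"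
    by (rule D.nat_pow_closed) (simp add: carrier_dual_grouplikes character_\<gamma>)
  then have p: "character ?pow" by (simp add: carrier_dual_grouplikes)
  define A where "A = antipode \<circ> antipode"
  have A: "A y = antipode (antipode y)" for y by (simp add: A_def)
  have comm: "wind \<gamma> ((A ^^ n) x) = (A ^^ n) (wind \<gamma> x)" for x
    by (induction n) (simp_all add: wind_antipode_antipode A)
  have sel: "monoid.mult grouplikes = convolution comul"
    by (simp add: dual_grouplikes_def)
  \<comment> \<open>The induction adds the new winding on the outside, so the power is needed with
    the extra factor on the left.\<close>
  have Suc2: "convolution comul \<gamma> ?pow = \<gamma> [^]\<^bsub>grouplikes\<^esub> Suc n"
    using D.nat_pow_Suc2[of \<gamma> n] by (simp add: carrier_dual_grouplikes character_\<gamma> sel)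
  show ?case
    unfolding A_def[symmetric]
  proof
    fix x
    have "(nakayama ^^ Suc n) x = nakayama ((A ^^ n) (wind ?pow x))"
      by (simp add: Suc[folded A_def])
    also have "\<dots> = A ((A ^^ n) (wind \<gamma> (wind ?pow x)))"
      by (simp only: nakayama_wind comm A)
    also have "\<dots> = (A ^^ Suc n) (wind (convolution comul \<gamma> ?pow) x)"
      by (simp add: wind_wind[OF characterD(1)[OF character_\<gamma>] characterD(1)[OF p]])
    finally show "(nakayama ^^ Suc n) x = (A ^^ Suc n \<circ>
        wind (\<gamma> [^]\<^bsub>grouplikes\<^esub> Suc n)) x"
      by (simp only: Suc2 comp_apply)
  qed
qed

lemma antipode_antipode_Aut: "antipode \<circ> antipode \<in> carrier (Aut scale)"
  by (simp add: Aut_def bij_comp bij_antipode antipode_one antipode_mult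
      lin_iff vector_space_axioms antipode_add)

lemma nakayama_pow_inner:
  "nakayama ^^ n \<in> Inn \<longleftrightarrow> (antipode \<circ> antipode) ^^ n \<in> Inn \<and> 
    \<gamma> [^]\<^bsub>grouplikes\<^esub> n = counit"
proof -
  interpret D: group grouplikes by (rule group_dual_grouplikes)
  let ?pow = "\<gamma> [^]\<^bsub>grouplikes\<^esub> n"
  have "?pow \<in> carrier grouplikes"
    by (rule D.nat_pow_closed) (simp add: carrier_dual_grouplikes character_\<gamma>)
  then have p: "lin (*) ?pow" by (simp add: carrier_dual_grouplikes character_def)
  have "?pow = counit" if "nakayama ^^ n \<in> Inn"
  proof
    fix x
    obtain u v where uv: "nakayama ^^ n = (\<lambda>r. v * r * u)" "v * u = 1"
      using \<open>nakayama ^^ n \<in> Inn\<close> unfolding Inn_def by blast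
    have "counit v * counit u = 1" using uv(2) by (simp add: counit_one flip: counit_mult)
    then have "counit ((nakayama ^^ n) x) = counit x" by (simp add: uv(1) counit_mult algebra_simps)
    \<comment> \<open>The iterates of the square of S preserve the counit, so its value after
      \<nu>^n sees the winding alone.\<close>
    moreover have "counit (((antipode \<circ> antipode) ^^ n) y) = counit y" for y
      by (induction n) (simp_all add: counit_antipode)
    ultimately show "?pow x = counit x" by (simp add: nakayama_pow counit_wind[OF p])
  qed
  then show ?thesis by (auto simp: nakayama_pow wind_counit)
qed

end

theorem theoremA:
  fixes scale :: "'k::field \<Rightarrow> 'h::ring_1 \<Rightarrow> 'h"
    and comul :: "'h \<Rightarrow> ('h, 'h) tensor"
    and counit :: "'h \<Rightarrow> 'k"
    and S :: "'h \<Rightarrow> 'h"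
  assumes "finite_dimensional_hopf_algebra scale comul counit S"
  shows "group.ord (Pic scale) (iso_class scale (dual_bimodule scale)) =
    lcm (group.ord (Out scale) (Out_class scale (S \<circ> S)))
        (group.ord (dual_grouplikes scale comul counit) (modular_element scale counit))"
proof -
  interpret H: finite_dimensional_hopf_algebra scale comul counit S by fact
  interpret P: group "Pic scale" by (rule group_Pic[OF H.unital_algebra_axioms])
  interpret O: group "Out scale" by (rule H.group_Out)
  interpret D: group "dual_grouplikes scale comul counit" by (rule H.group_dual_grouplikes)
  let ?D = "dual_grouplikes scale comul counit"
  let ?\<gamma> = "\<lambda>x. H.G (S x)"
  note aut = H.ring_aut_nakayama and one = H.nakayama_scale_one and alg = H.unital_algebra_axioms
  have dual: "iso_class scale (dual_bimodule scale) = iso_class scale (twist H.nakayama)"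
    by (rule iso_class_cong[OF H.twist_nakayama_iso_dual, symmetric])
      (intro twist_is_bimodule aut H.dual_is_bimodule)+
  have nak: "iso_class scale (dual_bimodule scale) [^]\<^bsub>Pic scale\<^esub> n = \<one>\<^bsub>Pic scale\<^esub> \<longleftrightarrow> H.nakayama ^^ n \<in> Inn" for n :: nat
  proof -
    have autn: "ring_aut (H.nakayama ^^ n)" by (rule ring_aut_funpow[OF aut])
    have onen: "(H.nakayama ^^ n) (scale k 1) = scale k 1" for k by (induction n) (simp_all add: one)
    have "iso_class scale (dual_bimodule scale) [^]\<^bsub>Pic scale\<^esub> n = iso_class scale (twist (H.nakayama ^^ n))"
      unfolding dual by (rule Pic_pow_twist[OF aut one alg])
    moreover have "\<one>\<^bsub>Pic scale\<^esub> = iso_class scale (regular_bimodule :: ('h, 'h) bimodule)" by (simp add: Pic_def)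
    ultimately show ?thesis
      by (simp only: iso_class_eq_iff[OF inverse_pair_twist[OF autn onen alg] regular_is_bimodule] twist_iso_regular[OF autn])
  qed
  \<comment> \<open>A power of the inverse is the inverse of the power, and an inverse is trivial
    only with its element.\<close>
  have \<gamma>: "?\<gamma> [^]\<^bsub>?D\<^esub> n = counit \<longleftrightarrow> H.G [^]\<^bsub>?D\<^esub> n = \<one>\<^bsub>?D\<^esub>" for n :: nat
  proof -
    have G: "H.G \<in> carrier ?D" by (simp add: H.carrier_dual_grouplikes H.character_G)
    have "?\<gamma> [^]\<^bsub>?D\<^esub> n = inv\<^bsub>?D\<^esub> (H.G [^]\<^bsub>?D\<^esub> n)"
      using D.nat_pow_inv[OF G, of n] by (simp add: H.dual_grouplikes_inv H.character_G)
    moreover have "counit = \<one>\<^bsub>?D\<^esub>" by (simp add: dual_grouplikes_def)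
    ultimately show ?thesis
      using D.inv_eq_1_iff[OF D.nat_pow_closed[OF G], of n] by simp
  qed
  \<comment> \<open>\<open>ord\<close> divides n exactly when the n-th power is trivial, with 0
    standing for infinite order. The criterion for inner powers thus becomes a statement on
    divisors, which is the universal property of the least common multiple.\<close>
  have dvd: "P.ord (iso_class scale (dual_bimodule scale)) dvd n \<longleftrightarrow>
      O.ord (Out_class scale (S \<circ> S)) dvd n \<and> D.ord (modular_element scale counit) dvd n" for n
  proof -
    have "iso_class scale (dual_bimodule scale) \<in> carrier (Pic scale)"
      unfolding dual by (rule Pic_carrierI[OF inverse_pair_twist[OF aut one alg]])
    moreover have "Out_class scale (S \<circ> S) \<in> carrier (Out scale)"
      by (rule H.Out_class_closed[OF H.antipode_antipode_Aut])
    moreover have "modular_element scale counit \<in> carrier ?D"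
      by (simp add: H.modular_element_eq H.carrier_dual_grouplikes H.character_G)
    ultimately show ?thesis
      by (simp only: P.pow_eq_id[symmetric] O.pow_eq_id[symmetric] D.pow_eq_id[symmetric] nak
          H.Out_class_pow_eq_one[OF H.antipode_antipode_Aut] H.nakayama_pow_inner H.modular_element_eq \<gamma>)
  qed
  show ?thesis
  proof (rule dvd_antisym)
    show "P.ord (iso_class scale (dual_bimodule scale)) dvd
      lcm (O.ord (Out_class scale (S \<circ> S))) (D.ord (modular_element scale counit))"
      unfolding dvd by (intro conjI dvd_lcm1 dvd_lcm2)
    show "lcm (O.ord (Out_class scale (S \<circ> S))) (D.ord (modular_element scale counit)) dvd
      P.ord (iso_class scale (dual_bimodule scale))"
      using iffD1[OF dvd dvd_refl] by (intro lcm_least) (erule conjE, assumption)+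
  qed
qed

end
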